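(* Let $\mathcal{F}$ be a finite family of linear forms with non-zero integer coefficients, each form in at least three variables. Then $d_{\mathcal{F}}(\mathbb{Z}/p\mathbb{Z}) \to d_{\mathcal{F}}(\mathbb{R}/\mathbb{Z})$ as $p\to\infty$ over primes.
   Context: A linear form $L(x)=c_1x_1+\cdots+c_tx_t$ has non-zero integer coefficients. A subset $A$ of an abelian group $G$ is $L$-free if there is no $t$-tuple $x=(x_1,\dots,x_t)\in A^t$ with $L(x)=0$ (no exceptions for trivial solutions); $A$ is $\mathcal{F}$-free if it is $L$-free for every $L\in\mathcal{F}$. For a compact abelian group $G$ with normalized Haar measure $\mu$, $d_{\mathcal{F}}(G)=\sup\{\mu(A): A\subset G \text{ measurable and } \mathcal{F}\text{-free}\}$. In particular $d_{\mathcal{F}}(\mathbb{Z}/p\mathbb{Z})=\max\{|A|/p : A\subset \mathbb{Z}/p\mathbb{Z} \text{ is } \mathcal{F}\text{-free}\}$, and $\mathbb{R}/\mathbb{Z}$ is the circle group with Lebesgue (Haar) probability measure. *)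

theory Defs
  imports
    "HOL-Analysis.Analysis"
    "HOL-Algebra.FiniteProduct"
    "HOL-Algebra.Elementary_Groups"
    "HOL-Computational_Algebra.Primes"
begin

(* The linear form c_1 x_1 + ... + c_t x_t is represented by its list of integer
   coefficients [c_1, ..., c_t]; in particular t is the length of the list. *)

type_synonym linear_form = "int list"

definition nonzero_coeffs :: "linear_form \<Rightarrow> bool" where
  "nonzero_coeffs c \<longleftrightarrow> 0 \<notin> set c"

(* Abelian groups are those of HOL-Algebra, whose operations are written multiplicatively:
   the product of the powers x_i [^] c_i is the sum of the multiples c_i x_i. *)

definition form_value :: "('a, 'b) monoid_scheme \<Rightarrow> linear_form \<Rightarrow> 'a list \<Rightarrow> 'a" where
  "form_value G c x = finprod G (\<lambda>i. (x ! i) [^]\<^bsub>G\<^esub> (c ! i)) {..<length c}"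

definition form_free :: "('a, 'b) monoid_scheme \<Rightarrow> linear_form \<Rightarrow> 'a set \<Rightarrow> bool" where
  "form_free G c A \<longleftrightarrow>
     \<not> (\<exists>x. length x = length c \<and> set x \<subseteq> A \<and> form_value G c x = \<one>\<^bsub>G\<^esub>)"

definition family_free :: "('a, 'b) monoid_scheme \<Rightarrow> linear_form set \<Rightarrow> 'a set \<Rightarrow> bool" where
  "family_free G F A \<longleftrightarrow> (\<forall>c\<in>F. form_free G c A)"

(* M is meant to be the normalized Haar measure of the compact abelian group G. *)

definition max_density :: "linear_form set \<Rightarrow> ('a, 'b) monoid_scheme \<Rightarrow> 'a measure \<Rightarrow> real" where
  "max_density F G M = Sup {measure M A |A. A \<subseteq> carrier G \<and> A \<in> sets M \<and> family_free G F A}"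

definition real_group :: "real monoid" where
  "real_group = \<lparr>carrier = UNIV, monoid.mult = (+), one = 0\<rparr>"

definition circle_group :: "real set monoid" where
  "circle_group = real_group Mod \<int>"

(* The Haar probability measure on R/Z: the image of Lebesgue measure on the fundamental domain
   [0,1) under the quotient map. A set A of cosets is measurable iff its preimage in R under
   the quotient map, which is the union of the cosets in A, is Lebesgue measurable. *)

definition circle_measure :: "real set measure" where
  "circle_measure =
     distr (lebesgue_on {0..<1})
       (sigma (carrier circle_group)
          {A. A \<subseteq> carrier circle_group \<and> \<Union>A \<in> sets lebesgue})
       (\<lambda>x. \<int> #>\<^bsub>real_group\<^esub> x)"

definition haar_mod :: "nat \<Rightarrow> int measure" where
  "haar_mod n = uniform_count_measure (carrier (integer_mod_group n))"

abbreviation density_mod :: "linear_form set \<Rightarrow> nat \<Rightarrow> real" where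
  "density_mod F n \<equiv> max_density F (integer_mod_group n) (haar_mod n)"

abbreviation density_circle :: "linear_form set \<Rightarrow> real" where
  "density_circle F \<equiv> max_density F circle_group circle_measure"

(* The two groups are abelian groups, and the two measures are translation-invariant
   probability measures on them. *)

lemma real_group_simps [simp]:
  "carrier real_group = UNIV" "x \<otimes>\<^bsub>real_group\<^esub> y = x + y" "\<one>\<^bsub>real_group\<^esub> = 0"
  by (simp_all add: real_group_def)

lemma comm_group_real_group [simp]: "comm_group real_group"
proof (rule comm_groupI)
  fix x :: real
  show "\<exists>y\<in>carrier real_group. y \<otimes>\<^bsub>real_group\<^esub> x = \<one>\<^bsub>real_group\<^esub>"
    by (intro bexI[of _ "-x"]) simp_all
qed (simp_all add: algebra_simps)

lemma inv_real_group [simp]: "inv\<^bsub>real_group\<^esub> x = - x"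
  by (rule group.inv_equality[OF comm_group.axioms(2)[OF comm_group_real_group]]) simp_all

lemma Ints_subgroup_real: "subgroup \<int> real_group"
  by (rule group.subgroupI[OF comm_group.axioms(2)[OF comm_group_real_group]]) (auto intro: exI[of _ 0])

lemma comm_group_circle_group: "comm_group circle_group"
  unfolding circle_group_def
  by (rule comm_group.abelian_FactGroup[OF comm_group_real_group Ints_subgroup_real])

lemma coset_eq: "\<int> #>\<^bsub>real_group\<^esub> (x::real) = {y. y - x \<in> \<int>}"
proof -
  have "y \<in> \<int> #>\<^bsub>real_group\<^esub> x" if "y - x \<in> \<int>" for y
    using that unfolding r_coset_def by (auto intro!: bexI[of _ "y - x"])
  then show ?thesis by (auto simp: r_coset_def)
qed

lemma carrier_circle_group:
  "carrier circle_group = range (\<lambda>x::real. {y. y - x \<in> \<int>})"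
  by (simp add: circle_group_def carrier_FactGroup coset_eq)

lemma coset_eqI:
  assumes "(x::real) - x' \<in> \<int>"
  shows "{y. y - x \<in> \<int>} = {y. y - x' \<in> \<int>}"
proof -
  have "y - x \<in> \<int> \<longleftrightarrow> y - x' \<in> \<int>" for y
    using Ints_add[OF _ assms, of "y - x"] Ints_diff[OF _ assms, of "y - x'"] by force
  then show ?thesis by blast
qed

lemma coset_mem_iff:
  assumes "A \<subseteq> carrier circle_group"
  shows "{y. y - x \<in> \<int>} \<in> A \<longleftrightarrow> x \<in> \<Union>A"
proof
  assume "{y. y - x \<in> \<int>} \<in> A"
  moreover have "x \<in> {y. y - x \<in> \<int>}" by simp
  ultimately show "x \<in> \<Union>A" by blast
next
  assume "x \<in> \<Union>A"
  then obtain C where C: "C \<in> A" "x \<in> C" by blast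
  then obtain x' where x': "C = {y. y - x' \<in> \<int>}"
    using assms by (auto simp: carrier_circle_group)
  with C show "{y. y - x \<in> \<int>} \<in> A" using coset_eqI[of x x'] by simp
qed

lemma Union_periodic:
  assumes "A \<subseteq> carrier circle_group" "x - y \<in> \<int>"
  shows "x \<in> \<Union>A \<longleftrightarrow> y \<in> \<Union>A"
  using coset_mem_iff[OF assms(1)] coset_eqI[OF assms(2)] by metis

lemma sigma_algebra_circle:
  "sigma_algebra (carrier circle_group) {A. A \<subseteq> carrier circle_group \<and> \<Union>A \<in> sets lebesgue}"
  (is "sigma_algebra ?C ?S")
proof -
  have "\<Union>(?C - A) = UNIV - \<Union>A" if "A \<subseteq> ?C" for A
  proof -
    have "?C - A \<subseteq> ?C" by blast
    then have "x \<in> \<Union>(?C - A) \<longleftrightarrow> {y. y - x \<in> \<int>} \<in> ?C - A" for x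
      by (rule coset_mem_iff[symmetric])
    moreover have "{y. y - x \<in> \<int>} \<in> ?C" for x :: real
      by (simp add: carrier_circle_group)
    ultimately show ?thesis using coset_mem_iff[OF that] by blast
  qed
  moreover have "UNIV - \<Union>A \<in> sets lebesgue" if "\<Union>A \<in> sets lebesgue" for A :: "real set set"
    using sets.compl_sets[OF that] by simp
  moreover have "\<Union>(\<Union>i. A i) \<in> sets lebesgue"
    if "range A \<subseteq> ?S" for A :: "nat \<Rightarrow> real set set"
  proof -
    have "\<Union>(\<Union>i. A i) = (\<Union>i. \<Union>(A i))" by blast
    with that show ?thesis by (simp only:) (rule sets.countable_UN, blast)
  qed
  ultimately show ?thesis
    unfolding sigma_algebra_iff2 by (simp add: subset_eq)
qed

lemma space_circle_measure [simp]: "space circle_measure = carrier circle_group"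
  by (simp add: circle_measure_def space_measure_of_conv)

lemma sets_circle_measure:
  "sets circle_measure = {A. A \<subseteq> carrier circle_group \<and> \<Union>A \<in> sets lebesgue}"
  using sigma_algebra.sigma_sets_eq[OF sigma_algebra_circle]
  by (simp add: circle_measure_def sets_measure_of_conv) (use sigma_algebra_circle in blast)

lemma emeasure_circle_measure:
  assumes "A \<in> sets circle_measure"
  shows "emeasure circle_measure A = emeasure lebesgue (\<Union>A \<inter> {0..<1})"
proof -
  let ?N = "sigma (carrier circle_group)
          {A. A \<subseteq> carrier circle_group \<and> \<Union>A \<in> sets lebesgue}"
  let ?q = "\<lambda>x. \<int> #>\<^bsub>real_group\<^esub> (x::real)"
  have sN: "sets ?N = sets circle_measure" by (simp add: circle_measure_def)
  have vim: "?q -` B \<inter> {0..<1} = \<Union>B \<inter> {0..<1}" if "B \<subseteq> carrier circle_group" for B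
    using coset_mem_iff[OF that] by (auto simp: coset_eq)
  have q: "?q \<in> lebesgue_on {0..<1} \<rightarrow>\<^sub>M ?N"
  proof (rule measurable_measure_of)
    fix B assume "B \<in> {A. A \<subseteq> carrier circle_group \<and> \<Union>A \<in> sets lebesgue}"
    then show "?q -` B \<inter> space (lebesgue_on {0..<1}) \<in> sets (lebesgue_on {0..<1})"
      using vim[of B] by (auto simp: space_restrict_space sets_restrict_space)
  qed (auto simp: coset_eq carrier_circle_group)
  have "A \<subseteq> carrier circle_group" "\<Union>A \<in> sets lebesgue"
    using assms by (auto simp: sets_circle_measure)
  moreover have "emeasure circle_measure A
      = emeasure (lebesgue_on {0..<1}) (?q -` A \<inter> space (lebesgue_on {0..<1}))"
    unfolding circle_measure_def by (rule emeasure_distr[OF q]) (use assms sN in blast)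
  ultimately show ?thesis
    using vim[of A] by (simp add: space_restrict_space emeasure_restrict_space)
qed

lemma prob_space_circle_measure: "emeasure circle_measure (space circle_measure) = 1"
proof -
  have "\<Union>(carrier circle_group) = UNIV" by (auto simp: carrier_circle_group) 
  then show ?thesis
    using emeasure_circle_measure[OF sets.top] by simp
qed

lemma circle_measure_translation_invariant:
  assumes g: "g \<in> carrier circle_group" and A: "A \<in> sets circle_measure"
  shows "g <#\<^bsub>circle_group\<^esub> A \<in> sets circle_measure"
    and "emeasure circle_measure (g <#\<^bsub>circle_group\<^esub> A) = emeasure circle_measure A"
proof -
  have AC: "A \<subseteq> carrier circle_group" and mU: "\<Union>A \<in> sets lebesgue"
    using A by (auto simp: sets_circle_measure)
  obtain s :: real where s: "g = {y. y - s \<in> \<int>}"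
    using g by (auto simp: carrier_circle_group)
  define t where "t = frac s"
  have "s - t \<in> \<int>" by (simp add: t_def frac_def)
  then have gt: "g = {y. y - t \<in> \<int>}" using s coset_eqI by blast
  have t: "0 \<le> t" "t < 1" by (auto simp: t_def frac_lt_1)
  define U where "U = \<Union>A"
  have per: "x \<in> U \<longleftrightarrow> y \<in> U" if "x - y \<in> \<int>" for x y
    using Union_periodic[OF AC that] by (simp add: U_def)
  have GA: "g <#\<^bsub>circle_group\<^esub> A \<subseteq> carrier circle_group"
    using group.l_coset_subset_G[OF comm_group.axioms(2)[OF comm_group_circle_group] AC g] .
  have UU: "\<Union>(g <#\<^bsub>circle_group\<^esub> A) = (+) t ` U"
  proof -
    have "\<Union>(g <#\<^bsub>circle_group\<^esub> A) = {a + u |a u. a - t \<in> \<int> \<and> u \<in> U}"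
      unfolding U_def by (auto simp: l_coset_def circle_group_def set_mult_def gt) 
    also have "\<dots> = (+) t ` U"
    proof (intro equalityI subsetI)
      fix z assume "z \<in> {a + u |a u. a - t \<in> \<int> \<and> u \<in> U}"
      then obtain a u where z: "z = a + u" "a - t \<in> \<int>" "u \<in> U" by blast
      then have "a - t + u \<in> U" using per[of "a - t + u" u] by simp
      then show "z \<in> (+) t ` U" by (intro image_eqI[of _ _ "a - t + u"]) (auto simp: z)
    next
      fix z assume "z \<in> (+) t ` U"
      then obtain u where "z = t + u" "u \<in> U" by blast
      then show "z \<in> {a + u |a u. a - t \<in> \<int> \<and> u \<in> U}"
        by (intro CollectI exI[of _ t] exI[of _ u]) simp
    qed
    finally show ?thesis .
  qed
  have mU': "U \<in> sets lebesgue" using mU by (simp add: U_def)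
  show 1: "g <#\<^bsub>circle_group\<^esub> A \<in> sets circle_measure"
    using GA UU lebesgue_sets_translation[OF mU', of t] by (simp add: sets_circle_measure)
  have shift: "emeasure lebesgue ((+) r ` S) = emeasure lebesgue S" for r :: real and S
  proof -
    have "(+) r = (\<lambda>x. r + 1 *\<^sub>R x)" by auto
    then show ?thesis using emeasure_lebesgue_affine[of 1 r S] by (simp add: add.commute)
  qed
  define P where "P = U \<inter> {0..<1-t}"
  define Q where "Q = U \<inter> {1-t..<1}"
  have m: "P \<in> sets lebesgue" "Q \<in> sets lebesgue" using mU' by (auto simp: P_def Q_def)
  have tr: "(+) r ` S \<in> sets lebesgue" if "S \<in> sets lebesgue" for r :: real and S
    using lebesgue_sets_translation[OF that, of r] .
  have "(+) t ` U \<inter> {0..<1} = (+) t ` P \<union> (+) (t - 1) ` Q"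
  proof (intro equalityI subsetI)
    fix z assume z: "z \<in> (+) t ` U \<inter> {0..<1}"
    then have zU: "z - t \<in> U" by auto
    show "z \<in> (+) t ` P \<union> (+) (t - 1) ` Q"
    proof (cases "z < t")
      case True
      have "z - t + 1 \<in> U" using zU per[of "z - t + 1" "z - t"] by simp
      then show ?thesis using True z
        by (intro UnI2 image_eqI[of _ _ "z - t + 1"]) (auto simp: Q_def)
    next
      case False
      then show ?thesis using zU z
        by (intro UnI1 image_eqI[of _ _ "z - t"]) (auto simp: P_def)
    qed
  next
    fix z assume "z \<in> (+) t ` P \<union> (+) (t - 1) ` Q"
    then show "z \<in> (+) t ` U \<inter> {0..<1}"
    proof
      assume "z \<in> (+) t ` P" then show ?thesis using t by (auto simp: P_def)
    next
      assume "z \<in> (+) (t - 1) ` Q"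
      then obtain u where u: "z = t - 1 + u" "u \<in> U" "1 - t \<le> u" "u < 1"
        by (auto simp: Q_def)
      then have "u - 1 \<in> U" using per[of "u - 1" u] by simp
      then show ?thesis using u t by (intro IntI image_eqI[of _ _ "u - 1"]) auto
    qed
  qed
  moreover have "(+) t ` P \<inter> (+) (t - 1) ` Q = {}" by (auto simp: P_def Q_def)
  ultimately have "emeasure lebesgue ((+) t ` U \<inter> {0..<1})
      = emeasure lebesgue P + emeasure lebesgue Q"
    using plus_emeasure[OF tr[OF m(1)] tr[OF m(2)], of t "t - 1"] by (simp only: shift)
  also have "\<dots> = emeasure lebesgue (P \<union> Q)"
    by (rule plus_emeasure[OF m]) (auto simp: P_def Q_def)
  also have "P \<union> Q = U \<inter> {0..<1}" using t by (auto simp: P_def Q_def)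
  finally show "emeasure circle_measure (g <#\<^bsub>circle_group\<^esub> A) = emeasure circle_measure A"
    using emeasure_circle_measure[OF 1] emeasure_circle_measure[OF A] by (simp add: UU U_def)
qed

lemma measure_haar_mod:
  assumes "n > 0" "A \<subseteq> carrier (integer_mod_group n)"
  shows "measure (haar_mod n) A = real (card A) / real n"
  using assms by (simp add: haar_mod_def measure_uniform_count_measure carrier_integer_mod_group)

lemma density_mod_eq_Max:
  assumes "n > 0" and "\<forall>c\<in>F. c \<noteq> []"
  shows "density_mod F n =
    Max {real (card A) / real n |A. A \<subseteq> carrier (integer_mod_group n)
           \<and> family_free (integer_mod_group n) F A}" (is "_ = Max ?S")
proof -
  have "max_density F (integer_mod_group n) (haar_mod n) = Sup ?S"
  proof -
    have "A \<in> sets (haar_mod n)" if "A \<subseteq> carrier (integer_mod_group n)" for A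
      using that by (simp add: haar_mod_def sets_uniform_count_measure)
    then show ?thesis
      unfolding max_density_def
      by (intro arg_cong[where f = Sup] Collect_cong ex_cong1)
        (use measure_haar_mod[OF assms(1)] in \<open>metis (no_types)\<close>)
  qed
  moreover have "finite ?S"
  proof (rule finite_subset)
    show "?S \<subseteq> (\<lambda>A. real (card A) / real n) ` Pow (carrier (integer_mod_group n))" by blast
    show "finite ((\<lambda>A. real (card A) / real n) ` Pow (carrier (integer_mod_group n)))"
      using assms(1) by (simp add: carrier_integer_mod_group)
  qed
  moreover have "?S \<noteq> {}"
    using assms(2) by (auto simp: family_free_def form_free_def intro!: exI[of _ "{}"])
  ultimately show ?thesis by (simp add: cSup_eq_Max)
qed

end

theory Submission
  imports Defs "HOL-Number_Theory.Cong" "HOL-Real_Asymp.Real_Asymp"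
begin

text \<open>
  Lower bound: a measurable solution-free subset of the circle contains a compact set \<open>K\<close> of almost
  full measure. The values of a form on \<open>K\<close> stay at a positive distance from the integers, so for
  large \<open>p\<close> the residues \<open>b\<close> such that \<open>K\<close> meets \<open>[b/p, (b+1)/p)\<close> form a solution-free set.

  Upper bound: a solution-free \<open>A\<close> in \<open>\<int>/p\<close> has a subset \<open>B\<close> of almost the same size that is robustly
  free, that is, \<open>L(x)\<close> avoids on \<open>B\<close> a whole Bohr set of bounded rank and width around \<open>0\<close>. Here \<open>B\<close>
  consists of the points of \<open>A\<close> around which \<open>A\<close> has positive density and is Fourier-uniform on a
  Bohr set, with scales supplied by an energy pigeonhole argument. If \<open>L(x)\<close> is almost \<open>0\<close> on such
  points, perturbing three coordinates produces a solution in \<open>A\<close>; this is where forms in at least three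
  variables are needed. Multiplication by a suitable \<open>\<mu>\<close> sends a bounded interval around \<open>0\<close> into the
  Bohr set, so the union of the arcs \<open>[b/p, (b+1)/p)\<close> with \<open>\<mu> b \<in> B\<close> is solution-free in the circle.

  Bohr sets are handled through the kernels \<open>|\<Sum>\<^sub>s\<^sub>\<in>\<^sub>S e(s x)|\<^sup>2 / |S|\<close> for almost invariant sets \<open>S\<close> of
  frequencies, which makes no removal lemma and no regularity of Bohr sets necessary.
\<close>

section \<open>Fourier analysis on cyclic groups\<close>

text \<open>Three variables matter for the Fourier bound: a trilinear count is at most the largest
  Fourier coefficient of one function times a sum over frequencies for the other two, and Parseval
  bounds that sum by 1. With two variables Parseval uses up both factors and nothing small is left.
  The obstacle is the order of the parameters. Localising the count to scales \<open>Sb\<close> and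
  \<open>Sn\<close> multiplies the Fourier error by \<open>card Sb * card Sn\<close>, so the fine
  scale at which the set looks uniform must be chosen after these two, while the density is read off
  at a coarse scale chosen before them. The energy argument finds a step in a chain of scales at
  which coarse and fine smoothing agree in mean square. The final dilation is harmless because forms
  are homogeneous, so the frequencies of the Bohr set, of which only the number is controlled, can
  be traded for an interval. An interval is what is needed, since rounding p x to an integer in each
  coordinate changes the value of a form by a bounded amount.\<close>

locale cyclic =
  fixes p :: nat
  assumes p_pos: "p > 0"
begin

definition avg :: "(int \<Rightarrow> 'a::real_normed_field) \<Rightarrow> 'a" where
  "avg h = (\<Sum>x\<in>{0..<int p}. h x) / of_nat p"

text \<open>Functions on Z/p are represented by periodic functions on the integers, so that
  translates and dilates are plain compositions; reduction mod p appears mainly where membership in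
  a subset of \<open>{0..<int p}\<close> is asked.\<close>

definition periodic :: "(int \<Rightarrow> 'a) \<Rightarrow> bool" where
  "periodic h \<longleftrightarrow> (\<forall>x. h (x mod int p) = h x)"

lemma periodicD: "periodic h \<Longrightarrow> h (x mod int p) = h x"
  by (simp add: periodic_def)

lemma periodic_cong: "periodic h \<Longrightarrow> x mod int p = y mod int p \<Longrightarrow> h x = h y"
  by (metis periodic_def)

lemma periodic_affine:
  assumes "periodic h"
  shows "periodic (\<lambda>x. h (m * x + a))"
  unfolding periodic_def
proof
  fix x
  show "h (m * (x mod int p) + a) = h (m * x + a)"
    by (rule periodic_cong[OF assms]) (metis mod_add_left_eq mod_mult_right_eq)
qed

lemma periodic_shift: "periodic h \<Longrightarrow> periodic (\<lambda>x. h (a + x))"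
  using periodic_affine[of h 1 a] by (simp add: add.commute)

lemma periodic_dilate: "periodic h \<Longrightarrow> periodic (\<lambda>x. h (a + m * x))"
  using periodic_affine[of h m a] by (simp add: add.commute)

lemma periodic_comp: "periodic h \<Longrightarrow> periodic (\<lambda>x. f (h x))"
  by (simp add: periodic_def)

lemma periodic_comp2: "periodic h \<Longrightarrow> periodic k \<Longrightarrow> periodic (\<lambda>x. f (h x) (k x))"
  by (simp add: periodic_def)

lemma avg_affine:
  assumes "periodic h" "coprime m (int p)"
  shows "avg (\<lambda>x. h (m * x + a)) = avg h"
proof -
  let ?f = "\<lambda>x. (m * x + a) mod int p"
  have inj: "inj_on ?f {0..<int p}"
  proof (rule inj_onI)
    fix x y assume xy: "x \<in> {0..<int p}" "y \<in> {0..<int p}" "?f x = ?f y"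
    then have "int p dvd m * x + a - (m * y + a)" by (simp add: mod_eq_dvd_iff)
    then have "int p dvd m * (x - y)" by (simp add: algebra_simps)
    then have "int p dvd x - y"
      using assms(2) by (simp add: coprime_commute coprime_dvd_mult_right_iff)
    then have "x mod int p = y mod int p" by (simp add: mod_eq_dvd_iff)
    then show "x = y" using xy by simp
  qed
  have sub: "?f ` {0..<int p} \<subseteq> {0..<int p}" using p_pos by auto
  have "bij_betw ?f {0..<int p} {0..<int p}"
    using inj endo_inj_surj[OF _ sub inj] by (simp add: bij_betw_def)
  then have "(\<Sum>x\<in>{0..<int p}. h (?f x)) = (\<Sum>x\<in>{0..<int p}. h x)"
    by (rule sum.reindex_bij_betw)
  then show ?thesis using periodicD[OF assms(1)] by (simp add: avg_def)
qed

lemma avg_shift: "periodic h \<Longrightarrow> avg (\<lambda>x. h (a + x)) = avg h"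
  using avg_affine[of h 1 a] by (simp add: add.commute)

lemma avg_dilate: "periodic h \<Longrightarrow> coprime m (int p) \<Longrightarrow> avg (\<lambda>x. h (a + m * x)) = avg h"
  using avg_affine[of h m a] by (simp add: add.commute)

lemma avg_reflect: "periodic h \<Longrightarrow> avg (\<lambda>x. h (a - x)) = avg h"
  using avg_dilate[of h "-1" a] by simp

lemma avg_const [simp]: "avg (\<lambda>_. c) = c"
  using p_pos by (simp add: avg_def)

lemma avg_add: "avg (\<lambda>x. f x + g x) = avg f + avg g"
  by (simp add: avg_def sum.distrib add_divide_distrib)

lemma avg_diff: "avg (\<lambda>x. f x - g x) = avg f - avg g"
  by (simp add: avg_def sum_subtractf diff_divide_distrib)

lemma avg_cmult: "avg (\<lambda>x. c * f x) = c * avg f"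
  by (simp add: avg_def sum_distrib_left)

lemma avg_cmult_right: "avg (\<lambda>x. f x * c) = avg f * c"
  by (simp add: avg_def sum_distrib_right)

lemma avg_divide: "avg (\<lambda>x. f x / c) = avg f / c"
  by (simp add: avg_def sum_divide_distrib mult.commute)

lemma avg_sum: "avg (\<lambda>x. \<Sum>i\<in>I. f i x) = (\<Sum>i\<in>I. avg (f i))"
  by (simp add: avg_def sum.swap[of _ I] sum_divide_distrib)

lemma avg_swap: "avg (\<lambda>x. avg (\<lambda>y. f x y)) = avg (\<lambda>y. avg (\<lambda>x. f x y))"
  by (simp add: avg_def sum_divide_distrib[symmetric] sum.swap[of f])

lemma avg_mono:
  fixes f g :: "int \<Rightarrow> real"
  shows "(\<And>x. f x \<le> g x) \<Longrightarrow> avg f \<le> avg g"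
  by (simp add: avg_def divide_right_mono sum_mono)

lemma avg_nonneg:
  fixes f :: "int \<Rightarrow> real"
  shows "(\<And>x. 0 \<le> f x) \<Longrightarrow> 0 \<le> avg f"
  using avg_mono[of "\<lambda>_. 0" f] by simp

lemma norm_avg_le: "norm (avg f) \<le> avg (\<lambda>x. norm (f x))"
  by (simp add: avg_def norm_divide divide_right_mono norm_sum)

lemma abs_avg_le:
  fixes f :: "int \<Rightarrow> real"
  shows "\<bar>avg f\<bar> \<le> avg (\<lambda>x. \<bar>f x\<bar>)"
  using norm_avg_le[of f] by simp

lemma avg_of_real: "avg (\<lambda>x. of_real (f x)) = of_real (avg f)"
  by (simp add: avg_def)

lemma avg_mono_on:
  fixes f :: "int \<Rightarrow> real"
  assumes "\<And>x. x \<in> {0..<int p} \<Longrightarrow> f x \<le> g x"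
  shows "avg f \<le> avg g"
  unfolding avg_def by (intro divide_right_mono sum_mono assms) simp_all

section \<open>Characters and the Fourier transform\<close>

definition chi :: "int \<Rightarrow> complex" where
  "chi n = cis (2 * pi * of_int n / of_nat p)"

lemma chi_0 [simp]: "chi 0 = 1" by (simp add: chi_def)

lemma chi_add: "chi (m + n) = chi m * chi n"
  by (simp add: chi_def cis_mult ring_distribs add_divide_distrib)

lemma chi_minus: "chi (- n) = cnj (chi n)"
  by (simp add: chi_def cis_cnj)

lemma chi_diff: "chi (m - n) = chi m * cnj (chi n)"
  using chi_add[of m "-n"] by (simp add: chi_minus)

lemma norm_chi [simp]: "cmod (chi n) = 1" by (simp add: chi_def)

lemma chi_eq_1_iff: "chi n = 1 \<longleftrightarrow> int p dvd n"
proof -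
  have "chi n = 1 \<longleftrightarrow> (\<exists>k::int. 2 * pi * of_int n / of_nat p = of_int (2 * k) * pi)"
    unfolding chi_def cis_conv_exp by (subst exp_eq_1) auto
  also have "\<dots> \<longleftrightarrow> (\<exists>k::int. n = int p * k)"
  proof (rule ex_cong1)
    fix k :: int
    have "2 * pi * of_int n / of_nat p = of_int (2 * k) * pi \<longleftrightarrow> real_of_int n = real p * of_int k"
      using p_pos by (auto simp: field_simps)
    also have "\<dots> \<longleftrightarrow> n = int p * k"
      by (metis of_int_eq_iff of_int_mult of_int_of_nat_eq)
    finally show "(2 * pi * of_int n / of_nat p = of_int (2 * k) * pi) = (n = int p * k)" .
  qed
  finally show ?thesis by (auto simp: dvd_def)
qed

lemma chi_cong: "m mod int p = n mod int p \<Longrightarrow> chi m = chi n"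
proof -
  assume "m mod int p = n mod int p"
  then have "chi (m - n) = 1" by (simp add: chi_eq_1_iff mod_eq_dvd_iff)
  then show ?thesis using chi_add[of "m - n" n] by simp
qed

lemma periodic_chi: "periodic (\<lambda>x. chi (r * x))"
  unfolding periodic_def by (auto intro!: chi_cong simp: mod_mult_right_eq)

lemma periodic_chi_freq: "periodic (\<lambda>r. chi (r * x))"
  using periodic_chi[of x] by (simp add: mult.commute)

lemma avg_chi: "avg (\<lambda>x. chi (r * x)) = (if int p dvd r then 1 else 0)"
proof (cases "int p dvd r")
  case True
  then have "chi (r * x) = 1" for x by (simp add: chi_eq_1_iff)
  then show ?thesis using True by simp
next
  case False
  have "avg (\<lambda>x. chi (r * (1 + x))) = avg (\<lambda>x. chi (r * x))"
    by (rule avg_shift[OF periodic_chi])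
  moreover have "avg (\<lambda>x. chi (r * (1 + x))) = chi r * avg (\<lambda>x. chi (r * x))"
    by (simp add: distrib_left chi_add avg_cmult)
  ultimately have "(chi r - 1) * avg (\<lambda>x. chi (r * x)) = 0" by (simp add: algebra_simps)
  then show ?thesis using False by (simp add: chi_eq_1_iff)
qed

definition fourier :: "(int \<Rightarrow> complex) \<Rightarrow> int \<Rightarrow> complex" where
  "fourier h r = avg (\<lambda>x. h x * chi (- (r * x)))"

lemma periodic_fourier: "periodic (fourier h)"
proof -
  have "periodic (\<lambda>r. chi (- (r * x)))" for x
    using periodic_chi_freq[of "-x"] by simp
  then show ?thesis by (simp add: periodic_def fourier_def)
qed

lemma fourier_inversion:
  assumes "periodic h"
  shows "h x = (\<Sum>r\<in>{0..<int p}. fourier h r * chi (r * x))"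
proof -
  have *: "(\<Sum>r\<in>{0..<int p}. chi (r * n)) = (if int p dvd n then of_nat p else 0)" for n
    using avg_chi[of n] p_pos
    by (auto simp: avg_def mult.commute field_simps split: if_splits)
  have "(\<Sum>r\<in>{0..<int p}. fourier h r * chi (r * x))
      = (\<Sum>r\<in>{0..<int p}. avg (\<lambda>y. h y * chi (r * (x - y))))"
    by (simp add: fourier_def avg_cmult[symmetric] right_diff_distrib chi_diff chi_minus mult_ac)
  also have "\<dots> = avg (\<lambda>y. h y * (\<Sum>r\<in>{0..<int p}. chi (r * (x - y))))"
    by (simp add: avg_sum[symmetric] sum_distrib_left)
  also have "\<dots> = avg (\<lambda>y. if y = x mod int p then h x * of_nat p else 0)"
    unfolding avg_def
  proof (intro arg_cong2[where f="(/)"] sum.cong refl)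
    fix y assume y: "y \<in> {0..<int p}"
    have "int p dvd x - y \<longleftrightarrow> y = x mod int p"
      using y by (metis atLeastLessThan_iff mod_eq_dvd_iff mod_pos_pos_trivial)
    then show "h y * (\<Sum>r\<in>{0..<int p}. chi (r * (x - y)))
        = (if y = x mod int p then h x * of_nat p else 0)"
      using periodicD[OF assms] by (simp add: *)
  qed
  also have "\<dots> = h x" using p_pos by (simp add: avg_def)
  finally show ?thesis by simp
qed

lemma parseval:
  assumes "periodic h"
  shows "(\<Sum>r\<in>{0..<int p}. (cmod (fourier h r))\<^sup>2) = avg (\<lambda>x. (cmod (h x))\<^sup>2)"
proof -
  have "complex_of_real (avg (\<lambda>x. (cmod (h x))\<^sup>2)) = avg (\<lambda>x. h x * cnj (h x))"
    by (simp add: avg_of_real[symmetric] complex_norm_square[symmetric])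
  also have "\<dots> = avg (\<lambda>x. (\<Sum>r\<in>{0..<int p}. cnj (fourier h r) * (h x * chi (- (r * x)))))"
    by (subst (2) fourier_inversion[OF assms]) (simp add: sum_distrib_left chi_minus mult_ac)
  also have "\<dots> = (\<Sum>r\<in>{0..<int p}. cnj (fourier h r) * fourier h r)"
    by (simp add: avg_sum avg_cmult fourier_def)
  also have "\<dots> = complex_of_real (\<Sum>r\<in>{0..<int p}. (cmod (fourier h r))\<^sup>2)"
    by (simp only: complex_norm_square of_real_sum mult.commute)
  finally show ?thesis by (simp only: of_real_eq_iff)
qed

text \<open>Every point of \<open>z\<^sub>1 + z\<^sub>2 + z\<^sub>3 + u = 0\<close> is weighted equally here, so the three functions
  play symmetric roles and it suffices that any one of them is Fourier-uniform.\<close>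

lemma trilinear_fourier:
  assumes "periodic a" "periodic b" "periodic c"
  shows "avg (\<lambda>y. avg (\<lambda>z. a (- u - y - z) * b y * c z))
    = (\<Sum>r\<in>{0..<int p}. chi (- (r * u)) * fourier a r * fourier b r * fourier c r)"
proof -
  have "avg (\<lambda>y. avg (\<lambda>z. a (- u - y - z) * b y * c z))
    = avg (\<lambda>y. avg (\<lambda>z. \<Sum>r\<in>{0..<int p}. chi (- (r * u)) * fourier a r
         * (b y * chi (- (r * y))) * (c z * chi (- (r * z)))))"
    by (subst fourier_inversion[OF assms(1)])
       (simp add: right_diff_distrib chi_diff chi_minus sum_distrib_left sum_distrib_right mult_ac)
  also have "\<dots> = (\<Sum>r\<in>{0..<int p}. avg (\<lambda>y. avg (\<lambda>z. chi (- (r * u)) * fourier a r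
         * (b y * chi (- (r * y))) * (c z * chi (- (r * z))))))"
    by (simp add: avg_sum)
  also have "\<dots> = (\<Sum>r\<in>{0..<int p}. chi (- (r * u)) * fourier a r * fourier b r * fourier c r)"
    by (simp only: avg_cmult avg_cmult_right fourier_def)
  finally show ?thesis .
qed

text \<open>AM-GM stands in for Cauchy-Schwarz: Parseval turns both sums of squares into mean
  squares, which are at most 1.\<close>

lemma sum_fourier_prod_le:
  assumes "periodic b" "periodic c" "\<And>x. cmod (b x) \<le> 1" "\<And>x. cmod (c x) \<le> 1"
  shows "(\<Sum>r\<in>{0..<int p}. cmod (fourier b r) * cmod (fourier c r)) \<le> 1"
proof -
  have *: "(\<Sum>r\<in>{0..<int p}. (cmod (fourier d r))\<^sup>2) \<le> 1"
    if "periodic d" "\<And>x. cmod (d x) \<le> 1" for d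
    using avg_mono[of "\<lambda>x. (cmod (d x))\<^sup>2" "\<lambda>_. 1"] that
    by (simp add: parseval power_le_one)
  have "(\<Sum>r\<in>{0..<int p}. cmod (fourier b r) * cmod (fourier c r))
     \<le> (\<Sum>r\<in>{0..<int p}. ((cmod (fourier b r))\<^sup>2 + (cmod (fourier c r))\<^sup>2) / 2)"
  proof (rule sum_mono)
    fix r
    show "cmod (fourier b r) * cmod (fourier c r)
      \<le> ((cmod (fourier b r))\<^sup>2 + (cmod (fourier c r))\<^sup>2) / 2"
      using sum_squares_bound[of "cmod (fourier b r)" "cmod (fourier c r)"] by simp
  qed
  also have "\<dots> = ((\<Sum>r\<in>{0..<int p}. (cmod (fourier b r))\<^sup>2)
      + (\<Sum>r\<in>{0..<int p}. (cmod (fourier c r))\<^sup>2)) / 2"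
    by (simp add: sum.distrib[symmetric] sum_divide_distrib)
  also have "\<dots> \<le> 1" using *[of b] *[of c] assms by simp
  finally show ?thesis .
qed

text \<open>The small sup norm is taken out of whichever factor is uniform; the other two are left
  to Parseval.\<close>

lemma trilinear_le:
  assumes per: "periodic a" "periodic b" "periodic c"
    and le1: "\<And>x. cmod (a x) \<le> 1" "\<And>x. cmod (b x) \<le> 1" "\<And>x. cmod (c x) \<le> 1"
    and u: "(\<forall>r. cmod (fourier a r) \<le> \<eta>) \<or> (\<forall>r. cmod (fourier b r) \<le> \<eta>)
         \<or> (\<forall>r. cmod (fourier c r) \<le> \<eta>)"
  shows "cmod (avg (\<lambda>y. avg (\<lambda>z. a (- u - y - z) * b y * c z))) \<le> \<eta>"
proof -
  have eta: "\<eta> \<ge> 0" using u norm_ge_zero order_trans by blast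
  have core: "(\<Sum>r\<in>{0..<int p}. cmod (fourier d r) * cmod (fourier e r) * cmod (fourier f r)) \<le> \<eta>"
    if "\<forall>r. cmod (fourier d r) \<le> \<eta>" "periodic e" "periodic f"
       "\<And>x. cmod (e x) \<le> 1" "\<And>x. cmod (f x) \<le> 1" for d e f
  proof -
    have "(\<Sum>r\<in>{0..<int p}. cmod (fourier d r) * cmod (fourier e r) * cmod (fourier f r))
       \<le> (\<Sum>r\<in>{0..<int p}. \<eta> * (cmod (fourier e r) * cmod (fourier f r)))"
      unfolding mult.assoc by (rule sum_mono) (use that(1) in \<open>auto intro!: mult_right_mono\<close>)
    also have "\<dots> \<le> \<eta> * 1"
      unfolding sum_distrib_left[symmetric]
      by (rule mult_left_mono[OF sum_fourier_prod_le eta]) (use that in auto)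
    finally show ?thesis by simp
  qed
  have "cmod (avg (\<lambda>y. avg (\<lambda>z. a (- u - y - z) * b y * c z)))
     \<le> (\<Sum>r\<in>{0..<int p}. cmod (fourier a r) * cmod (fourier b r) * cmod (fourier c r))"
    unfolding trilinear_fourier[OF per] by (rule order_trans[OF norm_sum]) (simp add: norm_mult)
  also have "\<dots> \<le> \<eta>"
    using u core[of a b c] core[of b a c] core[of c a b] per le1 by (auto simp: mult_ac)
  finally show ?thesis .
qed

text \<open>Absorbs the phases of an expanded Fejer kernel into the functions: bounds that are
  uniform in the frequency are not affected.\<close>

lemma fourier_modulate:
  "fourier (\<lambda>x. chi (s * x) * h x) r = fourier h (r - s)"
proof -
  have "chi (s * x) * h x * chi (- (r * x)) = h x * chi (- ((r - s) * x))" for x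
    using chi_add[of "s * x" "- (r * x)"] by (simp add: algebra_simps)
  then show ?thesis by (simp only: fourier_def)
qed

text \<open>Translation contributes a phase, and dilation by m permutes the frequencies through the
  inverse of m mod p; hence a bound over all frequencies survives.\<close>

lemma norm_fourier_dilate:
  assumes "periodic h" "coprime m (int p)" "\<And>r. cmod (fourier h r) \<le> \<eta>"
  shows "cmod (fourier (\<lambda>z. h (x + m * z)) r) \<le> \<eta>"
proof -
  obtain m' where m': "[m * m' = 1] (mod int p)"
    using cong_solve_coprime_int assms(2) by blast
  have "chi (- (r * z)) = chi (r * m' * x) * chi (- (r * m' * (x + m * z)))" for z
  proof -
    have "[- (r * z) * (m * m') = - (r * z) * 1] (mod int p)"
      using m' by (rule cong_scalar_left)
    then have "chi (- (r * z)) = chi (r * m' * x + - (r * m' * (x + m * z)))"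
      by (intro chi_cong) (simp add: cong_def algebra_simps)
    then show ?thesis by (simp only: chi_add)
  qed
  then have "fourier (\<lambda>z. h (x + m * z)) r
    = chi (r * m' * x) * avg (\<lambda>z. h (x + m * z) * chi (- (r * m' * (x + m * z))))"
    by (simp add: fourier_def avg_cmult[symmetric] mult_ac)
  also have "avg (\<lambda>z. h (x + m * z) * chi (- (r * m' * (x + m * z))))
      = avg (\<lambda>y. h y * chi (- (r * m' * y)))"
    using avg_dilate[OF periodic_comp2[OF assms(1) periodic_chi[of "-(r*m')"], of "(*)"] assms(2), of x]
    by simp
  also have "\<dots> = fourier h (r * m')" by (simp add: fourier_def)
  finally show ?thesis using assms(3) by (simp add: norm_mult)
qed

end

section \<open>Fejer kernels of almost invariant frequency sets\<close>

text \<open>Limits how many consecutive boxes in \<open>folner\<close> can all grow by the factor 1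
  + \<delta>.\<close>

lemma ex_exponential_gt_polynomial:
  fixes \<delta> :: real
  assumes "\<delta> > 0"
  shows "\<exists>N. (real N + 1) ^ k < (1 + \<delta>) ^ N"
proof -
  have "((\<lambda>n::nat. (real n + 1) ^ k / (1 + \<delta>) ^ n) \<longlongrightarrow> 0) at_top"
    using assms by real_asymp
  then have "eventually (\<lambda>n. (real n + 1) ^ k / (1 + \<delta>) ^ n < 1) at_top"
    by (rule order_tendstoD) simp
  then obtain N where "(real N + 1) ^ k / (1 + \<delta>) ^ N < 1"
    by (auto simp: eventually_at_top_linorder)
  then show ?thesis using assms by (auto simp: divide_less_eq_1)
qed

context cyclic
begin

text \<open>The kernels replace normalized indicators of Bohr sets: \<open>dev S v\<close> is small iff \<open>v\<close> lies in
  a small Bohr set with frequency set \<open>S\<close>, and \<open>ov S\<close> is the Fourier transform of \<open>fejer S\<close>,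
  so \<open>fejer S\<close> is concentrated where the frequencies almost leaving \<open>S\<close> invariant are trivial.\<close>

definition fejer :: "int set \<Rightarrow> int \<Rightarrow> real" where
  "fejer S x = (cmod (\<Sum>s\<in>S. chi (s * x)))\<^sup>2 / card S"

definition dev :: "int set \<Rightarrow> int \<Rightarrow> real" where
  "dev S v = (\<Sum>s\<in>S. cmod (chi (s * v) - 1))"

definition ov :: "int set \<Rightarrow> int \<Rightarrow> real" where
  "ov S r = card {s\<in>S. (s + r) mod int p \<in> S} / card S"

text \<open>The density of \<open>a\<close> around x seen at the scale of S. Since the kernel is
  even this is a convolution, with Fourier multiplier \<open>ov S\<close>
  (\<open>fourier_sm\<close>).\<close>

definition sm :: "int set \<Rightarrow> (int \<Rightarrow> real) \<Rightarrow> int \<Rightarrow> real" where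
  "sm S a x = avg (\<lambda>z. fejer S z * a (x + z))"

lemma fejer_nonneg [simp]: "0 \<le> fejer S x"
  by (simp add: fejer_def)

lemma fejer_expand:
  "complex_of_real (fejer S x) = (\<Sum>s\<in>S. \<Sum>t\<in>S. chi ((s - t) * x)) / of_nat (card S)"
proof -
  have "complex_of_real ((cmod (\<Sum>s\<in>S. chi (s * x)))\<^sup>2) = (\<Sum>s\<in>S. \<Sum>t\<in>S. chi ((s - t) * x))"
    unfolding complex_norm_square
    by (simp add: sum_product left_diff_distrib chi_diff)
  then show ?thesis by (simp add: fejer_def)
qed

lemma periodic_fejer: "periodic (fejer S)"
proof -
  have "chi (s * (x mod int p)) = chi (s * x)" for s x
    using periodicD[OF periodic_chi] .
  then show ?thesis by (simp add: periodic_def fejer_def)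
qed

lemma fejer_minus [simp]: "fejer S (- x) = fejer S x"
proof -
  have "(\<Sum>s\<in>S. chi (s * - x)) = cnj (\<Sum>s\<in>S. chi (s * x))"
    by (simp add: chi_minus)
  then show ?thesis by (simp only: fejer_def complex_mod_cnj)
qed

lemma fejer_le:
  assumes "finite S" "S \<noteq> {}"
  shows "fejer S x \<le> card S"
proof -
  have "cmod (\<Sum>s\<in>S. chi (s * x)) \<le> card S"
    using norm_sum[of "\<lambda>s. chi (s * x)" S] by simp
  then have "(cmod (\<Sum>s\<in>S. chi (s * x)))\<^sup>2 \<le> (card S)\<^sup>2"
    by (simp add: power_mono)
  then show ?thesis using assms
    by (simp add: fejer_def power2_eq_square card_gt_0_iff pos_divide_le_eq)
qed

text \<open>After squaring out, only terms with s + r - t divisible by p survive. As S consists of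
  reduced residues, each s admits at most the one t = (s + r) mod p.\<close>

lemma avg_fejer_chi:
  assumes "S \<subseteq> {0..<int p}"
  shows "avg (\<lambda>z. complex_of_real (fejer S z) * chi (r * z)) = complex_of_real (ov S r)"
proof -
  have fin: "finite S" using assms finite_subset by blast
  have "avg (\<lambda>z. complex_of_real (fejer S z) * chi (r * z))
      = avg (\<lambda>z. \<Sum>s\<in>S. \<Sum>t\<in>S. chi ((s + r - t) * z)) / of_nat (card S)"
  proof -
    have "chi ((s - t) * z) * chi (r * z) = chi ((s + r - t) * z)" for s t z
      unfolding chi_add[symmetric] by (simp add: algebra_simps)
    then show ?thesis
      unfolding fejer_expand avg_divide[symmetric] by (simp add: sum_distrib_right)
  qed
  also have "avg (\<lambda>z. \<Sum>s\<in>S. \<Sum>t\<in>S. chi ((s + r - t) * z))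
      = (\<Sum>s\<in>S. \<Sum>t\<in>S. if int p dvd s + r - t then 1 else 0)"
    by (simp add: avg_sum avg_chi)
  also have "\<dots> = (\<Sum>s\<in>S. if (s + r) mod int p \<in> S then 1 else 0)"
  proof (rule sum.cong)
    fix s
    have "int p dvd s + r - t \<longleftrightarrow> t = (s + r) mod int p" if "t \<in> S" for t
      using assms that by (metis atLeastLessThan_iff mod_eq_dvd_iff mod_pos_pos_trivial subsetD)
    then have "(\<Sum>t\<in>S. if int p dvd s + r - t then 1 else (0::complex))
        = (\<Sum>t\<in>S. if t = (s + r) mod int p then 1 else 0)"
      by (intro sum.cong) auto
    then show "(\<Sum>t\<in>S. if int p dvd s + r - t then 1 else (0::complex))
        = (if (s + r) mod int p \<in> S then 1 else 0)"
      using fin by simp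
  qed simp
  also have "\<dots> = of_nat (card {s\<in>S. (s + r) mod int p \<in> S})"
    using fin by (simp add: sum.If_cases Int_def)
  finally show ?thesis by (simp add: ov_def)
qed

lemma ov_nonneg: "0 \<le> ov S r"
  by (simp add: ov_def)

lemma ov_le_1:
  assumes "finite S"
  shows "ov S r \<le> 1"
  using card_mono[OF assms, of "{s\<in>S. (s + r) mod int p \<in> S}"]
  by (auto simp: ov_def divide_le_eq_1)

lemma ov_cong: "r mod int p = r' mod int p \<Longrightarrow> ov S r = ov S r'"
  by (metis (no_types, lifting) Collect_cong mod_add_right_eq ov_def)

lemma avg_fejer:
  assumes "S \<subseteq> {0..<int p}" "S \<noteq> {}"
  shows "avg (fejer S) = 1"
proof -
  have "finite S" using assms finite_subset by blast
  moreover have "{s\<in>S. s mod int p \<in> S} = S" using assms by (auto simp: subset_iff)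
  ultimately have "ov S 0 = 1" using assms by (simp add: ov_def)
  then have "complex_of_real (avg (fejer S)) = 1"
    using avg_fejer_chi[OF assms(1), of 0] by (simp add: avg_of_real)
  then show ?thesis by simp
qed

lemma dev_nonneg [simp]: "0 \<le> dev S v"
  by (simp add: dev_def sum_nonneg)

lemma dev_0 [simp]: "dev S 0 = 0"
  by (simp add: dev_def)

lemma dev_minus [simp]: "dev S (- v) = dev S v"
proof -
  have "cmod (chi (s * - v) - 1) = cmod (chi (s * v) - 1)" for s
  proof -
    have "chi (s * - v) - 1 = cnj (chi (s * v) - 1)" by (simp add: chi_minus)
    then show ?thesis by (simp only: complex_mod_cnj)
  qed
  then show ?thesis by (simp add: dev_def)
qed

lemma norm_chi_add_le: "cmod (chi (x + y) - 1) \<le> cmod (chi x - 1) + cmod (chi y - 1)"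
proof -
  have "chi (x + y) - 1 = chi y * (chi x - 1) + (chi y - 1)"
    by (simp add: chi_add algebra_simps)
  then show ?thesis
    using norm_triangle_ineq[of "chi y * (chi x - 1)" "chi y - 1"] by (simp only: norm_mult norm_chi)
qed

lemma dev_add: "dev S (u + v) \<le> dev S u + dev S v"
  unfolding dev_def sum.distrib[symmetric] distrib_left
  by (intro sum_mono norm_chi_add_le)

lemma dev_diff: "dev S (u - v) \<le> dev S u + dev S v"
  using dev_add[of S u "- v"] by simp

lemma dev_mult: "dev S (m * v) \<le> real_of_int \<bar>m\<bar> * dev S v"
proof -
  have nat: "dev S (int n * v) \<le> real n * dev S v" for n
  proof (induction n)
    case (Suc n)
    then show ?case using dev_add[of S v "int n * v"] by (simp add: algebra_simps)
  qed simp
  show ?thesis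
  proof (cases "m \<ge> 0")
    case True
    then show ?thesis using nat[of "nat m"] by simp
  next
    case False
    then show ?thesis using nat[of "nat (- m)"] by simp
  qed
qed

lemma dev_mono: "finite T \<Longrightarrow> S \<subseteq> T \<Longrightarrow> dev S v \<le> dev T v"
  unfolding dev_def by (rule sum_mono2) auto

text \<open>Each of the \<open>card S * card S\<close> phases moves by at most the displacements of
  its two frequencies, and the normalisation of the kernel cancels one factor \<open>card S\<close>.
  With \<open>dev\<close> an unnormalised sum, no factor depending on the size of S remains.\<close>

lemma fejer_lipschitz:
  assumes "finite S" "S \<noteq> {}"
  shows "\<bar>fejer S (x + v) - fejer S x\<bar> \<le> 2 * dev S v"
proof -
  have card: "card S > 0" using assms by (simp add: card_gt_0_iff)
  have le: "cmod (chi ((s - t) * v) - 1) \<le> cmod (chi (s * v) - 1) + cmod (chi (t * v) - 1)" for s t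
  proof -
    have "cmod (chi (- (t * v)) - 1) = cmod (chi (t * v) - 1)"
    proof -
      have "chi (- (t * v)) - 1 = cnj (chi (t * v) - 1)" by (simp add: chi_minus)
      then show ?thesis by (simp only: complex_mod_cnj)
    qed
    then show ?thesis
      using norm_chi_add_le[of "s * v" "- (t * v)"] by (simp add: left_diff_distrib)
  qed
  have "\<bar>fejer S (x + v) - fejer S x\<bar> = cmod (complex_of_real (fejer S (x + v)) - complex_of_real (fejer S x))"
    by (metis norm_of_real of_real_diff)
  also have "\<dots> = cmod (\<Sum>s\<in>S. \<Sum>t\<in>S. chi ((s - t) * x) * (chi ((s - t) * v) - 1)) / card S"
    unfolding fejer_expand
    by (simp add: diff_divide_distrib[symmetric] sum_subtractf[symmetric] distrib_left chi_add
        right_diff_distrib norm_divide)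
  also have "\<dots> \<le> (\<Sum>s\<in>S. \<Sum>t\<in>S. cmod (chi (s * v) - 1) + cmod (chi (t * v) - 1)) / card S"
    by (intro divide_right_mono order_trans[OF norm_sum] sum_mono)
       (use le in \<open>simp_all add: norm_mult\<close>)
  also have "\<dots> = 2 * dev S v"
    using card by (simp add: sum.distrib dev_def sum_distrib_left[symmetric] field_simps)
  finally show ?thesis .
qed

text \<open>For unimodular z one has |z - 1|^2 = 2 - 2 Re z, and the kernel average of the real part
  of the character is \<open>ov S s\<close>. So a defect of \<delta>^2/2 gives a mean square of at
  most \<delta>^2, and AM-GM turns this into a mean of at most \<delta> for each frequency.\<close>

lemma avg_fejer_dev:
  fixes \<delta> :: real
  assumes S: "S \<subseteq> {0..<int p}" "S \<noteq> {}" and "\<delta> > 0"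
    and inv: "\<And>s. s \<in> R \<Longrightarrow> ov S s \<ge> 1 - \<delta>\<^sup>2 / 2"
  shows "avg (\<lambda>z. fejer S z * dev R z) \<le> card R * \<delta>"
proof -
  have "avg (\<lambda>z. fejer S z * cmod (chi (s * z) - 1)) \<le> \<delta>" if s: "s \<in> R" for s
  proof -
    have "cmod (chi (s * z) - 1) \<le> \<delta> / 2 + (2 - 2 * Re (chi (s * z))) / (2 * \<delta>)" for z
    proof -
      have "(cmod (chi (s * z)))\<^sup>2 = 1" by simp
      then have "(cmod (chi (s * z) - 1))\<^sup>2 = 2 - 2 * Re (chi (s * z))"
        unfolding cmod_power2 by (simp add: power2_eq_square algebra_simps)
      moreover have "2 * \<delta> * cmod (chi (s * z) - 1) \<le> \<delta>\<^sup>2 + (cmod (chi (s * z) - 1))\<^sup>2"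
        using sum_squares_bound[of \<delta> "cmod (chi (s * z) - 1)"] by simp
      ultimately show ?thesis using \<open>\<delta> > 0\<close> by (simp add: field_simps power2_eq_square)
    qed
    then have "avg (\<lambda>z. fejer S z * cmod (chi (s * z) - 1))
        \<le> avg (\<lambda>z. fejer S z * (\<delta> / 2 + (2 - 2 * Re (chi (s * z))) / (2 * \<delta>)))"
      by (intro avg_mono mult_left_mono) auto
    also have "\<dots> = avg (\<lambda>z. (\<delta> / 2 + 1 / \<delta>) * fejer S z - 1 / \<delta> * (fejer S z * Re (chi (s * z))))"
      by (rule arg_cong[where f = avg]) (use \<open>\<delta> > 0\<close> in \<open>simp add: fun_eq_iff field_simps\<close>)
    also have "\<dots> = (\<delta> / 2 + 1 / \<delta>) - 1 / \<delta> * avg (\<lambda>z. fejer S z * Re (chi (s * z)))"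
      unfolding avg_diff avg_cmult avg_fejer[OF S] by simp
    also have "avg (\<lambda>z. fejer S z * Re (chi (s * z))) = ov S s"
    proof -
      have "avg (\<lambda>z. fejer S z * Re (chi (s * z)))
          = Re (avg (\<lambda>z. complex_of_real (fejer S z) * chi (s * z)))"
        by (simp add: avg_def)
      then show ?thesis by (simp add: avg_fejer_chi[OF S(1)])
    qed
    also have "(\<delta> / 2 + 1 / \<delta>) - 1 / \<delta> * ov S s \<le> (\<delta> / 2 + 1 / \<delta>) - 1 / \<delta> * (1 - \<delta>\<^sup>2 / 2)"
      using inv[OF s] \<open>\<delta> > 0\<close> by (intro diff_left_mono mult_left_mono) auto
    also have "\<dots> = \<delta>" using \<open>\<delta> > 0\<close> by (simp add: field_simps power2_eq_square)
    finally show ?thesis .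
  qed
  then have "(\<Sum>s\<in>R. avg (\<lambda>z. fejer S z * cmod (chi (s * z) - 1))) \<le> card R * \<delta>"
    using sum_bounded_above[of R _ \<delta>] by simp
  then show ?thesis
    by (simp add: dev_def sum_distrib_left avg_sum)
qed

section \<open>Smoothing by a Fejer kernel\<close>

lemma periodic_sm:
  assumes "periodic a"
  shows "periodic (sm S a)"
  unfolding periodic_def sm_def
  by (intro allI arg_cong[where f = avg] ext arg_cong2[where f = "(*)"] refl periodic_cong[OF assms])
     (simp add: mod_add_left_eq)

lemma sm_bounds:
  assumes "S \<subseteq> {0..<int p}" "S \<noteq> {}" "\<And>x. 0 \<le> a x" "\<And>x. a x \<le> 1"
  shows "0 \<le> sm S a x" "sm S a x \<le> 1"
proof -
  show "0 \<le> sm S a x" unfolding sm_def by (intro avg_nonneg mult_nonneg_nonneg) (use assms in auto)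
  have "sm S a x \<le> avg (fejer S)" unfolding sm_def
    by (intro avg_mono mult_left_le) (use assms in auto)
  then show "sm S a x \<le> 1" using avg_fejer[OF assms(1,2)] by simp
qed

lemma sm_alt:
  assumes "periodic a"
  shows "sm S a x = avg (\<lambda>y. fejer S (y - x) * a y)"
proof -
  have "periodic (\<lambda>y. fejer S (y - x) * a y)"
    by (rule periodic_comp2[OF _ assms])
       (use periodic_shift[OF periodic_fejer, of S "-x"] in simp)
  from avg_shift[OF this, of x] show ?thesis by (simp add: sm_def)
qed

text \<open>Smoothing is self-adjoint because the kernel is even.\<close>

lemma avg_mult_sm:
  assumes "periodic a" "periodic b"
  shows "avg (\<lambda>x. b x * sm S a x) = avg (\<lambda>x. a x * sm S b x)"
proof -
  have "avg (\<lambda>x. b x * sm S a x) = avg (\<lambda>x. avg (\<lambda>y. b x * (fejer S (y - x) * a y)))"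
    by (simp add: sm_alt[OF assms(1)] avg_cmult)
  also have "\<dots> = avg (\<lambda>y. avg (\<lambda>x. b x * (fejer S (y - x) * a y)))"
    by (rule avg_swap)
  also have "\<dots> = avg (\<lambda>y. avg (\<lambda>x. a y * (fejer S (x - y) * b x)))"
    using fejer_minus[of S "_ - _"] by (simp add: mult_ac)
  also have "\<dots> = avg (\<lambda>x. a x * sm S b x)"
    by (simp add: sm_alt[OF assms(2)] avg_cmult)
  finally show ?thesis .
qed

lemma fourier_sm:
  assumes "periodic a" "S \<subseteq> {0..<int p}"
  shows "fourier (\<lambda>x. complex_of_real (sm S a x)) r
    = fourier (\<lambda>x. complex_of_real (a x)) r * complex_of_real (ov S r)"
proof -
  have "fourier (\<lambda>x. complex_of_real (sm S a x)) r
    = avg (\<lambda>x. avg (\<lambda>z. (of_real (fejer S z) * chi (r * z)) * (of_real (a (x + z)) * chi (- (r * (x + z))))))"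
  proof -
    have chi: "chi (r * z) * chi (- (r * (x + z))) = chi (- (r * x))" for x z
      unfolding chi_add[symmetric] by (simp add: algebra_simps)
    have "complex_of_real (fejer S z * a (x + z)) * chi (- (r * x))
      = (of_real (fejer S z) * chi (r * z)) * (of_real (a (x + z)) * chi (- (r * (x + z))))" for x z
      unfolding chi[of z x, symmetric] by simp
    then show ?thesis
      unfolding fourier_def sm_def avg_of_real[symmetric] avg_cmult_right[symmetric] by (simp only:)
  qed
  also have "\<dots> = avg (\<lambda>z. (of_real (fejer S z) * chi (r * z)) * avg (\<lambda>x. of_real (a (x + z)) * chi (- (r * (x + z)))))"
    by (subst avg_swap) (simp add: avg_cmult)
  also have "\<dots> = avg (\<lambda>z. (of_real (fejer S z) * chi (r * z)) * fourier (\<lambda>x. complex_of_real (a x)) r)"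
  proof -
    have "avg (\<lambda>x. complex_of_real (a (x + z)) * chi (- (r * (x + z)))) = fourier (\<lambda>x. complex_of_real (a x)) r" for z
    proof -
      have "periodic (\<lambda>x. complex_of_real (a x) * chi (- (r * x)))"
        by (rule periodic_comp2[where f = "\<lambda>u v. complex_of_real u * v", OF assms(1)])
           (use periodic_chi[of "-r"] in simp)
      from avg_shift[OF this, of z] show ?thesis by (simp add: fourier_def add.commute)
    qed
    then show ?thesis by simp
  qed
  also have "\<dots> = complex_of_real (ov S r) * fourier (\<lambda>x. complex_of_real (a x)) r"
    unfolding avg_cmult_right avg_fejer_chi[OF assms(2)] ..
  finally show ?thesis by (simp add: mult.commute)
qed

lemma sm_lipschitz:
  assumes "finite S" "S \<noteq> {}" "periodic a" "\<And>x. 0 \<le> a x" "\<And>x. a x \<le> 1"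
  shows "\<bar>sm S a (x + v) - sm S a x\<bar> \<le> 2 * dev S v"
proof -
  have "\<bar>sm S a (x + v) - sm S a x\<bar> = \<bar>avg (\<lambda>y. (fejer S (y - (x + v)) - fejer S (y - x)) * a y)\<bar>"
    by (simp add: sm_alt[OF assms(3)] avg_diff[symmetric] left_diff_distrib)
  also have "\<dots> \<le> avg (\<lambda>y. \<bar>(fejer S (y - (x + v)) - fejer S (y - x)) * a y\<bar>)"
    by (rule abs_avg_le)
  also have "\<dots> \<le> avg (\<lambda>y. 2 * dev S v)"
  proof (rule avg_mono)
    fix y
    have "\<bar>fejer S (y - (x + v)) - fejer S (y - x)\<bar> \<le> 2 * dev S v"
      using fejer_lipschitz[OF assms(1,2), of "y - x" "- v"] by (simp add: algebra_simps)
    then have "\<bar>fejer S (y - (x + v)) - fejer S (y - x)\<bar> * \<bar>a y\<bar> \<le> 2 * dev S v * 1"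
      by (rule mult_mono) (use assms in auto)
    then show "\<bar>(fejer S (y - (x + v)) - fejer S (y - x)) * a y\<bar> \<le> 2 * dev S v"
      by (simp add: abs_mult)
  qed
  finally show ?thesis by simp
qed

text \<open>The boxes \<open>{\<Sum>r\<in>R. c\<^sub>r r | 0 \<le> c\<^sub>r \<le> n}\<close> grow polynomially in \<open>n\<close>, so some box barely grows
  when \<open>n\<close> is replaced by \<open>n + 1\<close>, and is then almost invariant under \<open>R\<close>.\<close>

lemma folner:
  assumes R: "finite R" "card R \<le> k" and \<delta>: "\<delta> > 0" and N: "(real N + 1) ^ k < (1 + \<delta>) ^ N"
  shows "\<exists>S. S \<subseteq> {0..<int p} \<and> S \<noteq> {} \<and> card S \<le> (N + 1) ^ k \<and> (\<forall>r\<in>R. ov S r \<ge> 1 - \<delta>)"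
proof -
  define T where "T n = (\<lambda>c. (\<Sum>r\<in>R. int (c r) * r) mod int p) ` (PiE R (\<lambda>_. {0..n}))" for n :: nat
  have T_sub: "T n \<subseteq> {0..<int p}" for n using p_pos by (auto simp: T_def)
  have fin: "finite (T n)" for n using T_sub finite_subset by blast
  have ne: "T n \<noteq> {}" for n by (auto simp: T_def PiE_eq_empty_iff)
  have card_pos: "card (T n) > 0" for n using fin ne by (simp add: card_gt_0_iff)
  have card_T: "card (T n) \<le> (n + 1) ^ k" for n
  proof -
    have "card (T n) \<le> card (PiE R (\<lambda>_. {0..n}))"
      unfolding T_def by (rule card_image_le) (simp add: R finite_PiE)
    also have "\<dots> = (n + 1) ^ card R" by (simp add: card_PiE R)
    also have "\<dots> \<le> (n + 1) ^ k" by (rule power_increasing) (use R in auto)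
    finally show ?thesis .
  qed
  have mono: "T n \<subseteq> T (Suc n)" for n
    unfolding T_def by (intro image_mono PiE_mono) auto
  have step: "(t + r) mod int p \<in> T (Suc n)" if t: "t \<in> T n" and r: "r \<in> R" for t r n
  proof -
    obtain c where c: "c \<in> PiE R (\<lambda>_. {0..n})" "t = (\<Sum>r\<in>R. int (c r) * r) mod int p"
      using t by (auto simp: T_def)
    have "(\<Sum>q\<in>R. int ((c(r := c r + 1)) q) * q) = (\<Sum>q\<in>R. int (c q) * q + (if q = r then r else 0))"
      by (rule sum.cong) (auto simp: algebra_simps)
    also have "\<dots> = (\<Sum>q\<in>R. int (c q) * q) + r"
      using r R by (simp add: sum.distrib)
    finally have "(t + r) mod int p = (\<Sum>q\<in>R. int ((c(r := c r + 1)) q) * q) mod int p"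
      by (simp add: c mod_add_left_eq)
    moreover have "c(r := c r + 1) \<in> PiE R (\<lambda>_. {0..Suc n})"
      using c(1) r by (auto simp: PiE_iff extensional_def le_SucI)
    ultimately show ?thesis unfolding T_def by blast
  qed
  have "\<exists>n<N. real (card (T (Suc n))) \<le> (1 + \<delta>) * card (T n)"
  proof (rule ccontr)
    assume "\<not> ?thesis"
    then have gr: "real (card (T (Suc n))) > (1 + \<delta>) * card (T n)" if "n < N" for n
      using that by (auto simp: not_le)
    have "n \<le> N \<Longrightarrow> real (card (T n)) \<ge> (1 + \<delta>) ^ n" for n
    proof (induction n)
      case 0 then show ?case using card_pos[of 0] by simp
    next
      case (Suc n)
      then have "(1 + \<delta>) * (1 + \<delta>) ^ n \<le> (1 + \<delta>) * card (T n)"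
        using \<delta> by (intro mult_left_mono) auto
      then show ?case using gr[of n] Suc.prems by simp
    qed
    from this[of N] have "(1 + \<delta>) ^ N \<le> real (card (T N))" by simp
    also have "\<dots> \<le> real ((N + 1) ^ k)" using card_T[of N] by (simp only: of_nat_le_iff)
    finally have "(1 + \<delta>) ^ N \<le> real ((N + 1) ^ k)" .
    then show False using N by (simp add: add.commute)
  qed
  then obtain n where n: "n < N" "real (card (T (Suc n))) \<le> (1 + \<delta>) * card (T n)" by blast
  have "ov (T n) r \<ge> 1 - \<delta>" if r: "r \<in> R" for r
  proof -
    let ?I = "{s\<in>T n. (s + r) mod int p \<in> T n}"
    \<comment> \<open>The elements that leave \<open>T n\<close> under translation by r land
      injectively in \<open>T (Suc n) - T n\<close>, which is a \<delta>-fraction of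
      \<open>T n\<close> at most.\<close>
    have inj: "inj_on (\<lambda>s. (s + r) mod int p) (T n - ?I)"
    proof (rule inj_onI)
      fix s t assume "s \<in> T n - ?I" "t \<in> T n - ?I" and eq: "(s + r) mod int p = (t + r) mod int p"
      then have "s \<in> {0..<int p}" "t \<in> {0..<int p}" using T_sub by blast+
      moreover have "s mod int p = t mod int p" using eq by (simp add: mod_eq_dvd_iff)
      ultimately show "s = t" by simp
    qed
    have "(\<lambda>s. (s + r) mod int p) ` (T n - ?I) \<subseteq> T (Suc n) - T n"
    proof (rule image_subsetI)
      fix s assume "s \<in> T n - ?I"
      then show "(s + r) mod int p \<in> T (Suc n) - T n" using step[OF _ r] by simp
    qed
    then have "card (T n - ?I) \<le> card (T (Suc n) - T n)"
      by (rule card_inj_on_le[OF inj]) (simp add: fin)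
    moreover have "card (T (Suc n) - T n) = card (T (Suc n)) - card (T n)"
      by (rule card_Diff_subset[OF fin mono])
    moreover have "card (T n - ?I) = card (T n) - card ?I"
      by (rule card_Diff_subset) (use fin in auto)
    moreover have "card ?I \<le> card (T n)" by (rule card_mono[OF fin]) auto
    moreover have "card (T n) \<le> card (T (Suc n))" by (rule card_mono[OF fin mono])
    ultimately have "card (T n) + card (T n) \<le> card (T (Suc n)) + card ?I" by linarith
    then have "real (card (T n)) + real (card (T n)) \<le> real (card (T (Suc n))) + real (card ?I)"
      by (simp only: of_nat_add[symmetric] of_nat_le_iff)
    then have "real (card ?I) \<ge> (1 - \<delta>) * card (T n)"
      using n(2) unfolding left_diff_distrib distrib_right by linarith
    then show ?thesis using card_pos[of n] by (simp add: ov_def pos_le_divide_eq)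
  qed
  moreover have "card (T n) \<le> (N + 1) ^ k"
    using card_T[of n] n(1) power_mono[of "n + 1" "N + 1" k] by simp
  ultimately show ?thesis using T_sub[of n] ne[of n] by (intro exI[of _ "T n"]) simp
qed

end

section \<open>Counting solutions locally\<close>

lemma abs_prod3_diff_le:
  fixes a b c a' b' c' :: real
  assumes "0 \<le> a" "a \<le> 1" "0 \<le> b" "b \<le> 1" "0 \<le> c" "c \<le> 1"
    and "0 \<le> a'" "a' \<le> 1" "0 \<le> b'" "b' \<le> 1" "0 \<le> c'" "c' \<le> 1"
  shows "\<bar>a * b * c - a' * b' * c'\<bar> \<le> \<bar>a - a'\<bar> + \<bar>b - b'\<bar> + \<bar>c - c'\<bar>"
proof -
  have "a * b * c - a' * b' * c' = (a - a') * (b * c) + (b - b') * (a' * c) + (c - c') * (a' * b')"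
    by (simp add: algebra_simps)
  then have "\<bar>a * b * c - a' * b' * c'\<bar>
      \<le> \<bar>(a - a') * (b * c)\<bar> + \<bar>(b - b') * (a' * c)\<bar> + \<bar>(c - c') * (a' * b')\<bar>"
    by linarith
  also have "\<dots> \<le> \<bar>a - a'\<bar> * 1 + \<bar>b - b'\<bar> * 1 + \<bar>c - c'\<bar> * 1"
    unfolding abs_mult by (intro add_mono mult_left_mono) (use assms in \<open>auto intro: mult_le_one\<close>)
  finally show ?thesis by simp
qed

context cyclic
begin

text \<open>The weighted count of solutions of \<open>z\<^sub>1 + y + z = - u\<close> with \<open>y\<close> at scale \<open>S\<close> and \<open>z\<close> at
  scale \<open>T\<close>.\<close>

definition tri :: "int \<Rightarrow> int set \<Rightarrow> int set \<Rightarrow> (int \<Rightarrow> real) \<Rightarrow> (int \<Rightarrow> real) \<Rightarrow> (int \<Rightarrow> real) \<Rightarrow> real" where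
  "tri u S T a b c = avg (\<lambda>y. avg (\<lambda>z. fejer S y * fejer T z * (a (- u - y - z) * b y * c z)))"

lemma tri_diff1: "tri u S T (\<lambda>x. a x - a' x) b c = tri u S T a b c - tri u S T a' b c"
  by (simp add: tri_def avg_diff[symmetric] left_diff_distrib right_diff_distrib)

lemma tri_diff2: "tri u S T a (\<lambda>x. b x - b' x) c = tri u S T a b c - tri u S T a b' c"
  by (simp add: tri_def avg_diff[symmetric] left_diff_distrib right_diff_distrib)

lemma tri_diff3: "tri u S T a b (\<lambda>x. c x - c' x) = tri u S T a b c - tri u S T a b c'"
  by (simp add: tri_def avg_diff[symmetric] left_diff_distrib right_diff_distrib)

text \<open>Expanding both kernels gives a sum over two pairs from S and two from T of modulated
  trilinear averages, normalised by \<open>card S * card T\<close>. Modulation only shifts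
  frequencies, so each average is at most \<eta>. The factor that is left forces \<eta> to be chosen
  after S and T.\<close>

lemma tri_fourier_le:
  fixes a b c :: "int \<Rightarrow> real" and \<eta> :: real
  assumes S: "finite S" "S \<noteq> {}" and T: "finite T" "T \<noteq> {}"
    and per: "periodic a" "periodic b" "periodic c"
    and le1: "\<And>x. \<bar>a x\<bar> \<le> 1" "\<And>x. \<bar>b x\<bar> \<le> 1" "\<And>x. \<bar>c x\<bar> \<le> 1"
    and unif: "(\<forall>r. cmod (fourier (\<lambda>x. of_real (a x)) r) \<le> \<eta>)
      \<or> (\<forall>r. cmod (fourier (\<lambda>x. of_real (b x)) r) \<le> \<eta>)
      \<or> (\<forall>r. cmod (fourier (\<lambda>x. of_real (c x)) r) \<le> \<eta>)"
  shows "\<bar>tri u S T a b c\<bar> \<le> card S * card T * \<eta>"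
proof -
  define G where "G s s' t t' = avg (\<lambda>y. avg (\<lambda>z. complex_of_real (a (- u - y - z))
    * (chi ((s - s') * y) * of_real (b y)) * (chi ((t - t') * z) * of_real (c z))))" for s s' t t'
  have cards: "card S > 0" "card T > 0" using S T by (auto simp: card_gt_0_iff)
  have G: "cmod (G s s' t t') \<le> \<eta>" for s s' t t'
    unfolding G_def
  proof (rule trilinear_le)
    show "periodic (\<lambda>x. complex_of_real (a x))" by (rule periodic_comp[OF per(1)])
    show "periodic (\<lambda>y. chi ((s - s') * y) * complex_of_real (b y))"
      by (rule periodic_comp2[OF periodic_chi periodic_comp[OF per(2)], of "(*)"])
    show "periodic (\<lambda>y. chi ((t - t') * y) * complex_of_real (c y))"
      by (rule periodic_comp2[OF periodic_chi periodic_comp[OF per(3)], of "(*)"])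
  qed (use le1 unif in \<open>auto simp: norm_mult fourier_modulate\<close>)
  have "complex_of_real (tri u S T a b c)
    = avg (\<lambda>y. avg (\<lambda>z. of_real (fejer S y) * of_real (fejer T z)
        * (of_real (a (- u - y - z)) * of_real (b y) * of_real (c z))))"
    by (simp add: tri_def avg_of_real[symmetric])
  also have "\<dots> = avg (\<lambda>y. avg (\<lambda>z. (\<Sum>s\<in>S. \<Sum>s'\<in>S. \<Sum>t\<in>T. \<Sum>t'\<in>T. of_real (a (- u - y - z))
    * (chi ((s - s') * y) * of_real (b y)) * (chi ((t - t') * z) * of_real (c z)))
      / (of_nat (card S) * of_nat (card T))))"
  proof (intro arg_cong[where f = avg] ext)
    fix y z
    have "complex_of_real (fejer S y) * of_real (fejer T z)
        * (of_real (a (- u - y - z)) * of_real (b y) * of_real (c z))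
      = (\<Sum>s\<in>S. \<Sum>s'\<in>S. chi ((s - s') * y) * ((\<Sum>t\<in>T. \<Sum>t'\<in>T. chi ((t - t') * z)
        * (of_real (a (- u - y - z)) * of_real (b y) * of_real (c z)))))
          / (of_nat (card S) * of_nat (card T))"
      unfolding fejer_expand by (simp add: sum_distrib_right mult.assoc)
    also have "\<dots> = (\<Sum>s\<in>S. \<Sum>s'\<in>S. \<Sum>t\<in>T. \<Sum>t'\<in>T. of_real (a (- u - y - z))
      * (chi ((s - s') * y) * of_real (b y)) * (chi ((t - t') * z) * of_real (c z)))
        / (of_nat (card S) * of_nat (card T))"
      by (simp add: sum_distrib_left mult_ac)
    finally show "complex_of_real (fejer S y) * of_real (fejer T z)
        * (of_real (a (- u - y - z)) * of_real (b y) * of_real (c z))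
      = (\<Sum>s\<in>S. \<Sum>s'\<in>S. \<Sum>t\<in>T. \<Sum>t'\<in>T. of_real (a (- u - y - z))
      * (chi ((s - s') * y) * of_real (b y)) * (chi ((t - t') * z) * of_real (c z)))
        / (of_nat (card S) * of_nat (card T))" .
  qed
  also have "\<dots> = (\<Sum>s\<in>S. \<Sum>s'\<in>S. \<Sum>t\<in>T. \<Sum>t'\<in>T. G s s' t t')
      / (of_nat (card S) * of_nat (card T))"
    by (simp only: avg_divide avg_sum G_def)
  finally have "\<bar>tri u S T a b c\<bar>
      = cmod ((\<Sum>s\<in>S. \<Sum>s'\<in>S. \<Sum>t\<in>T. \<Sum>t'\<in>T. G s s' t t') / (of_nat (card S) * of_nat (card T)))"
    by (metis norm_of_real)
  also have "\<dots> = cmod (\<Sum>s\<in>S. \<Sum>s'\<in>S. \<Sum>t\<in>T. \<Sum>t'\<in>T. G s s' t t') / (card S * card T)"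
    by (simp add: norm_divide norm_mult)
  also have "\<dots> \<le> (\<Sum>s\<in>S. \<Sum>s'\<in>S. \<Sum>t\<in>T. \<Sum>t'\<in>T. \<eta>) / (card S * card T)"
    by (intro divide_right_mono order_trans[OF norm_sum] sum_mono G) simp
  also have "\<dots> = card S * card T * \<eta>"
    using cards by (simp add: field_simps)
  finally show ?thesis .
qed

lemma tri_replace:
  fixes a b c a' b' c' :: "int \<Rightarrow> real" and \<eta> :: real
  assumes S: "finite S" "S \<noteq> {}" and T: "finite T" "T \<noteq> {}"
    and per: "periodic a" "periodic b" "periodic c" "periodic a'" "periodic b'" "periodic c'"
    and bounds: "\<And>x. a x \<in> {0..1}" "\<And>x. b x \<in> {0..1}" "\<And>x. c x \<in> {0..1}"
      "\<And>x. a' x \<in> {0..1}" "\<And>x. b' x \<in> {0..1}" "\<And>x. c' x \<in> {0..1}"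
    and unif: "\<And>r. cmod (fourier (\<lambda>x. of_real (a x - a' x)) r) \<le> \<eta>"
      "\<And>r. cmod (fourier (\<lambda>x. of_real (b x - b' x)) r) \<le> \<eta>"
      "\<And>r. cmod (fourier (\<lambda>x. of_real (c x - c' x)) r) \<le> \<eta>"
  shows "\<bar>tri u S T a b c - tri u S T a' b' c'\<bar> \<le> 3 * (card S * card T * \<eta>)"
proof -
  have abs1: "\<bar>v - w\<bar> \<le> 1" if "v \<in> {0..1}" "w \<in> {0..1}" for v w :: real using that by auto
  have abs2: "\<bar>v\<bar> \<le> 1" if "v \<in> {0..1}" for v :: real using that by auto
  have per': "periodic (\<lambda>x. a x - a' x)" "periodic (\<lambda>x. b x - b' x)" "periodic (\<lambda>x. c x - c' x)"
    using per by (auto intro: periodic_comp2[where f = "(-)"])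
  have "\<bar>tri u S T (\<lambda>x. a x - a' x) b c\<bar> \<le> card S * card T * \<eta>"
    by (rule tri_fourier_le[OF S T per'(1) per(2,3)]) (use unif in \<open>simp_all only: abs1 abs2 bounds simp_thms\<close>)
  moreover have "\<bar>tri u S T a' (\<lambda>x. b x - b' x) c\<bar> \<le> card S * card T * \<eta>"
    by (rule tri_fourier_le[OF S T per(4) per'(2) per(3)]) (use unif in \<open>simp_all only: abs1 abs2 bounds simp_thms\<close>)
  moreover have "\<bar>tri u S T a' b' (\<lambda>x. c x - c' x)\<bar> \<le> card S * card T * \<eta>"
    by (rule tri_fourier_le[OF S T per(4,5) per'(3)]) (use unif in \<open>simp_all only: abs1 abs2 bounds simp_thms\<close>)
  ultimately show ?thesis unfolding tri_diff1 tri_diff2 tri_diff3 by linarith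
qed

lemma avg2_weight_right:
  assumes "S \<subseteq> {0..<int p}" "S \<noteq> {}"
  shows "avg (\<lambda>y. avg (\<lambda>z. fejer S y * fejer T z * k z)) = avg (\<lambda>z. fejer T z * k z)"
  by (simp add: mult.assoc avg_cmult avg_cmult_right avg_fejer[OF assms])

lemma avg2_weight_left:
  assumes "T \<subseteq> {0..<int p}" "T \<noteq> {}"
  shows "avg (\<lambda>y. avg (\<lambda>z. fejer S y * fejer T z * k y)) = avg (\<lambda>y. fejer S y * k y)"
proof -
  have "avg (\<lambda>z. fejer S y * fejer T z * k y) = fejer S y * k y" for y
    by (simp add: avg_cmult avg_cmult_right avg_fejer[OF assms])
  then show ?thesis by simp
qed

text \<open>Substituting n = - u - y - z for y turns the weight at y into the weight at n + (u + z).
  Replacing this by the weight at n costs multiples of \<open>dev S u\<close> and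
  \<open>dev S z\<close>, and the latter is small on average when T is much narrower than S.\<close>

lemma avg2_weight_shift_le:
  assumes S: "S \<subseteq> {0..<int p}" "S \<noteq> {}" and T: "T \<subseteq> {0..<int p}" "T \<noteq> {}"
    and k: "periodic k" "\<And>x. 0 \<le> k x" "\<And>x. k x \<le> 1"
  shows "avg (\<lambda>y. avg (\<lambda>z. fejer S y * fejer T z * k (- u - y - z)))
    \<le> avg (\<lambda>y. fejer S y * k y) + 2 * dev S u + 2 * avg (\<lambda>z. fejer T z * dev S z)"
proof -
  have fin: "finite S" using S finite_subset by blast
  have inner: "avg (\<lambda>y. fejer S y * k (- u - y - z))
      \<le> avg (\<lambda>y. fejer S y * k y) + 2 * dev S u + 2 * dev S z" for z
  proof -
    have per: "periodic (\<lambda>n. fejer S (- (u + z) - n) * k n)"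
      using periodic_comp2[OF periodic_dilate[OF periodic_fejer, of S "-(u+z)" "-1"] k(1), of "(*)"]
      by simp
    have "avg (\<lambda>y. fejer S y * k (- u - y - z)) = avg (\<lambda>n. fejer S (- (u + z) - n) * k n)"
      using avg_reflect[OF per, of "- (u + z)"] by (simp add: algebra_simps)
    also have "\<dots> \<le> avg (\<lambda>n. fejer S n * k n + (2 * dev S u + 2 * dev S z))"
    proof (rule avg_mono)
      fix n
      have "fejer S (- (u + z) - n) = fejer S (n + (u + z))"
        using fejer_minus[of S "n + (u + z)"] by (simp only: minus_add_distrib minus_add diff_conv_add_uminus add_ac)
      also have "\<dots> \<le> fejer S n + (2 * dev S u + 2 * dev S z)"
        using fejer_lipschitz[OF fin S(2), of n "u + z"] dev_add[of S u z] by linarith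
      finally have "fejer S (- (u + z) - n) * k n \<le> (fejer S n + (2 * dev S u + 2 * dev S z)) * k n"
        by (rule mult_right_mono) (rule k)
      also have "\<dots> \<le> fejer S n * k n + (2 * dev S u + 2 * dev S z)"
        using mult_left_le[of "k n" "2 * dev S u + 2 * dev S z"] k(3)[of n] by (simp add: distrib_right)
      finally show "fejer S (- (u + z) - n) * k n \<le> fejer S n * k n + (2 * dev S u + 2 * dev S z)" .
    qed
    finally show ?thesis by (simp add: avg_add)
  qed
  have "avg (\<lambda>y. avg (\<lambda>z. fejer S y * fejer T z * k (- u - y - z)))
      = avg (\<lambda>z. fejer T z * avg (\<lambda>y. fejer S y * k (- u - y - z)))"
    by (subst avg_swap) (simp add: avg_cmult[symmetric] mult_ac)
  also have "\<dots> \<le> avg (\<lambda>z. fejer T z * (avg (\<lambda>y. fejer S y * k y) + 2 * dev S u + 2 * dev S z))"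
    by (intro avg_mono mult_left_mono inner) simp
  also have "\<dots> = avg (\<lambda>z. fejer T z * (avg (\<lambda>y. fejer S y * k y) + 2 * dev S u) + 2 * (fejer T z * dev S z))"
    by (simp add: algebra_simps)
  also have "\<dots> = avg (\<lambda>y. fejer S y * k y) + 2 * dev S u + 2 * avg (\<lambda>z. fejer T z * dev S z)"
    unfolding avg_add avg_cmult avg_cmult_right avg_fejer[OF T] by simp
  finally show ?thesis .
qed

text \<open>Two scales \<open>S\<^sub>\<beta>\<close> (wide) and \<open>S\<^sub>\<nu>\<close> (narrow) between the coarse \<open>S\<^sub>0\<close> and the fine \<open>S\<^sub>1\<close>: the
  set looks Fourier-uniform relative to its smoothing at scale \<open>S\<^sub>1\<close>, which around the points
  \<open>x\<^sub>i\<close> is close to its smoothing at scale \<open>S\<^sub>0\<close>, which is almost constant at scale \<open>S\<^sub>\<beta>\<close>. Since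
  \<open>S\<^sub>\<nu>\<close> is much narrower than \<open>S\<^sub>\<beta>\<close>, all losses are additive and none depends on the size of
  the frequency sets.\<close>

lemma local_solution:
  fixes a :: "int \<Rightarrow> real" and D \<kappa> \<epsilon> :: real
  assumes S0: "S0 \<subseteq> {0..<int p}" "S0 \<noteq> {}" and Sb: "Sb \<subseteq> {0..<int p}" "Sb \<noteq> {}"
    and Sn: "Sn \<subseteq> {0..<int p}" "Sn \<noteq> {}" and S1: "S1 \<subseteq> {0..<int p}" "S1 \<noteq> {}"
    and a: "periodic a" "\<And>x. a x \<in> {0..1}"
    and conc: "avg (\<lambda>z. fejer Sb z * dev S0 z) \<le> \<kappa>" "avg (\<lambda>z. fejer Sn z * dev S0 z) \<le> \<kappa>"
      "avg (\<lambda>z. fejer Sn z * dev Sb z) \<le> \<kappa>"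
    and unif: "\<And>r. card Sb * card Sn * cmod (fourier (\<lambda>x. of_real (a x - sm S1 a x)) r) \<le> \<kappa>"
    and m: "coprime m1 (int p)" "coprime m2 (int p)" "coprime m3 (int p)"
      "\<bar>m1\<bar> \<le> D" "\<bar>m2\<bar> \<le> D" "\<bar>m3\<bar> \<le> D"
    and dense: "sm S0 a x1 \<ge> \<epsilon>" "sm S0 a x2 \<ge> \<epsilon>" "sm S0 a x3 \<ge> \<epsilon>"
    and reg: "avg (\<lambda>z. fejer Sb z * \<bar>sm S1 a (x1 + m1 * z) - sm S0 a (x1 + m1 * z)\<bar>) \<le> \<kappa>"
      "avg (\<lambda>z. fejer Sb z * \<bar>sm S1 a (x2 + m2 * z) - sm S0 a (x2 + m2 * z)\<bar>) \<le> \<kappa>"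
      "avg (\<lambda>z. fejer Sn z * \<bar>sm S1 a (x3 + m3 * z) - sm S0 a (x3 + m3 * z)\<bar>) \<le> \<kappa>"
    and u: "dev S0 u \<le> \<kappa>" "dev Sb u \<le> \<kappa>"
    and small: "(10 + 10 * D) * \<kappa> < \<epsilon> ^ 3" "\<epsilon> \<ge> 0"
  shows "\<exists>y z. a (x1 + m1 * (- u - y - z)) \<noteq> 0 \<and> a (x2 + m2 * y) \<noteq> 0 \<and> a (x3 + m3 * z) \<noteq> 0"
proof (rule ccontr)
  assume no: "\<not> ?thesis"
  define f where "f = sm S0 a"
  define g where "g = sm S1 a"
  define h where "h x = \<bar>g x - f x\<bar>" for x
  define w where "w y z = fejer Sb y * fejer Sn z" for y z
  have w0: "0 \<le> w y z" for y z by (simp add: w_def)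
  have D: "D \<ge> 0" using m(4) by linarith
  have fin: "finite S0" "finite Sb" "finite Sn" "finite S1"
    using S0 Sb Sn S1 finite_subset by blast+
  have per: "periodic f" "periodic g" "periodic h"
    unfolding h_def using periodic_sm[OF a(1)]
    by (auto simp: f_def g_def intro: periodic_comp2[where f = "\<lambda>x y. \<bar>x - y\<bar>"])
  have f01: "0 \<le> f x" "f x \<le> 1" and g01: "0 \<le> g x" "g x \<le> 1" for x
    unfolding f_def g_def using sm_bounds[OF S0, of a] sm_bounds[OF S1, of a] a(2) by auto
  have h01: "0 \<le> h x" "h x \<le> 1" for x using f01[of x] g01[of x] by (auto simp: h_def)
  \<comment> \<open>Scaled so that the factor \<open>card Sb * card Sn\<close> in
    \<open>tri_replace\<close> turns it into \<kappa>.\<close>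
  define \<eta> where "\<eta> = \<kappa> / (card Sb * card Sn)"
  have cards: "card Sb > 0" "card Sn > 0" using fin Sb Sn by (auto simp: card_gt_0_iff)
  then have \<eta>: "card Sb * card Sn * \<eta> = \<kappa>" by (simp add: \<eta>_def)
  have hat: "cmod (fourier (\<lambda>x. of_real (a x - g x)) r) \<le> \<eta>" for r
    using unif[of r] cards by (simp add: \<eta>_def g_def pos_le_divide_eq mult.commute)
  have hat_dil: "cmod (fourier (\<lambda>z. of_real (a (x + m * z) - g (x + m * z))) r) \<le> \<eta>"
    if "coprime m (int p)" for m x r
    by (rule norm_fourier_dilate[OF
          periodic_comp2[OF a(1) per(2), of "\<lambda>x y. complex_of_real (x - y)"] that hat])
  have tri_a: "tri u Sb Sn (\<lambda>z. a (x1 + m1 * z)) (\<lambda>z. a (x2 + m2 * z)) (\<lambda>z. a (x3 + m3 * z)) = 0"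
  proof -
    have "a (x1 + m1 * (- u - y - z)) * a (x2 + m2 * y) * a (x3 + m3 * z) = 0" for y z
      using no by auto
    then show ?thesis unfolding tri_def by (simp only: mult_zero_right avg_const)
  qed
  define t where "t = tri u Sb Sn (\<lambda>z. g (x1 + m1 * z)) (\<lambda>z. g (x2 + m2 * z)) (\<lambda>z. g (x3 + m3 * z))"
  have "\<bar>tri u Sb Sn (\<lambda>z. a (x1 + m1 * z)) (\<lambda>z. a (x2 + m2 * z)) (\<lambda>z. a (x3 + m3 * z)) - t\<bar>
      \<le> 3 * (card Sb * card Sn * \<eta>)"
    unfolding t_def
    by (rule tri_replace)
       (use fin Sb Sn a(2) g01 m hat_dil in \<open>auto intro!: periodic_dilate a(1) per\<close>)
  then have t_small: "\<bar>t\<bar> \<le> 3 * \<kappa>" unfolding \<eta> tri_a by simp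
  \<comment> \<open>A bound for the distance of g at x + m n from the constant f x: the first term
    pays for passing from fine to coarse smoothing, the second for the variation of the coarse
    smoothing.\<close>
  define k where "k x m n = h (x + m * n) + 2 * D * dev S0 n" for x m n
  have gk: "\<bar>g (x + m * n) - f x\<bar> \<le> k x m n" if "\<bar>m\<bar> \<le> D" for x m n
  proof -
    have "\<bar>f (x + m * n) - f x\<bar> \<le> 2 * dev S0 (m * n)"
      unfolding f_def by (rule sm_lipschitz[OF fin(1) S0(2) a(1)]) (use a(2) in auto)
    also have "\<dots> \<le> 2 * (\<bar>m\<bar> * dev S0 n)" using dev_mult[of S0 m n] by simp
    also have "\<dots> \<le> 2 * (D * dev S0 n)"
      by (intro mult_left_mono mult_right_mono) (use that in auto)
    finally show ?thesis by (simp add: k_def h_def)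
  qed
  define q where "q = f x1 * f x2 * f x3"
  have tot: "avg (\<lambda>y. avg (\<lambda>z. w y z)) = 1"
    using avg2_weight_left[OF Sn, of Sb "\<lambda>_. 1"] avg_fejer[OF Sb] by (simp add: w_def)
  have "\<bar>t - q\<bar> = \<bar>avg (\<lambda>y. avg (\<lambda>z. w y z * (g (x1 + m1 * (- u - y - z)) * g (x2 + m2 * y) * g (x3 + m3 * z)
      - q)))\<bar>"
    unfolding right_diff_distrib[of "w _ _"] avg_diff avg_cmult_right tot
    by (simp add: t_def tri_def w_def)
  also have "\<dots> \<le> avg (\<lambda>y. avg (\<lambda>z. \<bar>w y z * (g (x1 + m1 * (- u - y - z)) * g (x2 + m2 * y) * g (x3 + m3 * z)
      - q)\<bar>))"
    by (intro order_trans[OF abs_avg_le] avg_mono abs_avg_le)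
  also have "\<dots> \<le> avg (\<lambda>y. avg (\<lambda>z. w y z * (k x1 m1 (- u - y - z) + k x2 m2 y + k x3 m3 z)))"
    unfolding abs_mult abs_of_nonneg[OF w0]
  proof (intro avg_mono mult_left_mono w0)
    fix y z
    have "\<bar>g (x1 + m1 * (- u - y - z)) * g (x2 + m2 * y) * g (x3 + m3 * z) - q\<bar>
      \<le> \<bar>g (x1 + m1 * (- u - y - z)) - f x1\<bar> + \<bar>g (x2 + m2 * y) - f x2\<bar> + \<bar>g (x3 + m3 * z) - f x3\<bar>"
      unfolding q_def by (rule abs_prod3_diff_le) (use f01 g01 in auto)
    also have "\<dots> \<le> k x1 m1 (- u - y - z) + k x2 m2 y + k x3 m3 z"
      by (intro add_mono gk m)
    finally show "\<bar>g (x1 + m1 * (- u - y - z)) * g (x2 + m2 * y) * g (x3 + m3 * z) - q\<bar>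
      \<le> k x1 m1 (- u - y - z) + k x2 m2 y + k x3 m3 z" .
  qed
  also have "\<dots> = avg (\<lambda>y. avg (\<lambda>z. w y z * k x1 m1 (- u - y - z)))
      + avg (\<lambda>y. avg (\<lambda>z. w y z * k x2 m2 y)) + avg (\<lambda>y. avg (\<lambda>z. w y z * k x3 m3 z))"
    by (simp add: distrib_left avg_add)
  also have "avg (\<lambda>y. avg (\<lambda>z. w y z * k x3 m3 z)) \<le> \<kappa> + 2 * D * \<kappa>"
  proof -
    have "avg (\<lambda>y. avg (\<lambda>z. w y z * k x3 m3 z)) = avg (\<lambda>z. fejer Sn z * k x3 m3 z)"
      unfolding w_def by (rule avg2_weight_right[OF Sb])
    also have "\<dots> = avg (\<lambda>z. fejer Sn z * h (x3 + m3 * z)) + 2 * D * avg (\<lambda>z. fejer Sn z * dev S0 z)"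
      unfolding avg_cmult[symmetric] avg_add[symmetric] by (simp add: k_def algebra_simps)
    also have "\<dots> \<le> \<kappa> + 2 * D * \<kappa>"
      by (intro add_mono mult_left_mono conc) (use reg D in \<open>auto simp: h_def f_def g_def\<close>)
    finally show ?thesis .
  qed
  also have "avg (\<lambda>y. avg (\<lambda>z. w y z * k x2 m2 y)) \<le> \<kappa> + 2 * D * \<kappa>"
  proof -
    have "avg (\<lambda>y. avg (\<lambda>z. w y z * k x2 m2 y)) = avg (\<lambda>z. fejer Sb z * k x2 m2 z)"
      unfolding w_def by (rule avg2_weight_left[OF Sn])
    also have "\<dots> = avg (\<lambda>z. fejer Sb z * h (x2 + m2 * z)) + 2 * D * avg (\<lambda>z. fejer Sb z * dev S0 z)"
      unfolding avg_cmult[symmetric] avg_add[symmetric] by (simp add: k_def algebra_simps)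
    also have "\<dots> \<le> \<kappa> + 2 * D * \<kappa>"
      by (intro add_mono mult_left_mono conc) (use reg D in \<open>auto simp: h_def f_def g_def\<close>)
    finally show ?thesis .
  qed
  \<comment> \<open>Here 5 = 1 + 2 + 2, from \<open>reg\<close>, from \<open>dev Sb u\<close> and
    from the spread of z at scale \<open>Sb\<close>; and 6 = 3 * 2, since u, y and z all enter
    \<open>dev S0\<close>.\<close>
  also have "avg (\<lambda>y. avg (\<lambda>z. w y z * k x1 m1 (- u - y - z))) \<le> 5 * \<kappa> + 6 * D * \<kappa>"
  proof -
    have "avg (\<lambda>y. avg (\<lambda>z. w y z * k x1 m1 (- u - y - z)))
        \<le> avg (\<lambda>y. avg (\<lambda>z. w y z * h (x1 + m1 * (- u - y - z))
            + (w y z * (2 * D * dev S0 u) + (w y z * (2 * D * dev S0 y) + w y z * (2 * D * dev S0 z)))))"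
    proof (intro avg_mono)
      fix y z
      have "dev S0 (- u - y - z) \<le> dev S0 u + dev S0 y + dev S0 z"
        using dev_diff[of S0 "- u - y" z] dev_diff[of S0 "- u" y] by simp
      then have "2 * D * dev S0 (- u - y - z) \<le> 2 * D * (dev S0 u + dev S0 y + dev S0 z)"
        using D by (intro mult_left_mono) auto
      then have "k x1 m1 (- u - y - z) \<le> h (x1 + m1 * (- u - y - z))
          + (2 * D * dev S0 u + (2 * D * dev S0 y + 2 * D * dev S0 z))"
        by (simp add: k_def algebra_simps)
      from mult_left_mono[OF this w0[of y z]]
      show "w y z * k x1 m1 (- u - y - z) \<le> w y z * h (x1 + m1 * (- u - y - z))
            + (w y z * (2 * D * dev S0 u) + (w y z * (2 * D * dev S0 y) + w y z * (2 * D * dev S0 z)))"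
        by (simp add: distrib_left)
    qed
    also have "\<dots> = avg (\<lambda>y. avg (\<lambda>z. w y z * h (x1 + m1 * (- u - y - z))))
        + (2 * D * dev S0 u + (2 * D * avg (\<lambda>y. fejer Sb y * dev S0 y) + 2 * D * avg (\<lambda>z. fejer Sn z * dev S0 z)))"
    proof -
      have 1: "avg (\<lambda>y. avg (\<lambda>z. w y z * (2 * D * dev S0 u))) = 2 * D * dev S0 u"
        unfolding avg_cmult_right tot by simp
      have 2: "avg (\<lambda>y. avg (\<lambda>z. w y z * (2 * D * dev S0 y))) = 2 * D * avg (\<lambda>y. fejer Sb y * dev S0 y)"
        unfolding w_def avg2_weight_left[OF Sn] avg_cmult[symmetric] by (simp add: mult_ac)
      have 3: "avg (\<lambda>y. avg (\<lambda>z. w y z * (2 * D * dev S0 z))) = 2 * D * avg (\<lambda>z. fejer Sn z * dev S0 z)"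
        unfolding w_def avg2_weight_right[OF Sb] avg_cmult[symmetric] by (simp add: mult_ac)
      show ?thesis unfolding avg_add 1 2 3 ..
    qed
    also have "avg (\<lambda>y. avg (\<lambda>z. w y z * h (x1 + m1 * (- u - y - z))))
        \<le> avg (\<lambda>y. fejer Sb y * h (x1 + m1 * y)) + 2 * dev Sb u + 2 * avg (\<lambda>z. fejer Sn z * dev Sb z)"
      unfolding w_def
      by (rule avg2_weight_shift_le[OF Sb Sn, of "\<lambda>n. h (x1 + m1 * n)"])
         (use h01 in \<open>auto intro: periodic_dilate per\<close>)
    also have "\<dots> \<le> \<kappa> + 2 * \<kappa> + 2 * \<kappa>"
      by (intro add_mono mult_left_mono conc u) (use reg in \<open>auto simp: h_def f_def g_def\<close>)
    also have "2 * D * dev S0 u + (2 * D * avg (\<lambda>y. fejer Sb y * dev S0 y) + 2 * D * avg (\<lambda>z. fejer Sn z * dev S0 z))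
        \<le> 2 * D * \<kappa> + (2 * D * \<kappa> + 2 * D * \<kappa>)"
      by (intro add_mono mult_left_mono conc u) (use D in auto)
    finally show ?thesis by (simp add: algebra_simps)
  qed
  finally have "\<bar>t - q\<bar> \<le> 7 * \<kappa> + 10 * D * \<kappa>" by (simp add: algebra_simps)
  moreover have "q \<ge> \<epsilon> ^ 3"
    unfolding q_def power3_eq_cube f_def using small(2) dense
    by (intro mult_mono mult_nonneg_nonneg) auto
  \<comment> \<open>The contradiction is q \<le> |t| + |t - q| \<le> 3 \<kappa> + (7 + 10 D)
    \<kappa> < \<epsilon>^3 \<le> q.\<close>
  ultimately show False using t_small small(1) by (simp add: algebra_simps)
qed

end

section \<open>Choice of scales\<close>

text \<open>The bound of \<open>folner\<close> on the size of S for k frequencies, with the defect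
  (\<kappa>/(k + 1))^2/2 that makes the bound of \<open>avg_fejer_dev\<close> at most \<kappa>. The
  choice of N involves k and \<kappa> only, so everything built on it is uniform in p.\<close>

definition scale_bound :: "nat \<Rightarrow> real \<Rightarrow> nat" where
  "scale_bound k \<kappa> = ((SOME N. (real N + 1) ^ k < (1 + (\<kappa> / (real k + 1))\<^sup>2 / 2) ^ N) + 1) ^ k"

text \<open>Follows the construction in \<open>good_scales_exist\<close>: \<open>kb\<close> and
  \<open>kn\<close> bound \<open>Sb\<close> and \<open>Sn\<close>, \<eta> is the uniformity
  threshold they force, and the argument of the last \<open>scale_bound\<close> counts S, its
  differences and the frequencies with Fourier coefficient at least \<eta>. The leading
  \<open>kb\<close> makes the same number a bound for \<open>Sb\<close>.\<close>

definition next_bound :: "real \<Rightarrow> real \<Rightarrow> nat \<Rightarrow> nat" where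
  "next_bound \<kappa> \<tau> K =
    (let kb = scale_bound K \<kappa>; kn = scale_bound (K + kb) \<kappa>; \<eta> = \<kappa> / (real kb * real kn)
     in kb + scale_bound (K + K * K + nat \<lceil>1 / \<eta>\<^sup>2\<rceil>) (min \<kappa> (min \<eta> \<tau>)))"

lemma scale_bound_pos: "scale_bound k \<kappa> > 0"
  by (simp add: scale_bound_def)

context cyclic
begin

lemma scale_exists:
  assumes R: "finite R" "card R \<le> k" and \<kappa>: "0 < \<kappa>" "\<kappa> \<le> 1"
  shows "\<exists>S. S \<subseteq> {0..<int p} \<and> S \<noteq> {} \<and> card S \<le> scale_bound k \<kappa>
    \<and> avg (\<lambda>z. fejer S z * dev R z) \<le> \<kappa> \<and> (\<forall>r\<in>R. ov S r \<ge> 1 - \<kappa>)"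
proof -
  define \<delta> where "\<delta> = \<kappa> / (real k + 1)"
  have \<delta>: "0 < \<delta>" "\<delta> \<le> \<kappa>" "\<delta> \<le> 1" "real k * \<delta> \<le> \<kappa>"
    using \<kappa> by (auto simp: \<delta>_def field_simps)
  define N where "N = (SOME N. (real N + 1) ^ k < (1 + \<delta>\<^sup>2 / 2) ^ N)"
  have "(real N + 1) ^ k < (1 + \<delta>\<^sup>2 / 2) ^ N"
    unfolding N_def by (rule someI_ex, rule ex_exponential_gt_polynomial) (use \<delta> in simp)
  then obtain S where S: "S \<subseteq> {0..<int p}" "S \<noteq> {}" "card S \<le> (N + 1) ^ k"
    "\<And>r. r \<in> R \<Longrightarrow> ov S r \<ge> 1 - \<delta>\<^sup>2 / 2"
    using folner[OF R, of "\<delta>\<^sup>2 / 2" N] \<delta>(1) by auto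
  have "avg (\<lambda>z. fejer S z * dev R z) \<le> card R * \<delta>"
    by (rule avg_fejer_dev[OF S(1,2) \<delta>(1) S(4)])
  also have "\<dots> \<le> real k * \<delta>" using R \<delta> by (intro mult_right_mono) auto
  finally have "avg (\<lambda>z. fejer S z * dev R z) \<le> \<kappa>" using \<delta>(4) by simp
  moreover have "\<delta>\<^sup>2 / 2 \<le> \<kappa>"
  proof -
    have "\<delta>\<^sup>2 \<le> 1 * \<delta>" unfolding power2_eq_square using \<delta> by (intro mult_right_mono) auto
    then show ?thesis using \<delta> by simp
  qed
  moreover have "card S \<le> scale_bound k \<kappa>"
    using S(3) by (simp add: scale_bound_def N_def \<delta>_def)
  ultimately show ?thesis using S by (intro exI[of _ S]) force
qed

text \<open>A pigeonhole argument: the kernel of a set T almost invariant under S has mass 1, and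
  the point 0 carries at most \<open>card T / p\<close> of it, which is at most 1/2. If
  \<open>dev S\<close> exceeded \<delta> at every other residue, its kernel mean, which is at most
  \<delta>/4, would be at least \<delta>/2.\<close>

lemma exists_small_dev:
  assumes S: "finite S" "card S \<le> k" and \<delta>: "\<delta> > 0"
    and p: "p > 2 * scale_bound k (min 1 (\<delta> / 4))"
  shows "\<exists>z\<in>{0<..<int p}. dev S z \<le> \<delta>"
proof (rule ccontr)
  assume no: "\<not> ?thesis"
  define \<kappa> where "\<kappa> = min 1 (\<delta> / 4)"
  obtain T where T: "T \<subseteq> {0..<int p}" "T \<noteq> {}" "card T \<le> scale_bound k \<kappa>"
      "avg (\<lambda>z. fejer T z * dev S z) \<le> \<kappa>"
    using scale_exists[OF S, of \<kappa>] \<delta> by (auto simp: \<kappa>_def)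
  have fin: "finite T" using T(1) finite_subset by blast
  have "avg (\<lambda>z. \<delta> * fejer T z) \<le> avg (\<lambda>z. fejer T z * dev S z + \<delta> * (if z = 0 then real (card T) else 0))"
  proof (rule avg_mono_on)
    fix z assume z: "z \<in> {0..<int p}"
    show "\<delta> * fejer T z \<le> fejer T z * dev S z + \<delta> * (if z = 0 then real (card T) else 0)"
    proof (cases "z = 0")
      case True
      then show ?thesis using fejer_le[OF fin T(2), of 0] \<delta> by simp
    next
      case False
      then have "\<delta> \<le> dev S z" using no z by force
      from mult_left_mono[OF this, of "fejer T z"] show ?thesis using False by (simp add: mult.commute)
    qed
  qed
  also have "\<dots> = avg (\<lambda>z. fejer T z * dev S z) + \<delta> * (card T / p)"
    using p_pos unfolding avg_add avg_cmult by (simp add: avg_def)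
  also have "\<dots> \<le> \<delta> / 4 + \<delta> * (1 / 2)"
  proof (intro add_mono mult_left_mono)
    show "avg (\<lambda>z. fejer T z * dev S z) \<le> \<delta> / 4" using T(4) by (simp add: \<kappa>_def)
    have "2 * card T \<le> p" using T(3) p by (simp add: \<kappa>_def)
    then show "card T / p \<le> 1 / 2" using p_pos by (simp add: field_simps)
  qed (use \<delta> in simp)
  finally show False using \<delta> by (simp add: avg_cmult avg_fejer[OF T(1,2)])
qed

lemma norm_fourier_le:
  assumes "\<And>x. cmod (h x) \<le> 1"
  shows "cmod (fourier h r) \<le> 1"
proof -
  have "cmod (fourier h r) \<le> avg (\<lambda>x. cmod (h x * chi (- (r * x))))"
    unfolding fourier_def by (rule norm_avg_le)
  also have "\<dots> \<le> avg (\<lambda>_. 1)" by (rule avg_mono) (simp add: norm_mult assms)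
  finally show ?thesis by simp
qed

lemma card_large_spectrum:
  assumes "periodic h" "\<And>x. cmod (h x) \<le> 1" "\<eta> > 0"
  shows "card {r\<in>{0..<int p}. cmod (fourier h r) \<ge> \<eta>} \<le> nat \<lceil>1 / \<eta>\<^sup>2\<rceil>"
proof -
  let ?R = "{r\<in>{0..<int p}. cmod (fourier h r) \<ge> \<eta>}"
  have "card ?R * \<eta>\<^sup>2 \<le> (\<Sum>r\<in>?R. (cmod (fourier h r))\<^sup>2)"
    by (rule sum_bounded_below) (use assms(3) in \<open>auto intro: power_mono\<close>)
  also have "\<dots> \<le> (\<Sum>r\<in>{0..<int p}. (cmod (fourier h r))\<^sup>2)"
    by (rule sum_mono2) auto
  also have "\<dots> = avg (\<lambda>x. (cmod (h x))\<^sup>2)" by (rule parseval[OF assms(1)])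
  also have "\<dots> \<le> avg (\<lambda>_. 1)" by (rule avg_mono) (simp add: power_le_one assms)
  finally have "real (card ?R) \<le> 1 / \<eta>\<^sup>2" using assms(3) by (simp add: pos_le_divide_eq)
  then show ?thesis by linarith
qed

lemma fourier_diff: "fourier (\<lambda>x. h x - k x) r = fourier h r - fourier k r"
  by (simp add: fourier_def avg_diff left_diff_distrib)

text \<open>The first three averages and the Fourier bound are what \<open>local_solution\<close>
  asks of \<open>Sb\<close> and \<open>Sn\<close> between a coarse S and a fine S'. The fourth
  average is for \<open>low_density_part\<close>.\<close>

definition good_scales :: "real \<Rightarrow> (int \<Rightarrow> real) \<Rightarrow> int set \<Rightarrow> int set \<Rightarrow> int set \<Rightarrow> int set \<Rightarrow> bool" where
  "good_scales \<kappa> a S Sb Sn S' \<longleftrightarrow>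
    Sb \<subseteq> {0..<int p} \<and> Sb \<noteq> {} \<and> Sn \<subseteq> {0..<int p} \<and> Sn \<noteq> {} \<and>
    avg (\<lambda>z. fejer Sb z * dev S z) \<le> \<kappa> \<and> avg (\<lambda>z. fejer Sn z * dev S z) \<le> \<kappa> \<and>
    avg (\<lambda>z. fejer Sn z * dev Sb z) \<le> \<kappa> \<and> avg (\<lambda>z. fejer S' z * dev S z) \<le> \<kappa> \<and>
    (\<forall>r. card Sb * card Sn * cmod (fourier (\<lambda>x. of_real (a x - sm S' a x)) r) \<le> \<kappa>)"

lemma avg_fejer_dev_mono:
  assumes "finite T" "S \<subseteq> T" "avg (\<lambda>z. fejer U z * dev T z) \<le> \<kappa>"
  shows "avg (\<lambda>z. fejer U z * dev S z) \<le> \<kappa>"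
proof -
  have "avg (\<lambda>z. fejer U z * dev S z) \<le> avg (\<lambda>z. fejer U z * dev T z)"
    by (intro avg_mono mult_left_mono dev_mono assms) simp
  then show ?thesis using assms(3) by linarith
qed

text \<open>\<open>Sb\<close> and \<open>Sn\<close> are chosen before S', so that the threshold
  \<eta> for the large spectrum can absorb their sizes. The last conclusion makes \<open>ov\<close>
  almost increasing along a chain of scales, which the energy argument requires.\<close>

lemma good_scales_exist:
  fixes a :: "int \<Rightarrow> real"
  assumes S: "S \<subseteq> {0..<int p}" "S \<noteq> {}" "card S \<le> K"
    and a: "periodic a" "\<And>x. a x \<in> {0..1}"
    and \<kappa>: "0 < \<kappa>" "\<kappa> \<le> 1" and \<tau>: "0 < \<tau>"
  shows "\<exists>Sb Sn S'. good_scales \<kappa> a S Sb Sn S' \<and> S' \<subseteq> {0..<int p} \<and> S' \<noteq> {}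
    \<and> card Sb \<le> next_bound \<kappa> \<tau> K \<and> card S' \<le> next_bound \<kappa> \<tau> K \<and> (\<forall>r. ov S' r \<ge> ov S r - \<tau>)"
proof -
  have fS: "finite S" using S finite_subset by blast
  define kb where "kb = scale_bound K \<kappa>"
  define kn where "kn = scale_bound (K + kb) \<kappa>"
  define \<eta> where "\<eta> = \<kappa> / (real kb * real kn)"
  have pos: "kb > 0" "kn > 0" by (simp_all add: kb_def kn_def scale_bound_pos)
  then have \<eta>: "\<eta> > 0" using \<kappa> by (simp add: \<eta>_def)
  obtain Sb where Sb: "Sb \<subseteq> {0..<int p}" "Sb \<noteq> {}" "card Sb \<le> kb"
      "avg (\<lambda>z. fejer Sb z * dev S z) \<le> \<kappa>"
    using scale_exists[OF fS S(3) \<kappa>] unfolding kb_def by blast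
  have fSb: "finite Sb" using Sb finite_subset by blast
  have "card (S \<union> Sb) \<le> K + kb" using card_Un_le[of S Sb] S(3) Sb(3) by linarith
  from scale_exists[OF finite_UnI[OF fS fSb] this \<kappa>]
  obtain Sn where Sn: "Sn \<subseteq> {0..<int p}" "Sn \<noteq> {}" "card Sn \<le> kn"
      "avg (\<lambda>z. fejer Sn z * dev (S \<union> Sb) z) \<le> \<kappa>"
    unfolding kn_def by blast
  let ?ha = "fourier (\<lambda>x. complex_of_real (a x))"
  define Spec where "Spec = {r\<in>{0..<int p}. cmod (?ha r) \<ge> \<eta>}"
  define Df where "Df = (\<lambda>(s, t). t - s) ` (S \<times> S)"
  have a1: "cmod (complex_of_real (a x)) \<le> 1" for x using a(2)[of x] by auto
  have cSpec: "card Spec \<le> nat \<lceil>1 / \<eta>\<^sup>2\<rceil>"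
    unfolding Spec_def
  proof (rule card_large_spectrum)
    show "periodic (\<lambda>x. complex_of_real (a x))" by (rule periodic_comp[OF a(1)])
  qed (rule a1 \<eta>)+
  have cDf: "card Df \<le> K * K"
    using card_image_le[of "S \<times> S" "\<lambda>(s, t). t - s"] fS mult_le_mono[OF S(3) S(3)]
    by (simp add: Df_def card_cartesian_product)
  \<comment> \<open>Invariance of S' under S concentrates its kernel where \<open>dev S\<close> is
    small, invariance under the differences \<open>Df\<close> keeps \<open>ov S'\<close> from
    falling below \<open>ov S\<close> by more than \<tau>, and invariance under \<open>Spec\<close>
    keeps the large Fourier coefficients of \<open>a\<close> almost unchanged by smoothing.\<close>
  define R where "R = S \<union> Df \<union> Spec"
  have "Spec \<subseteq> {0..<int p}" by (auto simp: Spec_def)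
  then have "finite Spec" using finite_subset by blast
  then have fR: "finite R" using fS by (simp add: R_def Df_def)
  have cR: "card R \<le> K + K * K + nat \<lceil>1 / \<eta>\<^sup>2\<rceil>"
    using card_Un_le[of "S \<union> Df" Spec] card_Un_le[of S Df] cSpec cDf S(3) unfolding R_def by linarith
  define \<kappa>1 where "\<kappa>1 = min \<kappa> (min \<eta> \<tau>)"
  have \<kappa>1: "0 < \<kappa>1" "\<kappa>1 \<le> 1" using \<kappa> \<eta> \<tau> by (auto simp: \<kappa>1_def)
  from scale_exists[OF fR cR \<kappa>1]
  obtain S' where S': "S' \<subseteq> {0..<int p}" "S' \<noteq> {}"
      "card S' \<le> scale_bound (K + K * K + nat \<lceil>1 / \<eta>\<^sup>2\<rceil>) \<kappa>1"
      "avg (\<lambda>z. fejer S' z * dev R z) \<le> \<kappa>1" "\<forall>r\<in>R. ov S' r \<ge> 1 - \<kappa>1"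
    by blast
  have fS': "finite S'" using S' finite_subset by blast
  have nb: "next_bound \<kappa> \<tau> K = kb + scale_bound (K + K * K + nat \<lceil>1 / \<eta>\<^sup>2\<rceil>) \<kappa>1"
    by (simp add: next_bound_def Let_def kb_def kn_def \<eta>_def \<kappa>1_def)
  \<comment> \<open>If r moves some point of S into S, then r is a difference up to a multiple of p
    and S' is almost invariant under it; otherwise \<open>ov S r\<close> vanishes.\<close>
  have ov: "ov S' r \<ge> ov S r - \<tau>" for r
  proof (cases "\<exists>s\<in>S. (s + r) mod int p \<in> S")
    case True
    then obtain s where s: "s \<in> S" "(s + r) mod int p \<in> S" by blast
    then have "(s + r) mod int p - s \<in> Df"
      unfolding Df_def by (intro image_eqI[of _ _ "(s, (s + r) mod int p)"]) simp_all
    then have "(s + r) mod int p - s \<in> R" by (simp add: R_def)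
    then have "ov S' ((s + r) mod int p - s) \<ge> 1 - \<kappa>1" using S'(5) by blast
    moreover have "ov S' ((s + r) mod int p - s) = ov S' r"
      by (rule ov_cong) (simp add: mod_diff_left_eq)
    ultimately show ?thesis using ov_le_1[OF fS, of r] by (simp add: \<kappa>1_def)
  next
    case False
    then have "{s\<in>S. (s + r) mod int p \<in> S} = {}" by blast
    then have "ov S r = 0" unfolding ov_def by (metis card.empty div_0 of_nat_0)
    then show ?thesis using ov_nonneg[of S' r] \<tau> by simp
  qed
  have unif: "card Sb * card Sn * cmod (fourier (\<lambda>x. of_real (a x - sm S' a x)) r) \<le> \<kappa>" for r
  proof -
    have "fourier (\<lambda>x. complex_of_real (a x - sm S' a x)) r = ?ha r * complex_of_real (1 - ov S' r)"
      by (simp add: fourier_diff fourier_sm[OF a(1) S'(1)] algebra_simps)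
    then have eq: "cmod (fourier (\<lambda>x. complex_of_real (a x - sm S' a x)) r) = cmod (?ha r) * (1 - ov S' r)"
      using ov_le_1[OF fS', of r] by (simp only: norm_mult norm_of_real abs_of_nonneg diff_ge_0_iff_ge)
    have mod: "?ha (r mod int p) = ?ha r" "ov S' (r mod int p) = ov S' r"
      by (rule periodicD[OF periodic_fourier]) (rule ov_cong, simp)
    \<comment> \<open>On the large spectrum the second factor is at most \<eta>, elsewhere the
      first; the other factor is always at most 1.\<close>
    have le: "cmod (?ha r) * (1 - ov S' r) \<le> \<eta>"
    proof (cases "cmod (?ha r) \<ge> \<eta>")
      case True
      then have "r mod int p \<in> R" using mod p_pos by (auto simp: R_def Spec_def)
      then have "1 - \<kappa>1 \<le> ov S' (r mod int p)" using S'(5) by blast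
      moreover have "\<kappa>1 \<le> \<eta>" by (simp add: \<kappa>1_def)
      ultimately have "1 - ov S' r \<le> \<eta>" using mod(2) by linarith
      moreover have "cmod (?ha r) \<le> 1" by (rule norm_fourier_le) (rule a1)
      ultimately have "cmod (?ha r) * (1 - ov S' r) \<le> 1 * \<eta>"
        using ov_le_1[OF fS', of r] by (intro mult_mono) auto
      then show ?thesis by simp
    next
      case False
      then have "cmod (?ha r) * (1 - ov S' r) \<le> \<eta> * 1"
        using ov_le_1[OF fS', of r] ov_nonneg[of S' r] \<eta> by (intro mult_mono) auto
      then show ?thesis by simp
    qed
    have "real (card Sb * card Sn) * (cmod (?ha r) * (1 - ov S' r)) \<le> real (kb * kn) * \<eta>"
    proof (rule mult_mono)
      show "real (card Sb * card Sn) \<le> real (kb * kn)"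
        unfolding of_nat_le_iff by (rule mult_le_mono[OF Sb(3) Sn(3)])
    qed (use ov_le_1[OF fS', of r] le in simp_all)
    also have "\<dots> = \<kappa>" using pos by (simp add: \<eta>_def)
    finally show ?thesis by (simp only: eq)
  qed
  have "good_scales \<kappa> a S Sb Sn S'"
    unfolding good_scales_def
  proof (intro conjI allI)
    show "avg (\<lambda>z. fejer Sn z * dev S z) \<le> \<kappa>" "avg (\<lambda>z. fejer Sn z * dev Sb z) \<le> \<kappa>"
      by (rule avg_fejer_dev_mono[OF finite_UnI[OF fS fSb] _ Sn(4)], simp)+
    have conc: "avg (\<lambda>z. fejer S' z * dev R z) \<le> \<kappa>" using S'(4) by (simp add: \<kappa>1_def)
    have "S \<subseteq> R" by (auto simp: R_def)
    then show "avg (\<lambda>z. fejer S' z * dev S z) \<le> \<kappa>"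
      by (rule avg_fejer_dev_mono[OF fR _ conc])
  qed (use Sb Sn unif in auto)
  moreover have "card Sb \<le> next_bound \<kappa> \<tau> K" "card S' \<le> next_bound \<kappa> \<tau> K"
    unfolding nb using S'(3) Sb(3) by linarith+
  ultimately show ?thesis using S'(1,2) ov by blast
qed

lemma energy_increment:
  assumes a: "periodic a" and S: "S \<subseteq> {0..<int p}" and S': "S' \<subseteq> {0..<int p}"
  shows "avg (\<lambda>x. (sm S' a x - sm S a x)\<^sup>2)
    = (\<Sum>r\<in>{0..<int p}. (cmod (fourier (\<lambda>x. of_real (a x)) r))\<^sup>2 * (ov S' r - ov S r)\<^sup>2)"
proof -
  have "avg (\<lambda>x. (sm S' a x - sm S a x)\<^sup>2) = avg (\<lambda>x. (cmod (of_real (sm S' a x) - of_real (sm S a x)))\<^sup>2)"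
    by (simp flip: of_real_diff)
  also have "\<dots> = (\<Sum>r\<in>{0..<int p}. (cmod (fourier (\<lambda>x. of_real (sm S' a x) - of_real (sm S a x)) r))\<^sup>2)"
    by (rule parseval[symmetric], rule periodic_comp2[where f = "\<lambda>x y. complex_of_real x - of_real y"])
       (rule periodic_sm[OF a])+
  also have "\<dots> = (\<Sum>r\<in>{0..<int p}. (cmod (fourier (\<lambda>x. of_real (a x)) r * of_real (ov S' r - ov S r)))\<^sup>2)"
    by (simp add: fourier_diff fourier_sm[OF a] S S' right_diff_distrib)
  also have "\<dots> = (\<Sum>r\<in>{0..<int p}. (cmod (fourier (\<lambda>x. of_real (a x)) r))\<^sup>2 * (ov S' r - ov S r)\<^sup>2)"
    by (simp add: norm_mult power_mult_distrib del: of_real_diff)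
  finally show ?thesis .
qed

text \<open>For each frequency the numbers \<open>ov (s j) r\<close> lie in [0, 1] and drop by at
  most 1/(2 J) per step, so their squared increments sum to at most 2: one unit from telescoping and
  one from compensating the drops. Weighting by the squared Fourier coefficients of
  \<open>a\<close>, whose sum is at most 1, bounds the total energy of all J steps by 2.\<close>

lemma energy_pigeonhole:
  fixes a :: "int \<Rightarrow> real"
  assumes a: "periodic a" "\<And>x. a x \<in> {0..1}" and J: "J > 0"
    and s: "\<And>j. s j \<subseteq> {0..<int p}" "\<And>j r. ov (s (Suc j)) r \<ge> ov (s j) r - 1 / (2 * real J)"
  shows "\<exists>j<J. avg (\<lambda>x. (sm (s (Suc j)) a x - sm (s j) a x)\<^sup>2) \<le> 2 / J"
proof (rule ccontr)
  assume "\<not> ?thesis"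
  then have gr: "avg (\<lambda>x. (sm (s (Suc j)) a x - sm (s j) a x)\<^sup>2) > 2 / J" if "j < J" for j
    using that by (auto simp: not_le)
  have fin: "finite (s j)" for j using s(1) finite_subset by blast
  have osc: "(\<Sum>j<J. (ov (s (Suc j)) r - ov (s j) r)\<^sup>2) \<le> 2" for r
  proof -
    have "(\<Sum>j<J. (ov (s (Suc j)) r - ov (s j) r)\<^sup>2)
        \<le> (\<Sum>j<J. (ov (s (Suc j)) r - ov (s j) r) + 2 * (1 / (2 * real J)))"
    proof (rule sum_mono)
      fix j
      have "\<bar>ov (s (Suc j)) r - ov (s j) r\<bar> \<le> 1"
        using ov_nonneg[of "s j" r] ov_nonneg[of "s (Suc j)" r] ov_le_1[OF fin, of j r]
          ov_le_1[OF fin, of "Suc j" r] by linarith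
      then have "\<bar>ov (s (Suc j)) r - ov (s j) r\<bar> * \<bar>ov (s (Suc j)) r - ov (s j) r\<bar>
          \<le> 1 * \<bar>ov (s (Suc j)) r - ov (s j) r\<bar>"
        by (intro mult_right_mono) auto
      then have "(ov (s (Suc j)) r - ov (s j) r)\<^sup>2 \<le> \<bar>ov (s (Suc j)) r - ov (s j) r\<bar>"
        by (simp add: power2_eq_square abs_mult[symmetric])
      also have "\<dots> \<le> (ov (s (Suc j)) r - ov (s j) r) + 2 * (1 / (2 * real J))"
      proof -
        have "0 \<le> 1 / (2 * real J)" by simp
        then show ?thesis using s(2)[of j r] by linarith
      qed
      finally show "(ov (s (Suc j)) r - ov (s j) r)\<^sup>2
          \<le> (ov (s (Suc j)) r - ov (s j) r) + 2 * (1 / (2 * real J))" .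
    qed
    also have "\<dots> = ov (s J) r - ov (s 0) r + 1"
      using J sum_lessThan_telescope[of "\<lambda>j. ov (s j) r" J] by (simp add: sum.distrib)
    also have "\<dots> \<le> 2" using ov_le_1[OF fin, of J r] ov_nonneg[of "s 0" r] by simp
    finally show ?thesis .
  qed
  let ?ha = "\<lambda>r. (cmod (fourier (\<lambda>x. complex_of_real (a x)) r))\<^sup>2"
  have "(\<Sum>j<J. avg (\<lambda>x. (sm (s (Suc j)) a x - sm (s j) a x)\<^sup>2))
      = (\<Sum>r\<in>{0..<int p}. ?ha r * (\<Sum>j<J. (ov (s (Suc j)) r - ov (s j) r)\<^sup>2))"
    by (simp add: energy_increment[OF a(1) s(1) s(1)] sum_distrib_left sum.swap[of _ "{0..<int p}"])
  also have "\<dots> \<le> (\<Sum>r\<in>{0..<int p}. ?ha r * 2)"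
    by (intro sum_mono mult_left_mono osc) simp
  also have "\<dots> = avg (\<lambda>x. (cmod (complex_of_real (a x)))\<^sup>2) * 2"
    by (simp add: sum_distrib_right[symmetric] parseval[OF periodic_comp[OF a(1)]])
  also have "\<dots> \<le> avg (\<lambda>_. 1) * 2"
    by (intro mult_right_mono avg_mono) (use a(2) in \<open>auto simp: power_le_one\<close>)
  finally have "(\<Sum>j<J. avg (\<lambda>x. (sm (s (Suc j)) a x - sm (s j) a x)\<^sup>2)) \<le> 2" by simp
  moreover have "(\<Sum>j<J. avg (\<lambda>x. (sm (s (Suc j)) a x - sm (s j) a x)\<^sup>2)) > (\<Sum>j<J. 2 / real J)"
    by (rule sum_strict_mono) (use J gr in auto)
  ultimately show False using J by simp
qed

end

section \<open>Robust subsets\<close>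

context cyclic
begin

lemma avg_indicator: "avg (\<lambda>x. of_bool (x mod int p \<in> B)) = real (card (B \<inter> {0..<int p})) / p"
proof -
  have "(\<Sum>x\<in>{0..<int p}. of_bool (x mod int p \<in> B)) = (\<Sum>x\<in>{0..<int p}. of_bool (x \<in> B) :: real)"
    by (rule sum.cong) auto
  then show ?thesis by (simp add: avg_def sum_of_bool_eq Int_commute Int_def)
qed

lemma avg_le_of_sq:
  fixes h :: "int \<Rightarrow> real"
  assumes "avg (\<lambda>x. (h x)\<^sup>2) \<le> \<theta>\<^sup>2" "\<theta> > 0"
  shows "avg (\<lambda>x. \<bar>h x\<bar>) \<le> \<theta>"
proof -
  have "avg (\<lambda>x. \<bar>h x\<bar>) \<le> avg (\<lambda>x. \<theta> / 2 + (h x)\<^sup>2 * (1 / (2 * \<theta>)))"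
  proof (rule avg_mono)
    fix x
    have "2 * \<theta> * \<bar>h x\<bar> \<le> \<theta>\<^sup>2 + \<bar>h x\<bar>\<^sup>2" using sum_squares_bound[of \<theta> "\<bar>h x\<bar>"] by simp
    then show "\<bar>h x\<bar> \<le> \<theta> / 2 + (h x)\<^sup>2 * (1 / (2 * \<theta>))"
      using assms(2) by (simp add: field_simps power2_eq_square)
  qed
  also have "\<dots> = \<theta> / 2 + avg (\<lambda>x. (h x)\<^sup>2) * (1 / (2 * \<theta>))"
    unfolding avg_add avg_cmult_right by simp
  also have "\<dots> \<le> \<theta> / 2 + \<theta>\<^sup>2 * (1 / (2 * \<theta>))"
    using assms by (intro add_left_mono mult_right_mono) auto
  also have "\<dots> = \<theta>" using assms(2) by (simp add: power2_eq_square)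
  finally show ?thesis .
qed

lemma avg_smoothed_dilate:
  assumes k: "periodic k" and S: "S \<subseteq> {0..<int p}" "S \<noteq> {}"
  shows "avg (\<lambda>x. avg (\<lambda>z. fejer S z * k (x + m * z))) = avg k"
proof -
  have "avg (\<lambda>x. avg (\<lambda>z. fejer S z * k (x + m * z))) = avg (\<lambda>z. fejer S z * avg (\<lambda>x. k (x + m * z)))"
    by (subst avg_swap) (simp add: avg_cmult)
  also have "\<dots> = avg (\<lambda>z. fejer S z * avg k)"
  proof -
    have "avg (\<lambda>x. k (x + m * z)) = avg k" for z
      using avg_shift[OF k, of "m * z"] by (simp add: add.commute)
    then show ?thesis by simp
  qed
  finally show ?thesis by (simp add: avg_cmult_right avg_fejer[OF S])
qed

text \<open>The points of the set at which its coarse smoothing is small contribute little: smoothing at the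
  fine scale moves the cutoff, a slowly varying function, onto the fine smoothing of the set.\<close>

lemma low_density_part:
  fixes a :: "int \<Rightarrow> real"
  assumes S: "S \<subseteq> {0..<int p}" "S \<noteq> {}" and S': "S' \<subseteq> {0..<int p}" "S' \<noteq> {}"
    and a: "periodic a" "\<And>x. a x \<in> {0..1}" and \<epsilon>: "\<epsilon> > 0"
    and conc: "avg (\<lambda>z. fejer S' z * dev S z) \<le> \<kappa>"
    and close: "avg (\<lambda>x. \<bar>sm S' a x - sm S a x\<bar>) \<le> \<theta>"
  shows "avg (\<lambda>x. a x * of_bool (sm S a x < \<epsilon>)) \<le> 2 * \<kappa> / \<epsilon> + 4 * \<epsilon> + 2 * \<theta>"
proof -
  define f where "f = sm S a"
  define g where "g = sm S' a"
  \<comment> \<open>The line through the value 1 at \<epsilon> and 0 at 2 \<epsilon>, truncated: at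
    least 1 below \<epsilon>, zero beyond 2 \<epsilon>, with Lipschitz constant 1/\<epsilon>. The
    truncation at 2 makes no difference for t \<ge> 0.\<close>
  define \<phi> where "\<phi> t = max 0 (min 2 (2 - t / \<epsilon>))" for t
  have \<phi>_lip: "\<phi> t \<le> \<phi> t' + \<bar>t' - t\<bar> / \<epsilon>" for t t'
  proof -
    have "t' / \<epsilon> \<le> t / \<epsilon> + \<bar>t' - t\<bar> / \<epsilon>"
      unfolding add_divide_distrib[symmetric] using \<epsilon> by (intro divide_right_mono) auto
    moreover have "0 \<le> \<bar>t' - t\<bar> / \<epsilon>" using \<epsilon> by simp
    ultimately show ?thesis unfolding \<phi>_def by linarith
  qed
  have \<phi>_bounds: "0 \<le> \<phi> t" "\<phi> t \<le> 2" for t by (auto simp: \<phi>_def)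
  have \<phi>_ge: "of_bool (t < \<epsilon>) \<le> \<phi> t" for t using \<epsilon> by (auto simp: \<phi>_def min_def max_def field_simps)
  have \<phi>_mult: "\<phi> t * t \<le> 4 * \<epsilon>" if "t \<ge> 0" for t
  proof (cases "t \<le> 2 * \<epsilon>")
    case True
    then have "\<phi> t * t \<le> 2 * (2 * \<epsilon>)" by (intro mult_mono) (use \<phi>_bounds that in auto)
    then show ?thesis by simp
  next
    case False
    then have "\<phi> t = 0" using \<epsilon> by (simp add: \<phi>_def field_simps)
    then show ?thesis using \<epsilon> by simp
  qed
  have fin: "finite S" using S finite_subset by blast
  have per: "periodic f" "periodic g" by (simp_all add: f_def g_def periodic_sm a(1))
  have per\<phi>: "periodic (\<lambda>x. \<phi> (f x))" by (rule periodic_comp[OF per(1)])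
  have f0: "0 \<le> f x" for x unfolding f_def using sm_bounds(1)[OF S, of a] a(2) by auto
  have "\<phi> (f x) \<le> sm S' (\<lambda>x. \<phi> (f x)) x + 2 * \<kappa> / \<epsilon>" for x
  proof -
    have "\<phi> (f x) = avg (\<lambda>z. fejer S' z * \<phi> (f x))" by (simp add: avg_cmult_right avg_fejer[OF S'])
    also have "\<dots> \<le> avg (\<lambda>z. fejer S' z * (\<phi> (f (x + z)) + 2 * dev S z / \<epsilon>))"
    proof (intro avg_mono mult_left_mono)
      fix z
      have "\<bar>f (x + z) - f x\<bar> \<le> 2 * dev S z"
        unfolding f_def by (rule sm_lipschitz[OF fin S(2) a(1)]) (use a(2) in auto)
      then have "\<bar>f (x + z) - f x\<bar> / \<epsilon> \<le> 2 * dev S z / \<epsilon>"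
        using \<epsilon> by (intro divide_right_mono) auto
      then show "\<phi> (f x) \<le> \<phi> (f (x + z)) + 2 * dev S z / \<epsilon>"
        using \<phi>_lip[of "f x" "f (x + z)"] by linarith
    qed simp
    also have "\<dots> = sm S' (\<lambda>x. \<phi> (f x)) x + avg (\<lambda>z. fejer S' z * dev S z) * (2 / \<epsilon>)"
      unfolding sm_def avg_cmult_right[symmetric] avg_add[symmetric] by (simp add: algebra_simps)
    also have "\<dots> \<le> sm S' (\<lambda>x. \<phi> (f x)) x + \<kappa> * (2 / \<epsilon>)"
      using conc \<epsilon> by (intro add_left_mono mult_right_mono) auto
    finally show ?thesis by (simp add: mult.commute)
  qed
  note \<phi>_sm = this
  have \<kappa>: "\<kappa> \<ge> 0" using conc avg_nonneg[of "\<lambda>z. fejer S' z * dev S z"] by simp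
  have "avg (\<lambda>x. a x * of_bool (f x < \<epsilon>)) \<le> avg (\<lambda>x. a x * sm S' (\<lambda>x. \<phi> (f x)) x + 2 * \<kappa> / \<epsilon>)"
  proof (rule avg_mono)
    fix x
    have "a x * of_bool (f x < \<epsilon>) \<le> a x * (sm S' (\<lambda>x. \<phi> (f x)) x + 2 * \<kappa> / \<epsilon>)"
      using order_trans[OF \<phi>_ge \<phi>_sm] a(2)[of x] by (intro mult_left_mono) auto
    also have "\<dots> \<le> a x * sm S' (\<lambda>x. \<phi> (f x)) x + 2 * \<kappa> / \<epsilon>"
    proof -
      have "a x * (2 * \<kappa> / \<epsilon>) \<le> 1 * (2 * \<kappa> / \<epsilon>)"
        using a(2)[of x] \<kappa> \<epsilon> by (intro mult_right_mono) auto
      then show ?thesis by (simp add: distrib_left)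
    qed
    finally show "a x * of_bool (f x < \<epsilon>) \<le> a x * sm S' (\<lambda>x. \<phi> (f x)) x + 2 * \<kappa> / \<epsilon>" .
  qed
  also have "\<dots> = avg (\<lambda>x. \<phi> (f x) * g x) + 2 * \<kappa> / \<epsilon>"
    unfolding avg_add avg_mult_sm[OF per\<phi> a(1)] by (simp add: g_def)
  also have "avg (\<lambda>x. \<phi> (f x) * g x) \<le> avg (\<lambda>x. 4 * \<epsilon> + 2 * \<bar>g x - f x\<bar>)"
  proof (rule avg_mono)
    fix x
    have "\<phi> (f x) * (g x - f x) \<le> 2 * \<bar>g x - f x\<bar>"
      by (rule order_trans[OF mult_left_mono mult_right_mono]) (use \<phi>_bounds in auto)
    then show "\<phi> (f x) * g x \<le> 4 * \<epsilon> + 2 * \<bar>g x - f x\<bar>"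
      using \<phi>_mult[OF f0, of x] by (simp add: right_diff_distrib)
  qed
  also have "\<dots> \<le> 4 * \<epsilon> + 2 * \<theta>"
    unfolding avg_add avg_cmult using close by (simp add: f_def g_def)
  finally show ?thesis by (simp add: f_def)
qed

text \<open>When the multipliers are C divided by the first three coefficients, the shifts change
  the value of the form by C (- u - y - z) + C y + C z = - C u, whatever y and z are.\<close>

definition solvable :: "int set \<Rightarrow> int \<Rightarrow> int \<Rightarrow> int \<Rightarrow> int \<Rightarrow> int \<Rightarrow> int \<Rightarrow> int \<Rightarrow> bool" where
  "solvable A u m1 m2 m3 x1 x2 x3 \<longleftrightarrow> (\<exists>y z. (x1 + m1 * (- u - y - z)) mod int p \<in> A
      \<and> (x2 + m2 * y) mod int p \<in> A \<and> (x3 + m3 * z) mod int p \<in> A)"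

text \<open>Two kinds of points of A are discarded: those of small coarse density, counted by
  \<open>low_density_part\<close>, and those around which, for some multiplier and one of the two
  intermediate scales, the smoothings differ by more than \<kappa> on average. Markov's inequality
  counts the latter.\<close>

lemma robust_subset_of_scales:
  fixes D \<kappa> \<epsilon> \<theta> :: real
  assumes A: "A \<subseteq> {0..<int p}"
    and a: "a = (\<lambda>x. of_bool (x mod int p \<in> A))"
    and S: "S \<subseteq> {0..<int p}" "S \<noteq> {}" and S': "S' \<subseteq> {0..<int p}" "S' \<noteq> {}"
    and good: "good_scales \<kappa> a S Sb Sn S'"
    and close: "avg (\<lambda>x. (sm S' a x - sm S a x)\<^sup>2) \<le> \<theta>\<^sup>2"
    and M: "finite M" "\<forall>m\<in>M. coprime m (int p)" "\<forall>m\<in>M. \<bar>m\<bar> \<le> D"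
    and par: "0 < \<kappa>" "0 < \<epsilon>" "0 < \<theta>" "\<kappa> \<le> \<epsilon>\<^sup>2" "\<theta> \<le> \<epsilon>" "2 * card M * \<theta> \<le> \<kappa> * \<epsilon>"
      "(10 + 10 * D) * \<kappa> < \<epsilon> ^ 3"
  shows "\<exists>B\<subseteq>A. real (card B) \<ge> card A - 9 * \<epsilon> * p \<and>
    (\<forall>x1\<in>B. \<forall>x2\<in>B. \<forall>x3\<in>B. \<forall>m1\<in>M. \<forall>m2\<in>M. \<forall>m3\<in>M. \<forall>u.
      dev (S \<union> Sb) u \<le> \<kappa> \<longrightarrow> solvable A u m1 m2 m3 x1 x2 x3)"
proof -
  have Sb: "Sb \<subseteq> {0..<int p}" "Sb \<noteq> {}" and Sn: "Sn \<subseteq> {0..<int p}" "Sn \<noteq> {}"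
    and conc: "avg (\<lambda>z. fejer Sb z * dev S z) \<le> \<kappa>" "avg (\<lambda>z. fejer Sn z * dev S z) \<le> \<kappa>"
      "avg (\<lambda>z. fejer Sn z * dev Sb z) \<le> \<kappa>" "avg (\<lambda>z. fejer S' z * dev S z) \<le> \<kappa>"
    and unif: "\<And>r. card Sb * card Sn * cmod (fourier (\<lambda>x. of_real (a x - sm S' a x)) r) \<le> \<kappa>"
    using good unfolding good_scales_def by auto
  have pa: "periodic a" by (simp add: a periodic_def)
  have a01: "a x \<in> {0..1}" for x by (simp add: a)
  define h where "h x = \<bar>sm S' a x - sm S a x\<bar>" for x
  have ph: "periodic h"
    unfolding h_def by (rule periodic_comp2[where f = "\<lambda>x y. \<bar>x - y\<bar>"]) (simp_all add: periodic_sm pa)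
  have h\<theta>: "avg h \<le> \<theta>" using avg_le_of_sq[OF close par(3)] by (simp add: h_def[abs_def])
  define H where "H T m x = avg (\<lambda>z. fejer T z * h (x + m * z))" for T m x
  have H0: "0 \<le> H T m x" for T m x unfolding H_def h_def by (intro avg_nonneg) auto
  have avgH: "avg (H Sb m) \<le> \<theta>" "avg (H Sn m) \<le> \<theta>" for m
    using avg_smoothed_dilate[OF ph] Sb Sn h\<theta> by (simp_all add: H_def[abs_def])
  have pf: "periodic (sm S a)" by (rule periodic_sm[OF pa])
  define B where "B = {x\<in>A. sm S a x \<ge> \<epsilon> \<and> (\<forall>m\<in>M. H Sb m x \<le> \<kappa> \<and> H Sn m x \<le> \<kappa>)}"
  have BA: "B \<subseteq> A" by (auto simp: B_def)
  have "avg (\<lambda>x. a x - of_bool (x mod int p \<in> B))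
      \<le> avg (\<lambda>x. a x * of_bool (sm S a x < \<epsilon>) + (\<Sum>m\<in>M. (H Sb m x + H Sn m x) / \<kappa>))"
  proof (rule avg_mono_on)
    fix x assume x: "x \<in> {0..<int p}"
    have nn: "0 \<le> (H Sb m x + H Sn m x) / \<kappa>" for m using H0 par(1) by simp
    show "a x - of_bool (x mod int p \<in> B)
      \<le> a x * of_bool (sm S a x < \<epsilon>) + (\<Sum>m\<in>M. (H Sb m x + H Sn m x) / \<kappa>)"
    proof (cases "x \<in> A \<and> x \<notin> B \<and> sm S a x \<ge> \<epsilon>")
      case True
      then obtain m where m: "m \<in> M" "\<kappa> < H Sb m x \<or> \<kappa> < H Sn m x"
        by (auto simp: B_def not_le)
      have "1 \<le> (H Sb m x + H Sn m x) / \<kappa>" using m(2) H0[of Sb m x] H0[of Sn m x] par(1) by auto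
      also have "\<dots> \<le> (\<Sum>m\<in>M. (H Sb m x + H Sn m x) / \<kappa>)"
        by (rule member_le_sum) (use m nn M in auto)
      finally show ?thesis using x True by (simp add: a)
    next
      case False
      have "0 \<le> (\<Sum>m\<in>M. (H Sb m x + H Sn m x) / \<kappa>)" by (intro sum_nonneg nn)
      then show ?thesis using x False by (auto simp: a)
    qed
  qed
  also have "\<dots> = avg (\<lambda>x. a x * of_bool (sm S a x < \<epsilon>)) + (\<Sum>m\<in>M. (avg (H Sb m) + avg (H Sn m)) / \<kappa>)"
    by (simp only: avg_add avg_sum avg_divide)
  also have "\<dots> \<le> (2 * \<kappa> / \<epsilon> + 4 * \<epsilon> + 2 * \<theta>) + (\<Sum>m\<in>M. (\<theta> + \<theta>) / \<kappa>)"
  proof (intro add_mono sum_mono divide_right_mono avgH)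
    show "avg (\<lambda>x. a x * of_bool (sm S a x < \<epsilon>)) \<le> 2 * \<kappa> / \<epsilon> + 4 * \<epsilon> + 2 * \<theta>"
      by (rule low_density_part[OF S S' pa a01 par(2) conc(4)])
         (use h\<theta> in \<open>simp add: h_def[abs_def]\<close>)
  qed (use par in auto)
  \<comment> \<open>The nine is 2 from 2 \<kappa>/\<epsilon>, 4 from the cutoff, 2 from 2 \<theta>
    and 1 from the Markov terms.\<close>
  also have "\<dots> \<le> 9 * \<epsilon>"
  proof -
    have "2 * \<kappa> / \<epsilon> \<le> 2 * \<epsilon>" using par by (simp add: field_simps power2_eq_square)
    moreover have "(\<Sum>m\<in>M. (\<theta> + \<theta>) / \<kappa>) \<le> \<epsilon>" using par by (simp add: field_simps)
    ultimately show ?thesis using par by linarith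
  qed
  finally have "avg a - avg (\<lambda>x. of_bool (x mod int p \<in> B)) \<le> 9 * \<epsilon>" by (simp add: avg_diff)
  then have "real (card A) / p - real (card B) / p \<le> 9 * \<epsilon>"
    unfolding a avg_indicator using A subset_trans[OF BA A] by (simp add: Int_absorb2)
  then have card: "real (card B) \<ge> card A - 9 * \<epsilon> * p"
    using p_pos by (simp add: field_simps)
  have "solvable A u m1 m2 m3 x1 x2 x3"
    if x: "x1 \<in> B" "x2 \<in> B" "x3 \<in> B" and m: "m1 \<in> M" "m2 \<in> M" "m3 \<in> M"
      and u: "dev (S \<union> Sb) u \<le> \<kappa>" for x1 x2 x3 m1 m2 m3 u
  proof -
    have fin: "finite (S \<union> Sb)" using S Sb finite_subset by blast
    have u': "dev S u \<le> \<kappa>" "dev Sb u \<le> \<kappa>"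
      using dev_mono[OF fin, of S u] dev_mono[OF fin, of Sb u] u by auto
    have "\<exists>y z. a (x1 + m1 * (- u - y - z)) \<noteq> 0 \<and> a (x2 + m2 * y) \<noteq> 0 \<and> a (x3 + m3 * z) \<noteq> 0"
      by (rule local_solution[OF S Sb Sn S' pa a01 conc(1-3) unif _ _ _ _ _ _ _ _ _ _ _ _ u' par(7)])
         (use x m M par in \<open>auto simp: B_def H_def h_def\<close>)
    then show ?thesis by (auto simp: solvable_def a split: if_splits)
  qed
  then show ?thesis using BA card by (intro exI[of _ B] conjI ballI allI impI)
qed

text \<open>The chain of scales starts at \<open>{0}\<close> and is prolonged by
  \<open>good_scales_exist\<close>, with size bounds that do not see p or A. Which step the energy
  argument returns is not known in advance, so K adds up the bounds for all J steps.\<close>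

lemma robust_subset:
  fixes D \<kappa> \<epsilon> \<theta> :: real
  assumes A: "A \<subseteq> {0..<int p}"
    and M: "finite M" "\<forall>m\<in>M. coprime m (int p)" "\<forall>m\<in>M. \<bar>m\<bar> \<le> D"
    and par: "0 < \<kappa>" "\<kappa> \<le> 1" "0 < \<epsilon>" "0 < \<theta>" "\<kappa> \<le> \<epsilon>\<^sup>2" "\<theta> \<le> \<epsilon>" "2 * card M * \<theta> \<le> \<kappa> * \<epsilon>"
      "(10 + 10 * D) * \<kappa> < \<epsilon> ^ 3"
    and J: "J > 0" "2 / real J \<le> \<theta>\<^sup>2"
    and K: "K = (\<Sum>j<J. (next_bound \<kappa> (1 / (2 * real J)) ^^ j) 1
        + next_bound \<kappa> (1 / (2 * real J)) ((next_bound \<kappa> (1 / (2 * real J)) ^^ j) 1))"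
  shows "\<exists>R B. finite R \<and> card R \<le> K \<and> B \<subseteq> A \<and> real (card B) \<ge> card A - 9 * \<epsilon> * p \<and>
    (\<forall>x1\<in>B. \<forall>x2\<in>B. \<forall>x3\<in>B. \<forall>m1\<in>M. \<forall>m2\<in>M. \<forall>m3\<in>M. \<forall>u.
      dev R u \<le> \<kappa> \<longrightarrow> solvable A u m1 m2 m3 x1 x2 x3)"
proof -
  define a where "a = (\<lambda>x. of_bool (x mod int p \<in> A) :: real)"
  have pa: "periodic a" by (simp add: a_def periodic_def)
  have a01: "a x \<in> {0..1}" for x by (simp add: a_def)
  define \<tau> where "\<tau> = 1 / (2 * real J)"
  have \<tau>: "\<tau> > 0" using J by (simp add: \<tau>_def)
  define b where "b j = (next_bound \<kappa> \<tau> ^^ j) 1" for j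
  have b_Suc: "b (Suc j) = next_bound \<kappa> \<tau> (b j)" for j by (simp add: b_def)
  have "\<exists>s. \<forall>j. (s j \<subseteq> {0..<int p} \<and> s j \<noteq> {} \<and> card (s j) \<le> b j) \<and>
     ((\<exists>Sb Sn. good_scales \<kappa> a (s j) Sb Sn (s (Suc j)) \<and> card Sb \<le> next_bound \<kappa> \<tau> (b j)) \<and>
      (\<forall>r. ov (s (Suc j)) r \<ge> ov (s j) r - \<tau>))"
  proof (rule dependent_nat_choice)
    show "\<exists>S. S \<subseteq> {0..<int p} \<and> S \<noteq> {} \<and> card S \<le> b 0"
      using p_pos by (intro exI[of _ "{0}"]) (auto simp: b_def)
  next
    fix S j assume "S \<subseteq> {0..<int p} \<and> S \<noteq> {} \<and> card S \<le> b j"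
    then have "S \<subseteq> {0..<int p}" "S \<noteq> {}" "card S \<le> b j" by simp_all
    from good_scales_exist[OF this pa a01 par(1,2) \<tau>]
    obtain Sb Sn S' where "good_scales \<kappa> a S Sb Sn S'" "S' \<subseteq> {0..<int p}" "S' \<noteq> {}"
      "card Sb \<le> next_bound \<kappa> \<tau> (b j)" "card S' \<le> next_bound \<kappa> \<tau> (b j)"
      "\<forall>r. ov S' r \<ge> ov S r - \<tau>"
      by (elim exE conjE)
    then show "\<exists>S'. (S' \<subseteq> {0..<int p} \<and> S' \<noteq> {} \<and> card S' \<le> b (Suc j)) \<and>
      ((\<exists>Sb Sn. good_scales \<kappa> a S Sb Sn S' \<and> card Sb \<le> next_bound \<kappa> \<tau> (b j)) \<and>
       (\<forall>r. ov S' r \<ge> ov S r - \<tau>))"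
      unfolding b_Suc by (intro exI[of _ S'] exI[of _ Sb] exI[of _ Sn] conjI)
  qed
  then obtain s where "\<forall>j. (s j \<subseteq> {0..<int p} \<and> s j \<noteq> {} \<and> card (s j) \<le> b j) \<and>
     ((\<exists>Sb Sn. good_scales \<kappa> a (s j) Sb Sn (s (Suc j)) \<and> card Sb \<le> next_bound \<kappa> \<tau> (b j)) \<and>
      (\<forall>r. ov (s (Suc j)) r \<ge> ov (s j) r - \<tau>))" ..
  then have s: "s j \<subseteq> {0..<int p}" "s j \<noteq> {}" "card (s j) \<le> b j"
      "\<exists>Sb Sn. good_scales \<kappa> a (s j) Sb Sn (s (Suc j)) \<and> card Sb \<le> next_bound \<kappa> \<tau> (b j)"
      "ov (s (Suc j)) r \<ge> ov (s j) r - \<tau>" for j r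
    by simp_all
  obtain j where j: "j < J" "avg (\<lambda>x. (sm (s (Suc j)) a x - sm (s j) a x)\<^sup>2) \<le> 2 / J"
    using energy_pigeonhole[OF pa a01 J(1), where s = s, OF s(1) s(5)[unfolded \<tau>_def]] by (elim exE conjE)
  obtain Sb Sn where g: "good_scales \<kappa> a (s j) Sb Sn (s (Suc j))" "card Sb \<le> next_bound \<kappa> \<tau> (b j)"
    using s(4) by blast
  have "avg (\<lambda>x. (sm (s (Suc j)) a x - sm (s j) a x)\<^sup>2) \<le> \<theta>\<^sup>2" using j J by linarith
  from robust_subset_of_scales[OF A a_def s(1,2) s(1,2) g(1) this M par(1,3-8)]
  obtain B where B: "B \<subseteq> A" "real (card B) \<ge> card A - 9 * \<epsilon> * p"
    "\<forall>x1\<in>B. \<forall>x2\<in>B. \<forall>x3\<in>B. \<forall>m1\<in>M. \<forall>m2\<in>M. \<forall>m3\<in>M. \<forall>u.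
      dev (s j \<union> Sb) u \<le> \<kappa> \<longrightarrow> solvable A u m1 m2 m3 x1 x2 x3"
    by (elim exE conjE)
  have "Sb \<subseteq> {0..<int p}" using g(1) by (simp add: good_scales_def)
  then have "s j \<union> Sb \<subseteq> {0..<int p}" using s(1)[of j] by simp
  then have "finite (s j \<union> Sb)" by (rule finite_subset) simp
  moreover have "card (s j \<union> Sb) \<le> K"
  proof -
    have "card (s j \<union> Sb) \<le> b j + next_bound \<kappa> \<tau> (b j)"
      using card_Un_le[of "s j" Sb] s(3)[of j] g(2) by linarith
    also have "\<dots> \<le> (\<Sum>j<J. b j + next_bound \<kappa> \<tau> (b j))"
      by (rule member_le_sum) (use j in auto)
    also have "\<dots> = K" unfolding K b_def \<tau>_def ..
    finally show ?thesis .
  qed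
  ultimately show ?thesis by (intro exI[of _ "s j \<union> Sb"] exI[of _ B] conjI B)
qed

end

text \<open>The order of quantifiers is the point: K and \<kappa> come before p and A. The constants
  are fixed in the order \<kappa>, \<theta>, J, each in terms of the earlier ones.\<close>

theorem robust_subset_uniform:
  fixes M :: "int set" and \<epsilon> :: real
  assumes M: "finite M" and \<epsilon>: "\<epsilon> > 0"
  shows "\<exists>K \<kappa>. \<kappa> > 0 \<and> (\<forall>p A. p > 0 \<and> (\<forall>m\<in>M. coprime m (int p)) \<and> A \<subseteq> {0..<int p} \<longrightarrow>
    (\<exists>R B. finite R \<and> card R \<le> K \<and> B \<subseteq> A \<and> real (card B) \<ge> card A - \<epsilon> * p \<and>
    (\<forall>x1\<in>B. \<forall>x2\<in>B. \<forall>x3\<in>B. \<forall>m1\<in>M. \<forall>m2\<in>M. \<forall>m3\<in>M. \<forall>u.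
      cyclic.dev p R u \<le> \<kappa> \<longrightarrow> cyclic.solvable p A u m1 m2 m3 x1 x2 x3)))"
proof -
  define e where "e = \<epsilon> / 9"
  have e: "e > 0" "9 * e = \<epsilon>" using \<epsilon> by (auto simp: e_def)
  define D where "D = (\<Sum>m\<in>M. real_of_int \<bar>m\<bar>)"
  have D: "\<forall>m\<in>M. \<bar>m\<bar> \<le> D"
    unfolding D_def using member_le_sum[of _ M "\<lambda>m. real_of_int \<bar>m\<bar>"] M by simp
  have D0: "D \<ge> 0" by (simp add: D_def sum_nonneg)
  define \<kappa> where "\<kappa> = min (min 1 (e\<^sup>2)) (e ^ 3 / (2 * (10 + 10 * D)))"
  have \<kappa>: "0 < \<kappa>" "\<kappa> \<le> 1" "\<kappa> \<le> e\<^sup>2" using e D0 by (auto simp: \<kappa>_def)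
  have "(10 + 10 * D) * \<kappa> \<le> (10 + 10 * D) * (e ^ 3 / (2 * (10 + 10 * D)))"
    by (rule mult_left_mono) (use D0 in \<open>auto simp: \<kappa>_def\<close>)
  also have "\<dots> = e ^ 3 / 2" using D0 by (simp add: field_simps)
  also have "\<dots> < e ^ 3" using e by simp
  finally have \<kappa>3: "(10 + 10 * D) * \<kappa> < e ^ 3" .
  \<comment> \<open>The added 1 keeps the denominator positive when M is empty.\<close>
  define \<theta> where "\<theta> = min e (\<kappa> * e / (2 * card M + 1))"
  have \<theta>: "0 < \<theta>" "\<theta> \<le> e" using e \<kappa> by (auto simp: \<theta>_def)
  have "2 * card M * \<theta> \<le> (2 * card M + 1) * \<theta>" using \<theta> by (intro mult_right_mono) auto
  also have "\<dots> \<le> (2 * card M + 1) * (\<kappa> * e / (2 * card M + 1))"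
    by (intro mult_left_mono) (auto simp: \<theta>_def)
  also have "\<dots> = \<kappa> * e" by simp
  finally have \<theta>M: "2 * card M * \<theta> \<le> \<kappa> * e" .
  define J where "J = nat \<lceil>2 / \<theta>\<^sup>2\<rceil>"
  have "real J \<ge> 2 / \<theta>\<^sup>2" by (simp add: J_def)
  moreover have "2 / \<theta>\<^sup>2 > 0" using \<theta> by simp
  ultimately have "real J > 0" by linarith
  moreover have "2 \<le> real J * \<theta>\<^sup>2"
    using \<open>real J \<ge> 2 / \<theta>\<^sup>2\<close> \<theta> by (simp add: pos_divide_le_eq)
  ultimately have "J > 0" and J: "2 / real J \<le> \<theta>\<^sup>2"
    by (simp_all add: pos_divide_le_eq mult.commute)
  define K where "K = (\<Sum>j<J. (next_bound \<kappa> (1 / (2 * real J)) ^^ j) 1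
        + next_bound \<kappa> (1 / (2 * real J)) ((next_bound \<kappa> (1 / (2 * real J)) ^^ j) 1))"
  show ?thesis
  proof (intro exI[of _ K] exI[of _ \<kappa>] conjI allI impI \<kappa>(1))
    fix p :: nat and A :: "int set"
    assume p: "p > 0 \<and> (\<forall>m\<in>M. coprime m (int p)) \<and> A \<subseteq> {0..<int p}"
    then interpret cyclic p by unfold_locales simp
    have A: "A \<subseteq> {0..<int p}" and cop: "\<forall>m\<in>M. coprime m (int p)"
      using p by simp_all
    show "\<exists>R B. finite R \<and> card R \<le> K \<and> B \<subseteq> A \<and> real (card B) \<ge> card A - \<epsilon> * p \<and>
    (\<forall>x1\<in>B. \<forall>x2\<in>B. \<forall>x3\<in>B. \<forall>m1\<in>M. \<forall>m2\<in>M. \<forall>m3\<in>M. \<forall>u.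
      dev R u \<le> \<kappa> \<longrightarrow> solvable A u m1 m2 m3 x1 x2 x3)"
      using robust_subset[OF A M cop D \<kappa>(1,2) e(1) \<theta>(1) \<kappa>(3) \<theta>(2) \<theta>M \<kappa>3 \<open>J > 0\<close> J K_def]
      unfolding e(2) .
  qed
qed

section \<open>Reduction to sums of reals and integers\<close>

text \<open>Reduction mod p on the integers and the projection of the reals onto the circle are both
  additive maps from a ring into a multiplicatively written group; this turns products of powers
  into ordinary sums for both at once.\<close>

lemma form_value_hom:
  fixes \<phi> :: "'b::comm_ring_1 \<Rightarrow> 'a"
  assumes G: "comm_group G" and carr: "\<And>x. \<phi> x \<in> carrier G"
    and add: "\<And>x y. \<phi> (x + y) = \<phi> x \<otimes>\<^bsub>G\<^esub> \<phi> y" and len: "length ys = length c"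
  shows "form_value G c (map \<phi> ys) = \<phi> (\<Sum>i<length c. of_int (c ! i) * ys ! i)"
proof -
  interpret comm_group G by (rule G)
  have zero: "\<phi> 0 = \<one>\<^bsub>G\<^esub>"
    using add[of 0 0] carr[of 0] by (metis add.right_neutral r_cancel_one')
  have nat_pow: "\<phi> x [^]\<^bsub>G\<^esub> n = \<phi> (of_nat n * x)" for x and n :: nat
  proof (induction n)
    case (Suc n)
    then show ?case using add[of "of_nat n * x" x] by (simp add: algebra_simps)
  qed (simp add: zero)
  have uminus: "\<phi> (- x) = inv\<^bsub>G\<^esub> (\<phi> x)" for x
    using inv_equality[of "\<phi> (- x)" "\<phi> x"] add[of "- x" x] carr zero by simp
  have int_pow: "\<phi> x [^]\<^bsub>G\<^esub> k = \<phi> (of_int k * x)" for x and k :: int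
  proof (cases k rule: int_cases2)
    case (nonneg n)
    then show ?thesis by (simp add: int_pow_int nat_pow)
  next
    case (nonpos n)
    have "\<phi> x [^]\<^bsub>G\<^esub> k = inv\<^bsub>G\<^esub> (\<phi> x [^]\<^bsub>G\<^esub> int n)"
      unfolding nonpos by (rule int_pow_neg[OF carr])
    also have "\<dots> = \<phi> (- (of_nat n * x))" by (simp only: int_pow_int nat_pow uminus)
    finally show ?thesis by (simp add: nonpos)
  qed
  have "finprod G (\<lambda>i. map \<phi> ys ! i [^]\<^bsub>G\<^esub> (c ! i)) I = \<phi> (\<Sum>i\<in>I. of_int (c ! i) * ys ! i)"
    if "finite I" "I \<subseteq> {..<length c}" for I
    using that
  proof (induction I rule: finite_induct)
    case empty
    then show ?case by (simp add: zero)
  next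
    case (insert i I)
    have "(\<lambda>i. map \<phi> ys ! i [^]\<^bsub>G\<^esub> (c ! i)) \<in> insert i I \<rightarrow> carrier G"
      using insert.prems carr len by (auto intro!: int_pow_closed)
    then have "finprod G (\<lambda>i. map \<phi> ys ! i [^]\<^bsub>G\<^esub> (c ! i)) (insert i I)
      = (map \<phi> ys ! i [^]\<^bsub>G\<^esub> (c ! i)) \<otimes>\<^bsub>G\<^esub> finprod G (\<lambda>i. map \<phi> ys ! i [^]\<^bsub>G\<^esub> (c ! i)) I"
      using insert.hyps by (intro finprod_insert) auto
    then show ?case using insert len by (simp add: int_pow add)
  qed
  from this[of "{..<length c}"] show ?thesis by (simp add: form_value_def)
qed

lemma form_free_hom:
  fixes \<phi> :: "'b::comm_ring_1 \<Rightarrow> 'a"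
  assumes G: "comm_group G" and carr: "\<And>x. \<phi> x \<in> carrier G"
    and add: "\<And>x y. \<phi> (x + y) = \<phi> x \<otimes>\<^bsub>G\<^esub> \<phi> y" and A: "A \<subseteq> range \<phi>"
  shows "form_free G c A \<longleftrightarrow> (\<forall>ys. length ys = length c \<and> (\<forall>y\<in>set ys. \<phi> y \<in> A)
    \<longrightarrow> \<phi> (\<Sum>i<length c. of_int (c ! i) * ys ! i) \<noteq> \<one>\<^bsub>G\<^esub>)"
proof
  assume L: "form_free G c A"
  show "\<forall>ys. length ys = length c \<and> (\<forall>y\<in>set ys. \<phi> y \<in> A)
    \<longrightarrow> \<phi> (\<Sum>i<length c. of_int (c ! i) * ys ! i) \<noteq> \<one>\<^bsub>G\<^esub>"
  proof (intro allI impI)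
    fix ys assume ys: "length ys = length c \<and> (\<forall>y\<in>set ys. \<phi> y \<in> A)"
    then have "length (map \<phi> ys) = length c" "set (map \<phi> ys) \<subseteq> A" by auto
    then have "form_value G c (map \<phi> ys) \<noteq> \<one>\<^bsub>G\<^esub>" using L unfolding form_free_def by blast
    then show "\<phi> (\<Sum>i<length c. of_int (c ! i) * ys ! i) \<noteq> \<one>\<^bsub>G\<^esub>"
      using form_value_hom[of G \<phi> ys c, OF G carr add] ys by metis
  qed
next
  assume R: "\<forall>ys. length ys = length c \<and> (\<forall>y\<in>set ys. \<phi> y \<in> A)
    \<longrightarrow> \<phi> (\<Sum>i<length c. of_int (c ! i) * ys ! i) \<noteq> \<one>\<^bsub>G\<^esub>"
  show "form_free G c A"
    unfolding form_free_def
  proof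
    assume "\<exists>x. length x = length c \<and> set x \<subseteq> A \<and> form_value G c x = \<one>\<^bsub>G\<^esub>"
    then obtain x where x: "length x = length c" "set x \<subseteq> A" "form_value G c x = \<one>\<^bsub>G\<^esub>" by blast
    have "\<exists>ys. x = map \<phi> ys" unfolding ex_map_conv using x(2) A by (auto simp: subset_iff image_iff)
    then obtain ys where ys: "x = map \<phi> ys" by blast
    then have "length ys = length c" "\<forall>y\<in>set ys. \<phi> y \<in> A" using x by auto
    then show False using R x(3) form_value_hom[of G \<phi> ys c, OF G carr add] ys by metis
  qed
qed

text \<open>The tuples range over all integers with residues in A, so that perturbed coordinates
  need no reduction.\<close>

lemma form_free_mod_iff:
  assumes p: "p > 0" and A: "A \<subseteq> {0..<int p}"
  shows "form_free (integer_mod_group p) c A \<longleftrightarrow>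
    (\<forall>ys. length ys = length c \<and> (\<forall>y\<in>set ys. y mod int p \<in> A)
      \<longrightarrow> \<not> int p dvd (\<Sum>i<length c. c ! i * ys ! i))"
proof -
  let ?\<phi> = "\<lambda>x. x mod int p"
  have carr: "?\<phi> x \<in> carrier (integer_mod_group p)" for x
    using p by (simp add: carrier_integer_mod_group)
  have add: "?\<phi> (x + y) = ?\<phi> x \<otimes>\<^bsub>integer_mod_group p\<^esub> ?\<phi> y" for x y
    by (simp add: mod_add_eq)
  have range: "A \<subseteq> range ?\<phi>"
  proof
    fix x assume "x \<in> A"
    then have "x = x mod int p" using A by auto
    then show "x \<in> range (\<lambda>x. x mod int p)" by blast
  qed
  show ?thesis
    unfolding form_free_hom[of "integer_mod_group p" ?\<phi> A c, OF abelian_integer_mod_group carr add range]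
    by (simp add: dvd_eq_mod_eq_0)
qed

section \<open>The circle as a quotient of the reals\<close>

definition circ :: "real \<Rightarrow> real set" where
  "circ x = {y. y - x \<in> \<int>}"

lemma circ_in_carrier: "circ x \<in> carrier circle_group"
  by (simp add: circ_def carrier_circle_group)

lemma circ_eq_iff: "circ x = circ y \<longleftrightarrow> x - y \<in> \<int>"
proof
  assume "circ x = circ y"
  moreover have "x \<in> circ x" by (simp add: circ_def)
  ultimately show "x - y \<in> \<int>" by (simp add: circ_def)
next
  assume "x - y \<in> \<int>" then show "circ x = circ y" unfolding circ_def by (rule coset_eqI)
qed

lemma circ_add: "circ (x + y) = circ x \<otimes>\<^bsub>circle_group\<^esub> circ y"
proof -
  have "\<int> \<lhd> real_group"
    using comm_group.normal_iff_subgroup[OF comm_group_real_group] Ints_subgroup_real by blast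
  from normal.r_coset_hom_Mod[OF this] show ?thesis
    by (auto simp: hom_def circle_group_def circ_def coset_eq)
qed

lemma one_circle_group: "\<one>\<^bsub>circle_group\<^esub> = circ 0"
  by (simp add: circle_group_def circ_def)

lemma form_free_circle_iff:
  assumes A: "A \<subseteq> carrier circle_group"
  shows "form_free circle_group c A \<longleftrightarrow>
    (\<forall>ys. length ys = length c \<and> (\<forall>y\<in>set ys. circ y \<in> A)
      \<longrightarrow> (\<Sum>i<length c. of_int (c ! i) * ys ! i) \<notin> \<int>)"
proof -
  have "A \<subseteq> range circ" using A by (auto simp: carrier_circle_group circ_def)
  from form_free_hom[OF comm_group_circle_group circ_in_carrier circ_add this, where c = c] show ?thesis
    by (simp add: one_circle_group circ_eq_iff)
qed

section \<open>Suprema of densities, and measures of arcs\<close>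

lemma max_density_bdd:
  assumes "\<forall>A\<in>sets M. measure M A \<le> 1"
  shows "bdd_above {measure M A |A. A \<subseteq> carrier G \<and> A \<in> sets M \<and> family_free G F A}"
  using assms by (intro bdd_aboveI[of _ 1]) auto

lemma max_density_upper:
  assumes "\<forall>A\<in>sets M. measure M A \<le> 1"
    and "A \<subseteq> carrier G" "A \<in> sets M" "family_free G F A"
  shows "measure M A \<le> max_density F G M"
  unfolding max_density_def
  by (rule cSup_upper[OF _ max_density_bdd[OF assms(1)]]) (use assms in blast)

lemma max_density_approx:
  assumes "\<forall>A\<in>sets M. measure M A \<le> 1" and ne: "[] \<notin> F" and e: "e > 0"
  obtains A where "A \<subseteq> carrier G" "A \<in> sets M" "family_free G F A" "measure M A > max_density F G M - e"
proof -
  let ?S = "{measure M A |A. A \<subseteq> carrier G \<and> A \<in> sets M \<and> family_free G F A}"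
  have "family_free G F {}" using ne by (auto simp: family_free_def form_free_def)
  then have "?S \<noteq> {}" by blast
  moreover have "Sup ?S - e < Sup ?S" using e by simp
  ultimately have "\<exists>x\<in>?S. Sup ?S - e < x"
    using less_cSup_iff[OF _ max_density_bdd[OF assms(1)]] by blast
  then show ?thesis using that unfolding max_density_def by blast
qed

lemma measure_circle_le_1: "\<forall>A\<in>sets circle_measure. measure circle_measure A \<le> 1"
  using emeasure_space[of circle_measure] prob_space_circle_measure
  by (simp add: measure_def enn2real_leI)

lemma measure_haar_mod_le_1:
  assumes "p > 0"
  shows "\<forall>A\<in>sets (haar_mod p). measure (haar_mod p) A \<le> 1"
proof
  fix A assume "A \<in> sets (haar_mod p)"
  then have A: "A \<subseteq> {0..<int p}"
    using assms by (auto simp: haar_mod_def sets_uniform_count_measure carrier_integer_mod_group)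
  then have "card A \<le> p" using card_mono[OF _ A] by simp
  then show "measure (haar_mod p) A \<le> 1"
    using assms A by (simp add: measure_haar_mod carrier_integer_mod_group)
qed

text \<open>The union of the cosets is the periodic extension of S, a countable union of translates,
  and is therefore Lebesgue measurable.\<close>

lemma circle_set_of_unit_interval:
  assumes S: "S \<subseteq> {0..<1}" "S \<in> sets lebesgue"
  shows "circ ` S \<in> sets circle_measure" "measure circle_measure (circ ` S) = measure lebesgue S"
    "circ y \<in> circ ` S \<longleftrightarrow> frac y \<in> S"
proof -
  show mem: "circ y \<in> circ ` S \<longleftrightarrow> frac y \<in> S" for y
  proof
    assume "circ y \<in> circ ` S"
    then obtain s where s: "s \<in> S" "y - s \<in> \<int>" by (auto simp: circ_eq_iff)
    then have "frac y = s" using S by (auto simp: frac_unique_iff)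
    then show "frac y \<in> S" using s by simp
  next
    assume "frac y \<in> S"
    moreover have "circ y = circ (frac y)" by (simp add: circ_eq_iff frac_def)
    ultimately show "circ y \<in> circ ` S" by simp
  qed
  have sub: "circ ` S \<subseteq> carrier circle_group" using circ_in_carrier by blast
  have U: "\<Union>(circ ` S) = {y. frac y \<in> S}"
    using coset_mem_iff[OF sub] mem by (auto simp: circ_def[symmetric])
  also have "\<dots> = (\<Union>k::int. (+) (of_int k) ` S)"
  proof (intro equalityI subsetI)
    fix y assume "y \<in> {y. frac y \<in> S}"
    then have "y = of_int \<lfloor>y\<rfloor> + frac y" "frac y \<in> S" by (simp_all add: frac_def)
    then show "y \<in> (\<Union>k::int. (+) (of_int k) ` S)" by blast
  next
    fix y assume "y \<in> (\<Union>k::int. (+) (of_int k) ` S)"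
    then obtain k :: int and s where "y = of_int k + s" "s \<in> S" by blast
    moreover have "frac (of_int k + s) = s" using S \<open>s \<in> S\<close> by (auto simp: frac_unique_iff)
    ultimately show "y \<in> {y. frac y \<in> S}" by simp
  qed
  finally have "\<Union>(circ ` S) \<in> sets lebesgue"
    using lebesgue_sets_translation[OF S(2)] by auto
  then show sets: "circ ` S \<in> sets circle_measure" using sub by (simp add: sets_circle_measure)
  have "{y. frac y \<in> S} \<inter> {0..<1} = S" using S(1) by (auto simp: frac_eq[THEN iffD2] subset_iff)
  then show "measure circle_measure (circ ` S) = measure lebesgue S"
    using emeasure_circle_measure[OF sets] unfolding U by (simp add: measure_def)
qed

text \<open>Written with the floor so that the passage from a real in [0, 1) to its residue is a
  function; \<open>cells_Union\<close> recovers the arcs.\<close>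

definition cells :: "nat \<Rightarrow> int set \<Rightarrow> real set" where
  "cells p B = {x. 0 \<le> x \<and> x < 1 \<and> \<lfloor>real p * x\<rfloor> \<in> B}"

lemma cells_Union:
  assumes "p > 0" "B \<subseteq> {0..<int p}"
  shows "cells p B = (\<Union>b\<in>B. {of_int b / real p ..< (of_int b + 1) / real p})"
proof -
  have eq: "\<lfloor>real p * x\<rfloor> = b \<longleftrightarrow> x \<in> {of_int b / real p ..< (of_int b + 1) / real p}" for x b
    using assms(1) by (auto simp: floor_eq_iff field_simps)
  have "0 \<le> x \<and> x < 1" if "\<lfloor>real p * x\<rfloor> \<in> B" for x
  proof -
    have "0 \<le> \<lfloor>real p * x\<rfloor>" "\<lfloor>real p * x\<rfloor> < int p" using that assms(2) by auto
    then have "0 \<le> real p * x" "real p * x < real p" by (auto simp: floor_less_iff)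
    then show ?thesis using assms(1) by (auto simp: zero_le_mult_iff)
  qed
  then have "cells p B = {x. \<lfloor>real p * x\<rfloor> \<in> B}" by (auto simp: cells_def)
  then show ?thesis by (simp only: set_eq_iff mem_Collect_eq UN_iff eq[symmetric]) blast
qed

lemma cells_measure:
  assumes p: "p > 0" and B: "B \<subseteq> {0..<int p}"
  shows "cells p B \<in> lmeasurable" "measure lebesgue (cells p B) = card B / p"
proof -
  have fin: "finite B" using B finite_subset by blast
  let ?I = "\<lambda>b::int. {of_int b / real p ..< (of_int b + 1) / real p}"
  have lm: "?I b \<in> lmeasurable" for b
  proof (rule bounded_set_imp_lmeasurable)
    show "bounded (?I b)"
      by (rule bounded_subset[of "{of_int b / real p .. (of_int b + 1) / real p}"]) auto
  qed simp
  show "cells p B \<in> lmeasurable"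
    unfolding cells_Union[OF p B] by (rule fmeasurable.finite_UN[OF fin lm])
  have disj: "disjoint_family_on ?I B"
  proof -
    have "b = b'" if "x \<in> ?I b" "x \<in> ?I b'" for x b b'
    proof -
      have "\<lfloor>real p * x\<rfloor> = b" "\<lfloor>real p * x\<rfloor> = b'"
        using that p by (auto simp: floor_eq_iff field_simps)
      then show ?thesis by simp
    qed
    then show ?thesis unfolding disjoint_family_on_def disjoint_iff by blast
  qed
  have "measure lebesgue (\<Union>b\<in>B. ?I b) = (\<Sum>b\<in>B. measure lebesgue (?I b))"
    by (rule measure_finite_Union[OF fin _ disj]) (use fmeasurableD[OF lm] fmeasurableD2[OF lm] in auto)
  also have "\<dots> = (\<Sum>b\<in>B. 1 / real p)"
  proof (rule sum.cong)
    fix b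
    have "(of_int b + 1) / real p - of_int b / real p = 1 / real p" by (simp add: diff_divide_distrib[symmetric])
    moreover have "of_int b / real p \<le> (of_int b + 1) / real p" by (simp add: divide_right_mono)
    ultimately show "measure lebesgue (?I b) = 1 / real p" by simp
  qed simp
  finally show "measure lebesgue (cells p B) = card B / p"
    unfolding cells_Union[OF p B] by simp
qed

section \<open>The lower bound\<close>

text \<open>The coordinates vary independently, so the values form an iterated sum of dilates of K,
  and sums of compact sets are compact.\<close>

lemma compact_form_values:
  fixes K :: "real set"
  assumes K: "compact K"
  shows "compact {\<Sum>i<length c. of_int (c ! i) * ys ! i |ys. length ys = length c \<and> set ys \<subseteq> K}"
proof (induction c)
  case Nil
  have "{\<Sum>i<length []. of_int ([] ! i) * ys ! i |ys :: real list. length ys = length [] \<and> set ys \<subseteq> K} = {0}"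
    by auto
  then show ?case by simp
next
  case (Cons k c)
  let ?V = "\<lambda>c. {\<Sum>i<length c. of_int (c ! i) * ys ! i |ys. length ys = length c \<and> set ys \<subseteq> K}"
  have "?V (k # c) = {x + y |x y. x \<in> (\<lambda>x. of_int k * x) ` K \<and> y \<in> ?V c}"
  proof (intro equalityI subsetI)
    fix v assume "v \<in> ?V (k # c)"
    then obtain ys where ys: "length ys = Suc (length c)" "set ys \<subseteq> K"
      "v = (\<Sum>i<Suc (length c). of_int ((k # c) ! i) * ys ! i)" by auto
    then obtain z zs where "ys = z # zs" by (cases ys) auto
    with ys have "z \<in> K" "length zs = length c" "set zs \<subseteq> K"
      "v = of_int k * z + (\<Sum>i<length c. of_int (c ! i) * zs ! i)"
      by (auto simp: sum.lessThan_Suc_shift simp del: sum.lessThan_Suc)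
    then show "v \<in> {x + y |x y. x \<in> (\<lambda>x. of_int k * x) ` K \<and> y \<in> ?V c}"
      by (intro CollectI exI[of _ "of_int k * z"] exI[of _ "\<Sum>i<length c. of_int (c ! i) * zs ! i"] conjI
          imageI exI[of _ zs]) auto
  next
    fix v assume "v \<in> {x + y |x y. x \<in> (\<lambda>x. of_int k * x) ` K \<and> y \<in> ?V c}"
    then obtain z zs where z: "z \<in> K" "length zs = length c" "set zs \<subseteq> K"
      "v = of_int k * z + (\<Sum>i<length c. of_int (c ! i) * zs ! i)" by blast
    then show "v \<in> ?V (k # c)"
      by (intro CollectI exI[of _ "z # zs"]) (simp add: sum.lessThan_Suc_shift del: sum.lessThan_Suc)
  qed
  moreover have "compact ((\<lambda>x. of_int k * x) ` K)"
    by (intro compact_continuous_image continuous_intros K)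
  ultimately show ?case using compact_sums[OF _ Cons.IH] by simp
qed

lemma form_gap:
  fixes K :: "real set"
  assumes K: "compact K"
    and free: "\<And>ys. length ys = length c \<Longrightarrow> set ys \<subseteq> K \<Longrightarrow> (\<Sum>i<length c. of_int (c ! i) * ys ! i) \<notin> \<int>"
  obtains \<delta> where "\<delta> > 0" "\<And>ys n. length ys = length c \<Longrightarrow> set ys \<subseteq> K \<Longrightarrow>
    \<delta> \<le> \<bar>(\<Sum>i<length c. of_int (c ! i) * ys ! i) - of_int n\<bar>"
proof -
  let ?V = "{\<Sum>i<length c. of_int (c ! i) * ys ! i |ys. length ys = length c \<and> set ys \<subseteq> K}"
  have "?V \<inter> \<int> = {}" using free by auto
  from separate_compact_closed[OF compact_form_values[OF K] closed_Ints this]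
  obtain \<delta> where \<delta>: "\<delta> > 0" "\<And>x n. x \<in> ?V \<Longrightarrow> \<delta> \<le> dist x (of_int n)"
    by (auto simp: Ints_def)
  show ?thesis
  proof (rule that[OF \<delta>(1)])
    fix ys and n :: int
    assume "length ys = length c" "set ys \<subseteq> K"
    then have "(\<Sum>i<length c. of_int (c ! i) * ys ! i) \<in> ?V" by blast
    then have "\<delta> \<le> dist (\<Sum>i<length c. of_int (c ! i) * ys ! i) (of_int n)"
      using \<delta>(2) by blast
    then show "\<delta> \<le> \<bar>(\<Sum>i<length c. of_int (c ! i) * ys ! i) - of_int n\<bar>"
      by (simp only: dist_real_def)
  qed
qed

text \<open>The bound does not grow with p. The lower bound compares it with a gap of order p; the
  upper bound uses it to confine an integer error to a fixed range.\<close>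

lemma form_perturb:
  fixes xs :: "real list"
  assumes "length xs = length c" "length bs = length c" "p > 0"
    and close: "\<And>i. i < length c \<Longrightarrow> bs ! i = \<lfloor>real p * xs ! i\<rfloor>"
  shows "\<bar>real p * (\<Sum>i<length c. of_int (c ! i) * xs ! i) - of_int (\<Sum>i<length c. c ! i * bs ! i)\<bar>
    \<le> (\<Sum>i<length c. \<bar>of_int (c ! i)\<bar>)"
proof -
  have "real p * (\<Sum>i<length c. of_int (c ! i) * xs ! i) - of_int (\<Sum>i<length c. c ! i * bs ! i)
      = (\<Sum>i<length c. of_int (c ! i) * (real p * xs ! i - of_int (bs ! i)))"
    by (simp add: sum_distrib_left sum_subtractf right_diff_distrib mult_ac)
  also have "\<bar>\<dots>\<bar> \<le> (\<Sum>i<length c. \<bar>of_int (c ! i) * (real p * xs ! i - of_int (bs ! i))\<bar>)"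
    by (rule sum_abs)
  also have "\<dots> \<le> (\<Sum>i<length c. \<bar>of_int (c ! i)\<bar>)"
  proof (rule sum_mono)
    fix i assume "i \<in> {..<length c}"
    then have "\<bar>real p * xs ! i - of_int (bs ! i)\<bar> \<le> 1"
      using close[of i] floor_correct[of "real p * xs ! i"] by (simp only: abs_le_iff lessThan_iff) linarith
    then show "\<bar>of_int (c ! i) * (real p * xs ! i - of_int (bs ! i))\<bar> \<le> \<bar>of_int (c ! i)\<bar>"
      unfolding abs_mult by (intro mult_left_le) auto
  qed
  finally show ?thesis .
qed

lemma density_mod_lower:
  assumes F: "finite F" "[] \<notin> F" and e: "e > 0"
  shows "eventually (\<lambda>p. density_mod F p \<ge> density_circle F - e) at_top"
proof -
  obtain A where A: "A \<subseteq> carrier circle_group" "A \<in> sets circle_measure" "family_free circle_group F A"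
      "measure circle_measure A > density_circle F - e / 2"
    by (rule max_density_approx[OF measure_circle_le_1 F(2) half_gt_zero[OF e]])
  define U where "U = \<Union>A \<inter> {0..<1}"
  have Um: "U \<in> sets lebesgue" using A(2) unfolding U_def by (intro sets.Int) (auto simp: sets_circle_measure)
  have UA: "measure lebesgue U = measure circle_measure A"
    unfolding measure_def U_def emeasure_circle_measure[OF A(2)] ..
  obtain K where K: "closed K" "K \<subseteq> U" "U - K \<in> lmeasurable" "emeasure lebesgue (U - K) < ennreal (e / 2)"
    by (rule sets_lebesgue_inner_closed[OF Um half_gt_zero[OF e]])
  have "K \<subseteq> {0..1}" using K(2) by (auto simp: U_def)
  then have "bounded K" by (rule bounded_subset[OF bounded_closed_interval])
  then have cK: "compact K" using K(1) by (simp add: compact_eq_bounded_closed)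
  have Kl: "K \<in> lmeasurable" using cK by (rule lmeasurable_compact)
  have "measure lebesgue U = measure lebesgue K + measure lebesgue (U - K)"
  proof -
    have "K \<union> (U - K) = U" "U - K - K = U - K" using K(2) by auto
    then show ?thesis using measure_Un2[OF Kl K(3)] by simp
  qed
  moreover have "measure lebesgue (U - K) < e / 2"
    using K(3,4) e by (simp add: emeasure_eq_measure2 ennreal_less_iff)
  ultimately have big: "measure lebesgue K > density_circle F - e" using A(4) UA by simp
  have ev: "eventually (\<lambda>p. form_free (integer_mod_group p) c ((\<lambda>x. \<lfloor>real p * x\<rfloor>) ` K)) at_top"
    if c: "c \<in> F" for c
  proof -
    have "form_free circle_group c A" using A(3) c by (simp add: family_free_def)
    then have "(\<Sum>i<length c. of_int (c ! i) * ys ! i) \<notin> \<int>"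
      if "length ys = length c" "set ys \<subseteq> K" for ys
      using that K(2) coset_mem_iff[OF A(1)] unfolding form_free_circle_iff[OF A(1)]
      by (auto simp: U_def circ_def subset_iff)
    then obtain \<delta> where \<delta>: "\<delta> > 0" "\<And>ys n. length ys = length c \<Longrightarrow> set ys \<subseteq> K \<Longrightarrow>
        \<delta> \<le> \<bar>(\<Sum>i<length c. of_int (c ! i) * ys ! i) - of_int n\<bar>"
      using form_gap[OF cK, of c] by blast
    define W :: real where "W = (\<Sum>i<length c. \<bar>of_int (c ! i)\<bar>)"
    \<comment> \<open>Rounding moves p times the value of the form by at most W, while the gap at
      values on K amounts to p \<delta>.\<close>
    have "eventually (\<lambda>p. real p > W / \<delta>) at_top"
      using filterlim_real_sequentially by (simp add: filterlim_at_top_dense)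
    then show ?thesis using eventually_gt_at_top[of 0]
    proof eventually_elim
      case (elim p)
      have sub: "(\<lambda>x. \<lfloor>real p * x\<rfloor>) ` K \<subseteq> {0..<int p}"
        using K(2) elim(2) by (auto simp: U_def floor_less_iff)
      show ?case
        unfolding form_free_mod_iff[OF elim(2) sub]
      proof (intro allI impI notI)
        fix ys assume ys: "length ys = length c \<and> (\<forall>y\<in>set ys. y mod int p \<in> (\<lambda>x. \<lfloor>real p * x\<rfloor>) ` K)"
          and dvd: "int p dvd (\<Sum>i<length c. c ! i * ys ! i)"
        have "\<exists>g. \<forall>y\<in>set ys. g y \<in> K \<and> y mod int p = \<lfloor>real p * g y\<rfloor>"
          using ys by (intro bchoice) auto
        then obtain g where g: "\<And>y. y \<in> set ys \<Longrightarrow> g y \<in> K \<and> y mod int p = \<lfloor>real p * g y\<rfloor>" by blast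
        have "(\<Sum>i<length c. c ! i * (ys ! i mod int p)) mod int p = (\<Sum>i<length c. c ! i * ys ! i) mod int p"
          by (subst (1 2) mod_sum_eq[symmetric]) (simp add: mod_mult_right_eq)
        then have "int p dvd (\<Sum>i<length c. c ! i * map (\<lambda>y. y mod int p) ys ! i)"
          using dvd ys by (simp add: dvd_eq_mod_eq_0)
        then obtain n where n: "(\<Sum>i<length c. c ! i * map (\<lambda>y. y mod int p) ys ! i) = int p * n"
          by (auto simp: dvd_def)
        have "\<bar>real p * (\<Sum>i<length c. of_int (c ! i) * map g ys ! i)
            - of_int (\<Sum>i<length c. c ! i * map (\<lambda>y. y mod int p) ys ! i)\<bar> \<le> W"
          unfolding W_def by (rule form_perturb) (use ys g elim(2) in auto)
        then have "\<bar>real p * ((\<Sum>i<length c. of_int (c ! i) * map g ys ! i) - of_int n)\<bar> \<le> W"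
          unfolding n by (simp add: right_diff_distrib)
        then have "real p * \<bar>(\<Sum>i<length c. of_int (c ! i) * map g ys ! i) - of_int n\<bar> \<le> W"
          by (simp add: abs_mult)
        moreover have "\<delta> \<le> \<bar>(\<Sum>i<length c. of_int (c ! i) * map g ys ! i) - of_int n\<bar>"
          by (rule \<delta>(2)) (use ys g in auto)
        ultimately have "real p * \<delta> \<le> W"
          by (meson mult_left_mono of_nat_0_le_iff order_trans)
        then show False using elim(1) \<delta>(1) by (simp add: pos_divide_less_eq)
      qed
    qed
  qed
  have "eventually (\<lambda>p. \<forall>c\<in>F. form_free (integer_mod_group p) c ((\<lambda>x. \<lfloor>real p * x\<rfloor>) ` K)) at_top"
    by (rule eventually_ball_finite[OF F(1)]) (use ev in blast)
  then show ?thesis using eventually_gt_at_top[of 0]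
  proof eventually_elim
    case (elim p)
    let ?A = "(\<lambda>x. \<lfloor>real p * x\<rfloor>) ` K"
    have sub: "?A \<subseteq> {0..<int p}"
      using K(2) elim(2) by (auto simp: U_def floor_less_iff)
    \<comment> \<open>K is covered by the cells it meets, each of measure 1/p, so rounding loses no
      density.\<close>
    have "measure lebesgue K \<le> measure lebesgue (cells p ?A)"
      by (rule measure_mono_fmeasurable)
         (use K(2) Kl cells_measure[OF elim(2) sub] in \<open>auto simp: U_def cells_def\<close>)
    also have "\<dots> = card ?A / p" by (rule cells_measure[OF elim(2) sub])
    also have "\<dots> = measure (haar_mod p) ?A"
      using elim(2) sub by (simp add: measure_haar_mod carrier_integer_mod_group)
    also have "\<dots> \<le> density_mod F p"
      by (rule max_density_upper[OF measure_haar_mod_le_1[OF elim(2)]])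
         (use sub elim in \<open>auto simp: carrier_integer_mod_group haar_mod_def
            sets_uniform_count_measure family_free_def\<close>)
    finally show ?case using big by simp
  qed
qed

section \<open>The upper bound\<close>

lemma (in cyclic) dilate_preimage_card:
  assumes "coprime \<mu> (int p)" "B \<subseteq> {0..<int p}"
  shows "card {b\<in>{0..<int p}. (\<mu> * b) mod int p \<in> B} = card B"
proof -
  have per: "periodic (\<lambda>x. of_bool (x mod int p \<in> B) :: real)" by (simp add: periodic_def)
  have "avg (\<lambda>x. of_bool (x mod int p \<in> {b\<in>{0..<int p}. (\<mu> * b) mod int p \<in> B}) :: real)
      = avg (\<lambda>x. of_bool ((\<mu> * x + 0) mod int p \<in> B))"
    using p_pos by (simp add: mod_mult_right_eq)
  also have "\<dots> = avg (\<lambda>x. of_bool (x mod int p \<in> B))"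
    by (rule avg_affine[OF per assms(1)])
  finally have "real (card ({b\<in>{0..<int p}. (\<mu> * b) mod int p \<in> B} \<inter> {0..<int p})) = card (B \<inter> {0..<int p})"
    using p_pos unfolding avg_indicator by simp
  moreover have "{b\<in>{0..<int p}. (\<mu> * b) mod int p \<in> B} \<inter> {0..<int p} = {b\<in>{0..<int p}. (\<mu> * b) mod int p \<in> B}"
    by blast
  ultimately show ?thesis using assms(2) by (simp add: Int_absorb2)
qed

text \<open>A solution with coordinates in \<open>B\<close>, up to an error \<open>C u\<close> with \<open>u\<close> in a small Bohr set, is moved
  to an exact solution in \<open>A\<close> by perturbing its first three coordinates by multiples of the
  \<open>C / c\<^sub>i\<close>.\<close>

lemma (in cyclic) no_approximate_solution:
  assumes free: "form_free (integer_mod_group p) c A" and A: "A \<subseteq> {0..<int p}" and BA: "B \<subseteq> A"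
    and len: "length c \<ge> 3"
    and dvd: "\<And>i. i < length c \<Longrightarrow> c ! i dvd C"
    and solv: "\<And>x1 x2 x3. x1 \<in> B \<Longrightarrow> x2 \<in> B \<Longrightarrow> x3 \<in> B
      \<Longrightarrow> solvable A u (C div c ! 0) (C div c ! 1) (C div c ! 2) x1 x2 x3"
    and xs: "length xs = length c" "set xs \<subseteq> B"
  shows "\<not> int p dvd (\<Sum>i<length c. c ! i * xs ! i) - C * u"
proof
  assume pd: "int p dvd (\<Sum>i<length c. c ! i * xs ! i) - C * u"
  have memB: "xs ! i \<in> B" if "i < length c" for i using xs that by (metis nth_mem subsetD)
  have xB: "xs ! 0 \<in> B" "xs ! 1 \<in> B" "xs ! 2 \<in> B" using len by (auto intro!: memB)
  obtain y z where yz: "(xs ! 0 + (C div c ! 0) * (- u - y - z)) mod int p \<in> A"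
      "(xs ! 1 + (C div c ! 1) * y) mod int p \<in> A" "(xs ! 2 + (C div c ! 2) * z) mod int p \<in> A"
    using solv[OF xB] unfolding solvable_def by (elim exE conjE)
  define e where "e i = (if i = 0 then (C div c ! 0) * (- u - y - z) else if i = 1 then (C div c ! 1) * y
     else if i = 2 then (C div c ! 2) * z else 0)" for i :: nat
  define ws where "ws = map (\<lambda>i. xs ! i + e i) [0..<length c]"
  have wsl: "length ws = length c" by (simp add: ws_def)
  have wsi: "ws ! i = xs ! i + e i" if "i < length c" for i using that by (simp add: ws_def)
  have wA: "\<forall>w\<in>set ws. w mod int p \<in> A"
  proof
    fix w assume "w \<in> set ws"
    then obtain i where i: "i < length c" "w = xs ! i + e i" by (auto simp: ws_def)
    have "xs ! i \<in> A" using memB[OF i(1)] BA by blast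
    then have "xs ! i mod int p \<in> A" using A by force
    then show "w mod int p \<in> A" using yz i by (auto simp: e_def)
  qed
  have "(\<Sum>i<length c. c ! i * e i) = (\<Sum>i\<in>{0,1,2}. c ! i * e i)"
    by (rule sum.mono_neutral_right) (use len in \<open>auto simp: e_def\<close>)
  also have "\<dots> = c ! 0 * (C div c ! 0) * (- u - y - z) + c ! 1 * (C div c ! 1) * y + c ! 2 * (C div c ! 2) * z"
    by (simp add: e_def)
  also have "\<dots> = C * (- u - y - z) + C * y + C * z"
  proof -
    have "0 < length c" "1 < length c" "2 < length c" using len by linarith+
    then show ?thesis by (simp only: dvd_mult_div_cancel[OF dvd])
  qed
  also have "\<dots> = - (C * u)" by (simp add: algebra_simps)
  finally have "(\<Sum>i<length c. c ! i * ws ! i) = (\<Sum>i<length c. c ! i * xs ! i) - C * u"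
    by (simp add: wsi distrib_left sum.distrib)
  then show False using free wA wsl pd unfolding form_free_mod_iff[OF p_pos A] by metis
qed

lemma density_mod_upper:
  assumes F: "finite F" "\<And>c. c \<in> F \<Longrightarrow> nonzero_coeffs c \<and> length c \<ge> 3" and e: "e > 0"
  shows "eventually (\<lambda>p. prime p \<longrightarrow> density_mod F p \<le> density_circle F + e) at_top"
proof -
  \<comment> \<open>A common multiple of all coefficients in the family, so that one finite set of
    multipliers, and hence one pair K and \<kappa>, serves every form.\<close>
  define C where "C = (\<Prod>c\<in>F. prod_list c)"
  have C0: "C \<noteq> 0"
    using F by (auto simp: C_def nonzero_coeffs_def prod_list_zero_iff)
  have dvdC: "x dvd C" if "c \<in> F" "x \<in> set c" for c x
    using dvd_trans[OF prod_list_dvd dvd_prodI[OF F(1)]] that by (simp add: C_def) 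
  define M where "M = (\<lambda>x. C div x) ` (\<Union>c\<in>F. set c)"
  have M: "finite M" using F by (simp add: M_def)
  have mC: "m \<noteq> 0 \<and> m dvd C" if "m \<in> M" for m
  proof -
    obtain x where "x dvd C" "m = C div x" using \<open>m \<in> M\<close> dvdC by (auto simp: M_def)
    then have "C = x * m" by simp
    then show ?thesis using C0 by auto
  qed
  obtain K \<kappa> where \<kappa>: "\<kappa> > 0" and robust: "\<And>p A. p > 0 \<and> (\<forall>m\<in>M. coprime m (int p)) \<and> A \<subseteq> {0..<int p} \<Longrightarrow>
    (\<exists>R B. finite R \<and> card R \<le> K \<and> B \<subseteq> A \<and> real (card B) \<ge> card A - e / 2 * p \<and>
    (\<forall>x1\<in>B. \<forall>x2\<in>B. \<forall>x3\<in>B. \<forall>m1\<in>M. \<forall>m2\<in>M. \<forall>m3\<in>M. \<forall>u.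
      cyclic.dev p R u \<le> \<kappa> \<longrightarrow> cyclic.solvable p A u m1 m2 m3 x1 x2 x3))"
    using robust_subset_uniform[OF M, of "e / 2"] e by auto
  \<comment> \<open>The summand 1 keeps W positive, for the division in \<delta>, when the family is
    empty.\<close>
  define W :: real where "W = 1 + (\<Sum>c\<in>F. \<Sum>i<length c. \<bar>of_int (c ! i)\<bar>)"
  have W: "(\<Sum>i<length c. \<bar>real_of_int (c ! i)\<bar>) \<le> W" if "c \<in> F" for c
  proof -
    have "(\<Sum>i<length c. \<bar>real_of_int (c ! i)\<bar>) \<le> (\<Sum>c\<in>F. \<Sum>i<length c. \<bar>of_int (c ! i)\<bar>)"
      using that F(1) by (intro member_le_sum) (auto intro: sum_nonneg)
    then show ?thesis by (simp add: W_def)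
  qed
  have W1: "W \<ge> 1" by (simp add: W_def sum_nonneg)
  \<comment> \<open>If \<open>dev R l\<close> is at most \<delta>, every multiple s l with |s| \<le>
    W still has deviation at most \<kappa>.\<close>
  define \<delta> where "\<delta> = \<kappa> / W"
  have \<delta>: "\<delta> > 0" using \<kappa> W1 by (simp add: \<delta>_def)
  have ne: "[] \<notin> F" using F(2) by force
  show ?thesis
    \<comment> \<open>For a prime p the first threshold makes C and all its divisors units mod p;
      the second is that of \<open>exists_small_dev\<close>.\<close>
    using eventually_gt_at_top[of "nat \<bar>C\<bar>"] eventually_gt_at_top[of "2 * scale_bound K (min 1 (\<delta> / 4))"]
  proof eventually_elim
    case (elim p)
    show ?case
    proof
      assume pr: "prime p"
      interpret cyclic p by unfold_locales (use pr prime_gt_0_nat in blast)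
      have prZ: "prime (int p)" using pr by simp
      have cop: "coprime m (int p)" if "m \<noteq> 0" "\<bar>m\<bar> < int p" for m
      proof -
        have "\<not> int p dvd m" using zdvd_not_zless[of "\<bar>m\<bar>" "int p"] that by auto
        then show ?thesis using prime_imp_coprime[OF prZ, of m] by (simp add: coprime_commute)
      qed
      have Cp: "\<bar>C\<bar> < int p" using elim(1) by linarith
      have copM: "\<forall>m\<in>M. coprime m (int p)"
      proof
        fix m assume "m \<in> M"
        then have "m \<noteq> 0" "m dvd C" using mC by blast+
        then have "\<bar>m\<bar> \<le> \<bar>C\<bar>" using dvd_imp_le_int[OF C0] by blast
        then show "coprime m (int p)" using cop[OF \<open>m \<noteq> 0\<close>] Cp by linarith
      qed
      obtain A where A: "A \<subseteq> carrier (integer_mod_group p)" "A \<in> sets (haar_mod p)"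
          "family_free (integer_mod_group p) F A" "measure (haar_mod p) A > density_mod F p - e / 2"
        by (rule max_density_approx[OF measure_haar_mod_le_1[OF p_pos] ne half_gt_zero[OF e]])
      have A': "A \<subseteq> {0..<int p}" using A(1) p_pos by (simp add: carrier_integer_mod_group)
      obtain R B where RB: "finite R" "card R \<le> K" "B \<subseteq> A" "real (card B) \<ge> card A - e / 2 * p"
        and solv: "\<And>x1 x2 x3 m1 m2 m3 u. x1 \<in> B \<Longrightarrow> x2 \<in> B \<Longrightarrow> x3 \<in> B \<Longrightarrow> m1 \<in> M \<Longrightarrow> m2 \<in> M \<Longrightarrow> m3 \<in> M
          \<Longrightarrow> dev R u \<le> \<kappa> \<Longrightarrow> solvable A u m1 m2 m3 x1 x2 x3"
        using robust[of p A] p_pos copM A' by auto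
      obtain l where l: "0 < l" "l < int p" "dev R l \<le> \<delta>"
        using exists_small_dev[OF RB(1,2) \<delta> elim(2)] by auto
      \<comment> \<open>The factor l sends the integers of absolute value at most W into the Bohr
        set; the factor C gives the error the shape C u that \<open>no_approximate_solution\<close>
        requires.\<close>
      define \<mu> where "\<mu> = C * l"
      have cop\<mu>: "coprime \<mu> (int p)"
        unfolding \<mu>_def using cop[OF C0 Cp] cop[of l] l by simp
      define B' where "B' = {b\<in>{0..<int p}. (\<mu> * b) mod int p \<in> B}"
      have B': "B' \<subseteq> {0..<int p}" by (auto simp: B'_def)
      have cB': "card B' = card B"
        unfolding B'_def by (rule dilate_preimage_card[OF cop\<mu>]) (use RB A' in auto)
      define S where "S = cells p B'"
      have S: "S \<subseteq> {0..<1}" "S \<in> sets lebesgue" "measure lebesgue S = card B / p"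
        using cells_measure[OF p_pos B'] cB' by (auto simp: S_def cells_def)
      have "form_free circle_group c (circ ` S)" if c: "c \<in> F" for c
      proof -
        have sub: "circ ` S \<subseteq> carrier circle_group" using circ_in_carrier by blast
        show ?thesis
          unfolding form_free_circle_iff[OF sub]
        proof (intro allI impI notI)
          fix ys assume ys: "length ys = length c \<and> (\<forall>y\<in>set ys. circ y \<in> circ ` S)"
            and int: "(\<Sum>i<length c. of_int (c ! i) * ys ! i) \<in> \<int>"
          define xs where "xs = map frac ys"
          define bs where "bs = map (\<lambda>x. \<lfloor>real p * x\<rfloor>) xs"
          have len: "length xs = length c" "length bs = length c" using ys by (simp_all add: xs_def bs_def)
          have bB: "b \<in> B'" if "b \<in> set bs" for b
            using that ys circle_set_of_unit_interval(3)[OF S(1,2)]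
            by (auto simp: bs_def xs_def S_def cells_def)
          have "(\<Sum>i<length c. of_int (c ! i) * xs ! i)
              = (\<Sum>i<length c. of_int (c ! i) * ys ! i) - of_int (\<Sum>i<length c. c ! i * \<lfloor>ys ! i\<rfloor>)"
            using ys by (simp add: xs_def frac_def right_diff_distrib sum_subtractf)
          then have "(\<Sum>i<length c. of_int (c ! i) * xs ! i) \<in> \<int>"
            using int Ints_diff Ints_of_int by metis
          then obtain n where n: "(\<Sum>i<length c. of_int (c ! i) * xs ! i) = of_int n"
            by (auto simp: Ints_def)
          \<comment> \<open>A solution on the circle, rounded to residues, solves the congruence up
            to the integer s of absolute value at most W. Multiplication by \<mu> turns this error
            into C (s l).\<close>
          define s where "s = (\<Sum>i<length c. c ! i * bs ! i) - int p * n"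
          have "\<bar>real p * (\<Sum>i<length c. of_int (c ! i) * xs ! i) - of_int (\<Sum>i<length c. c ! i * bs ! i)\<bar> \<le> W"
            by (rule order_trans[OF form_perturb[OF len p_pos] W[OF c]]) (use len in \<open>simp add: bs_def\<close>)
          then have sW: "real_of_int \<bar>s\<bar> \<le> W" unfolding n s_def by simp
          define u where "u = s * l"
          have "dev R u \<le> real_of_int \<bar>s\<bar> * dev R l" unfolding u_def by (rule dev_mult)
          also have "\<dots> \<le> W * \<delta>" using sW l(3) W1 by (intro mult_mono) auto
          also have "\<dots> = \<kappa>" using W1 by (simp add: \<delta>_def)
          finally have u: "dev R u \<le> \<kappa>" .
          define zs where "zs = map (\<lambda>b. (\<mu> * b) mod int p) bs"
          have "\<not> int p dvd (\<Sum>i<length c. c ! i * zs ! i) - C * u"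
          proof (rule no_approximate_solution[OF _ A' RB(3)])
            show "form_free (integer_mod_group p) c A" using A(3) c by (simp add: family_free_def)
            show len3: "length c \<ge> 3" using F(2)[OF c] by simp
            show "c ! i dvd C" if "i < length c" for i using dvdC[OF c] that by simp
            have mem: "C div c ! i \<in> M" if "i < length c" for i
              unfolding M_def by (rule imageI, rule UN_I, rule c, rule nth_mem, rule that)
            show "solvable A u (C div c ! 0) (C div c ! 1) (C div c ! 2) x1 x2 x3"
              if "x1 \<in> B" "x2 \<in> B" "x3 \<in> B" for x1 x2 x3
              by (rule solv[OF that mem mem mem u]) (use len3 in auto)
            show "length zs = length c" using len by (simp add: zs_def)
            show "set zs \<subseteq> B" using bB by (auto simp: zs_def B'_def)
          qed
          moreover have "int p dvd (\<Sum>i<length c. c ! i * zs ! i) - C * u"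
          proof -
            have "(\<Sum>i<length c. c ! i * zs ! i) mod int p = (\<Sum>i<length c. c ! i * (\<mu> * bs ! i)) mod int p"
              by (subst (1 2) mod_sum_eq[symmetric]) (simp add: zs_def len mod_mult_right_eq)
            also have "(\<Sum>i<length c. c ! i * (\<mu> * bs ! i)) = \<mu> * (\<Sum>i<length c. c ! i * bs ! i)"
              by (simp add: sum_distrib_left mult_ac)
            also have "\<dots> = C * u + int p * (\<mu> * n)"
              by (simp add: s_def u_def \<mu>_def algebra_simps)
            finally have "(\<Sum>i<length c. c ! i * zs ! i) mod int p = (C * u) mod int p" by simp
            then show ?thesis by (simp only: mod_eq_dvd_iff)
          qed
          ultimately show False by blast
        qed
      qed
      then have ff: "family_free circle_group F (circ ` S)" by (simp add: family_free_def)
      have "measure circle_measure (circ ` S) \<le> density_circle F"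
        by (rule max_density_upper[OF measure_circle_le_1 _ _ ff])
           (use circle_set_of_unit_interval(1)[OF S(1,2)] circ_in_carrier in auto)
      then have "card B / p \<le> density_circle F"
        using circle_set_of_unit_interval(2)[OF S(1,2)] S(3) by simp
      moreover have "measure (haar_mod p) A = card A / p"
        by (rule measure_haar_mod[OF p_pos A(1)])
      moreover have "card A / p \<le> card B / p + e / 2"
        using RB(4) p_pos by (simp add: field_simps)
      ultimately show "density_mod F p \<le> density_circle F + e" using A(4) by linarith
    qed
  qed
qed

theorem theorem1p3:
  fixes F :: "linear_form set"
  assumes "finite F"
    and "\<And>c. c \<in> F \<Longrightarrow> nonzero_coeffs c \<and> length c \<ge> 3"
  shows "((\<lambda>p. density_mod F p) \<longlongrightarrow> density_circle F)
           (inf at_top (principal {p. prime p}))"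
proof (rule tendstoI)
  fix e :: real assume e: "e > 0"
  have "[] \<notin> F" using assms(2) by force
  from density_mod_lower[OF assms(1) this, of "e / 2"] e
  have "eventually (\<lambda>p. density_mod F p \<ge> density_circle F - e / 2) at_top" by simp
  moreover have "eventually (\<lambda>p. prime p \<longrightarrow> density_mod F p \<le> density_circle F + e / 2) at_top"
    by (rule density_mod_upper[OF assms]) (use e in auto)
  ultimately show "eventually (\<lambda>p. dist (density_mod F p) (density_circle F) < e)
      (inf at_top (principal {p. prime p}))"
    unfolding eventually_inf_principal
    by eventually_elim (use e in \<open>auto simp: dist_real_def abs_less_iff\<close>)
qed

end
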